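(* Let $\Omega\subset\mathbb R^d$ ($d\ge1$) be a polyhedral domain with a conforming simplicial triangulation $\mathcal T_h$. Let $m\ge 0$ be an integer, $\boldsymbol r=(r_0,\dots,r_d)$ integers with $r_d=0$, $r_{d-1}=m$, $r_\ell\ge 2r_{\ell+1}$ for $\ell=d-2,\dots,0$, and $k\ge 2r_0+1$. For every sub-simplex $f\in\Delta_\ell(\mathcal T_h)$, $0\le \ell\le d-1$, fix a basis $N_f=\{\boldsymbol N_f^1,\dots,\boldsymbol N_f^{d-\ell}\}$ of the normal plane of $f$ depending only on $f$ (not on an element containing $f$). Then the degrees of freedom $$\mathtt G^{\alpha}(u):=\Big\langle \mathtt b^{\alpha_f},\ \frac{\partial^{|\gamma|}u}{\partial N_f^{\gamma}}\Big|_f\Big\rangle,\qquad \alpha=(\alpha_f,\gamma)\in\hat S_\ell([f]),\ f\in\Delta_\ell(\mathcal T_h),\ \ell=0,\dots,d,$$ define a $C^m$-conforming finite element space $\mathcal S_{k,\boldsymbol r}^d(\mathcal T_h)$. That is: for each $T\in\mathcal T_h$ the functionals $\mathtt G^\alpha$ with $\alpha\in\hat S_\ell([f])$, $f\in\Delta_\ell(T)$, $0\le\ell\le d$, uniquely determine the elements of $\mathbb P_k(T)$ (they form a basis of $\mathbb P_k(T)'$), and the space $$\mathcal S_{k,\boldsymbol r}^d(\mathcal T_h)=\{u:\ u|_T\in\mathbb P_k(T)\ \forall T\in\mathcal T_h,\ \text{and for all } f,\ \alpha\in \hat S_\ell([f]),\ \mathtt G^\alpha(u|_T)\text{ is the same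 for all }T\in\mathcal T_h\text{ containing }f\}$$ is contained in $C^m(\Omega)$.
   Context: $\mathcal T_h$ is a finite set of nondegenerate $d$-simplices with union $\overline\Omega$ such that the intersection of any two is empty or a common sub-simplex. $\Delta_\ell(T)$ and $\Delta_\ell(\mathcal T_h)$ denote the sets of $\ell$-dimensional sub-simplices of $T$ and of the triangulation. The vertices of the triangulation have a global numbering, and every sub-simplex $f$ has its vertices listed in ascending order of global index; $[f]$ denotes $f$ with this ordering. $\mathbb P_k(T)$ is the space of polynomials of degree $\le k$ on $T$. Lattice. $\mathbb T_j^p=\{\alpha\in\mathbb N^{p+1}:|\alpha|=j\}$ (with $0\in\mathbb N$). For an element $T$ with vertex index set $\{0,\dots,d\}$, components of $\alpha\in\mathbb T_k^d$ are indexed by the vertices of $T$. For an $\ell$-dimensional sub-simplex $f$, $f^*$ is the complementary vertex set, $R_f(\alpha)=\alpha_f$ is the tuple of components of $\alpha$ at the vertices of $f$ (in the order of $[f]$), and $\alpha_{f^*}$ is defined similarly. $\operatorname{dist}(\alpha,f)=|\alpha_{f^*}|$, $D(f,r)=\{\alpha\in\mathbb T_k^d:\operatorname{dist}(\alpha,f)\le r\}$, and $$S_\ell(f)=D(f,r_\ell)\setminus\bigcup_{i=0}^{\ell-1}\bigcup_{e\in\Delta_i(f)}D(e,r_i),$$ where $\Delta_i(f)$ is the set of $i$-dimensional sub-simplices of $f$. It is known that $\mathbb T_k^d$ is the disjoint union of the $S_\ell(f)$, $f\in\Delta_\ell(T)$, $0\le\ell\le d$. The set $R_f(S_\ell(f))$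 does not depend on the element $T$ containing $f$, and $$\hat S_\ell([f])=\{(\alpha_f,\gamma):\alpha_f\in R_f(S_\ell(f)),\ \gamma\in\mathbb T_{k-|\alpha_f|}^{d-\ell-1}\}.$$ For $\ell=d$, $\gamma$ is the empty multi-index and no derivative is taken. Functionals. For a degree $j$, the Bernstein basis of $\mathbb P_j(f)$ is $B_f^\mu=\frac{j!}{\mu!}\prod_{i=0}^{\ell}\lambda_{f(i)}^{\mu_i}$, $\mu\in\mathbb T_j^\ell$ ($\lambda_{f(i)}$ the barycentric coordinates of $f$), and $\{\mathtt b^\mu\}\subset\mathbb P_j(f)'$ is the dual basis: $\langle\mathtt b^\mu,B_f^\nu\rangle=\delta_{\mu,\nu}$. In $\mathtt G^\alpha$, $\mathtt b^{\alpha_f}$ acts on $\mathbb P_{k-|\gamma|}(f)$, $|\alpha_f|=k-|\gamma|$. The normal plane of $f$ is the orthogonal complement in $\mathbb R^d$ of its tangent space. For $|\gamma|=s$, $\frac{\partial^{s}u}{\partial N_f^\gamma}=\nabla^s u:\big((\boldsymbol N_f^1)^{\otimes\gamma_1}\otimes\cdots\otimes(\boldsymbol N_f^{d-\ell})^{\otimes\gamma_{d-\ell}}\big)$, with $:$ the Euclidean inner product of tensors. *)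

theory Defs
  imports "HOL-Analysis.Analysis"
begin

section \<open>Simplices\<close>

definition verts :: "(real ^ 'd) set \<Rightarrow> (real ^ 'd) set" where
  "verts S = {v. v extreme_point_of S}"

definition subsimplices :: "nat \<Rightarrow> (real ^ 'd) set \<Rightarrow> (real ^ 'd) set set" where
  "subsimplices l T = {f. f face_of T \<and> int l simplex f}"

definition mesh_subsimplices :: "nat \<Rightarrow> (real ^ 'd) set set \<Rightarrow> (real ^ 'd) set set" where
  "mesh_subsimplices l Th = (\<Union>T\<in>Th. subsimplices l T)"

text \<open>The ordered vertex list \<open>[f]\<close>; meaningful when the numbering \<open>num\<close> is injective
  on the vertices of \<open>f\<close>.\<close>

definition vlist :: "(real ^ 'd \<Rightarrow> nat) \<Rightarrow> (real ^ 'd) set \<Rightarrow> (real ^ 'd) list" where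
  "vlist num f = sorted_key_list_of_set num (verts f)"

definition tangent_space :: "(real ^ 'd) set \<Rightarrow> (real ^ 'd) set" where
  "tangent_space f = span {x - y | x y. x \<in> f \<and> y \<in> f}"

definition normal_plane :: "(real ^ 'd) set \<Rightarrow> (real ^ 'd) set" where
  "normal_plane f = orthogonal_comp (tangent_space f)"

definition barycentric :: "(real ^ 'd) set \<Rightarrow> real ^ 'd \<Rightarrow> real ^ 'd \<Rightarrow> real" where
  "barycentric f x = (THE w. (\<forall>v. v \<notin> verts f \<longrightarrow> w v = 0) \<and> sum w (verts f) = 1
      \<and> (\<Sum>v\<in>verts f. w v *\<^sub>R v) = x)"


section \<open>The simplicial lattice\<close>

text \<open>Multi-indices with \<open>n\<close> components, so that the lattice \<open>\<T>\<close> with lower index \<open>j\<close>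
  and upper index \<open>p\<close> is \<open>multi_indices (p + 1) j\<close>; the case \<open>p = -1\<close>, which occurs for
  the index \<open>\<gamma>\<close> when \<open>f\<close> is an element, is \<open>multi_indices 0 j\<close>.\<close>

definition multi_indices :: "nat \<Rightarrow> nat \<Rightarrow> nat list set" where
  "multi_indices n j = {xs. length xs = n \<and> sum_list xs = j}"

text \<open>Multi-indices whose components are indexed by the vertices of an element \<open>T\<close>
  are functions on points that vanish off the vertices.\<close>

definition lattice_on :: "nat \<Rightarrow> (real ^ 'd) set \<Rightarrow> (real ^ 'd \<Rightarrow> nat) set" where
  "lattice_on k T = {\<alpha>. (\<forall>v. v \<notin> verts T \<longrightarrow> \<alpha> v = 0) \<and> sum \<alpha> (verts T) = k}"

definition lattice_dist :: "(real ^ 'd) set \<Rightarrow> (real ^ 'd \<Rightarrow> nat) \<Rightarrow> (real ^ 'd) set \<Rightarrow> nat" where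
  "lattice_dist T \<alpha> f = sum \<alpha> (verts T - verts f)"

definition lattice_D ::
  "nat \<Rightarrow> (real ^ 'd) set \<Rightarrow> (real ^ 'd) set \<Rightarrow> nat \<Rightarrow> (real ^ 'd \<Rightarrow> nat) set" where
  "lattice_D k T f \<rho> = {\<alpha> \<in> lattice_on k T. lattice_dist T \<alpha> f \<le> \<rho>}"

definition lattice_S ::
  "nat \<Rightarrow> (nat \<Rightarrow> nat) \<Rightarrow> (real ^ 'd) set \<Rightarrow> nat \<Rightarrow> (real ^ 'd) set \<Rightarrow> (real ^ 'd \<Rightarrow> nat) set" where
  "lattice_S k r T l f =
     lattice_D k T f (r l) - (\<Union>i<l. \<Union>e\<in>subsimplices i f. lattice_D k T e (r i))"

definition lattice_R :: "(real ^ 'd \<Rightarrow> nat) \<Rightarrow> (real ^ 'd) set \<Rightarrow> (real ^ 'd \<Rightarrow> nat) \<Rightarrow> nat list" where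
  "lattice_R num f \<alpha> = map \<alpha> (vlist num f)"

text \<open>The element \<open>T\<close> containing \<open>f\<close> is only auxiliary in the following definition: see
  the lemma \<open>S_hat_indep\<close> below.\<close>

definition S_hat ::
  "(real ^ 'd \<Rightarrow> nat) \<Rightarrow> nat \<Rightarrow> (nat \<Rightarrow> nat) \<Rightarrow> (real ^ 'd) set \<Rightarrow> nat \<Rightarrow> (real ^ 'd) set
    \<Rightarrow> (nat list \<times> nat list) set" where
  "S_hat num k r T l f =
     {(a, \<gamma>). a \<in> lattice_R num f ` lattice_S k r T l f
        \<and> \<gamma> \<in> multi_indices (CARD('d) - l) (k - sum_list a)}"


lemma (in linorder) set_sorted_key_list:
  assumes "inj_on g A" "finite A"
  shows "set (sorted_key_list_of_set g A) = A"
proof -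
  interpret folding_insort_key "(\<le>)" "(<)" A g
    by standard (fact assms(1))
  show ?thesis using assms(2) by simp
qed

lemma simplex_verts:
  fixes S :: "(real ^ 'd) set"
  assumes "int n simplex S"
  shows "finite (verts S)" "card (verts S) = n + 1" "S = convex hull verts S"
proof -
  obtain C where C: "\<not> affine_dependent C" "int (card C) = int n + 1" "S = convex hull C"
    using assms unfolding simplex_def by blast
  have "verts S = C"
    using C extreme_point_of_convex_hull_affine_independent[OF C(1)] by (auto simp: verts_def)
  then show "finite (verts S)" "card (verts S) = n + 1" "S = convex hull verts S"
    using C aff_independent_finite by auto
qed

lemma verts_face: "f face_of T \<Longrightarrow> verts f = verts T \<inter> f"
  by (auto simp: verts_def extreme_point_of_face)

lemma lattice_S_transfer:
  fixes T T' :: "(real ^ 'd) set"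
  assumes T: "int CARD('d) simplex T" and T': "int CARD('d) simplex T'"
    and f: "f \<in> subsimplices l T" "f \<in> subsimplices l T'"
    and \<alpha>: "\<alpha> \<in> lattice_S k r T l f"
  obtains \<beta> where "\<beta> \<in> lattice_S k r T' l f" "\<And>v. v \<in> verts f \<Longrightarrow> \<beta> v = \<alpha> v"
proof -
  note fin = simplex_verts(1)[OF T] simplex_verts(1)[OF T']
  note crd = simplex_verts(2)[OF T] simplex_verts(2)[OF T']
  have sub: "verts f \<subseteq> verts T" "verts f \<subseteq> verts T'"
    using f verts_face by (auto simp: subsimplices_def)
  have fs: "int l simplex f" using f by (simp add: subsimplices_def)
  note ff = simplex_verts[OF fs]
  let ?n = "sum \<alpha> (verts T - verts f)"
  have cmp: "card (verts T - verts f) = card (verts T' - verts f)"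
    using fin crd sub by (simp add: card_Diff_subset finite_subset)
  obtain w where w: "verts T' - verts f = {} \<or> w \<in> verts T' - verts f" by blast
  define \<beta> where "\<beta> v = (if v \<in> verts f then \<alpha> v
     else if v = w \<and> w \<in> verts T' - verts f then ?n else 0)" for v
  have on_f: "\<beta> v = \<alpha> v" if "v \<in> verts f" for v using that by (simp add: \<beta>_def)
  have rest: "sum \<beta> (verts T' - verts f) = ?n"
  proof (cases "verts T' - verts f = {}")
    case True
    then have "verts T - verts f = {}" using cmp fin by (metis card_0_eq card.empty finite_Diff)
    with True show ?thesis by (metis sum.empty)
  next
    case False
    then have w: "w \<in> verts T' - verts f" using w by blast
    have "sum \<beta> (verts T' - verts f) = (\<Sum>v\<in>verts T' - verts f. if v = w then ?n else 0)"
      using w by (intro sum.cong) (auto simp: \<beta>_def)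
    then show ?thesis using w fin by simp
  qed
  have split: "sum g (A - B) = sum g (A - verts f) + sum g (verts f - B)"
    if "finite A" "verts f \<subseteq> A" "B \<subseteq> verts f" for g :: "real ^ 'd \<Rightarrow> nat" and A B
  proof -
    have "A - B = (A - verts f) \<union> (verts f - B)" using that by blast
    moreover have "sum g ((A - verts f) \<union> (verts f - B)) = sum g (A - verts f) + sum g (verts f - B)"
      using that ff(1) by (intro sum.union_disjoint) auto
    ultimately show ?thesis by simp
  qed
  have eq: "sum \<beta> (verts T' - B) = sum \<alpha> (verts T - B)" if "B \<subseteq> verts f" for B
    using split[OF fin(2) sub(2) that, of \<beta>] split[OF fin(1) sub(1) that, of \<alpha>] rest on_f
    by (auto intro!: sum.cong)
  have tot: "sum \<beta> (verts T') = sum \<alpha> (verts T)" using eq[of "{}"] by simp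
  have supp: "\<beta> v = 0" if "v \<notin> verts T'" for v using that sub by (auto simp: \<beta>_def)
  have ein: "verts e \<subseteq> verts f" if "e \<in> subsimplices i f" for e i
    using that verts_face by (auto simp: subsimplices_def)
  have D: "\<beta> \<in> lattice_D k T' e \<rho> \<longleftrightarrow> \<alpha> \<in> lattice_D k T e \<rho>" if "verts e \<subseteq> verts f" for e \<rho>
  proof -
    have "\<alpha> \<in> lattice_on k T" using \<alpha> by (simp add: lattice_S_def lattice_D_def)
    then show ?thesis using supp tot eq[OF that]
      by (simp add: lattice_D_def lattice_dist_def lattice_on_def)
  qed
  have "\<beta> \<in> lattice_S k r T' l f"
    using \<alpha> D[OF order_refl] D[OF ein] unfolding lattice_S_def by auto
  then show ?thesis using on_f that by blast
qed

lemma S_hat_indep: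
  fixes T T' :: "(real ^ 'd) set"
  assumes "int CARD('d) simplex T" "int CARD('d) simplex T'"
    and "f \<in> subsimplices l T" "f \<in> subsimplices l T'" and "inj_on num (verts f)"
  shows "S_hat num k r T l f = S_hat num k r T' l f"
proof -
  have fin: "finite (verts f)" using assms(3) simplex_verts(1) by (auto simp: subsimplices_def)
  have set: "set (vlist num f) = verts f"
    unfolding vlist_def using assms(5) fin by (rule set_sorted_key_list)
  have "lattice_R num f ` lattice_S k r A l f \<subseteq> lattice_R num f ` lattice_S k r B l f"
    if AB: "int CARD('d) simplex A" "int CARD('d) simplex B" "f \<in> subsimplices l A" "f \<in> subsimplices l B"
    for A B :: "(real ^ 'd) set"
  proof
    fix a assume "a \<in> lattice_R num f ` lattice_S k r A l f"
    then obtain \<alpha> where \<alpha>: "\<alpha> \<in> lattice_S k r A l f" "a = lattice_R num f \<alpha>" by blast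
    obtain \<beta> where "\<beta> \<in> lattice_S k r B l f" "\<And>v. v \<in> verts f \<Longrightarrow> \<beta> v = \<alpha> v"
      using lattice_S_transfer[OF AB \<alpha>(1)] by blast
    then show "a \<in> lattice_R num f ` lattice_S k r B l f"
      using \<alpha>(2) set by (intro image_eqI[of _ _ \<beta>]) (auto simp: lattice_R_def)
  qed
  then show ?thesis using assms unfolding S_hat_def by blast
qed


section \<open>Polynomials and their duals\<close>

text \<open>Functions on a set \<open>S\<close> are extensional functions (\<^term>\<open>undefined\<close> off \<open>S\<close>).\<close>

definition poly_space :: "nat \<Rightarrow> (real ^ 'd) set \<Rightarrow> (real ^ 'd \<Rightarrow> real) set" where
  "poly_space k S =
     {\<lambda>x\<in>S. \<Sum>a | sum a UNIV \<le> k. c a * (\<Prod>i\<in>UNIV. (x $ i) ^ a i) | c :: ('d \<Rightarrow> nat) \<Rightarrow> real. True}"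

text \<open>Linear functionals on a vector space \<open>V\<close> of functions on \<open>S\<close>. Only the values on \<open>V\<close>
  matter; functionals are identified when they agree on \<open>V\<close>.\<close>

definition dual_space ::
  "(real ^ 'd) set \<Rightarrow> (real ^ 'd \<Rightarrow> real) set \<Rightarrow> ((real ^ 'd \<Rightarrow> real) \<Rightarrow> real) set" where
  "dual_space S V =
     {\<phi>. \<forall>p\<in>V. \<forall>q\<in>V. \<forall>a b. \<phi> (\<lambda>x\<in>S. a * p x + b * q x) = a * \<phi> p + b * \<phi> q}"

definition basis_of_dual ::
  "(real ^ 'd) set \<Rightarrow> (real ^ 'd \<Rightarrow> real) set \<Rightarrow> 'i set \<Rightarrow> ('i \<Rightarrow> (real ^ 'd \<Rightarrow> real) \<Rightarrow> real) \<Rightarrow> bool"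
  where
  "basis_of_dual S V I F \<longleftrightarrow>
     finite I \<and> (\<forall>i\<in>I. F i \<in> dual_space S V)
     \<and> (\<forall>c. (\<forall>u\<in>V. (\<Sum>i\<in>I. c i * F i u) = 0) \<longrightarrow> (\<forall>i\<in>I. c i = 0))
     \<and> (\<forall>\<phi>\<in>dual_space S V. \<exists>c. \<forall>u\<in>V. \<phi> u = (\<Sum>i\<in>I. c i * F i u))"

definition bernstein ::
  "(real ^ 'd \<Rightarrow> nat) \<Rightarrow> (real ^ 'd) set \<Rightarrow> nat \<Rightarrow> nat list \<Rightarrow> real ^ 'd \<Rightarrow> real" where
  "bernstein num f j \<mu> =
     (\<lambda>x\<in>f. fact j / (\<Prod>i<length \<mu>. fact (\<mu> ! i))
        * (\<Prod>i<length \<mu>. barycentric f x (vlist num f ! i) ^ (\<mu> ! i)))"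

definition bernstein_dual ::
  "(real ^ 'd \<Rightarrow> nat) \<Rightarrow> (real ^ 'd) set \<Rightarrow> nat \<Rightarrow> nat list \<Rightarrow> (real ^ 'd \<Rightarrow> real) \<Rightarrow> real" where
  "bernstein_dual num f j \<mu> =
     (SOME b. b \<in> dual_space f (poly_space j f)
        \<and> (\<forall>\<nu>\<in>multi_indices (card (verts f)) j. b (bernstein num f j \<nu>) = (if \<nu> = \<mu> then 1 else 0)))"


section \<open>Derivatives and degrees of freedom\<close>

text \<open>Derivatives are taken within \<open>S\<close>, so that they make sense up to the boundary of an
  element \<open>S\<close> for a function that is given only there; for open \<open>S\<close> and for nondegenerate
  simplices \<open>S\<close> they are unique.\<close>

definition partial_deriv ::
  "(real ^ 'd) set \<Rightarrow> 'd \<Rightarrow> (real ^ 'd \<Rightarrow> real) \<Rightarrow> real ^ 'd \<Rightarrow> real" where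
  "partial_deriv S i u x = frechet_derivative u (at x within S) (axis i 1)"

text \<open>A tensor of order \<open>s\<close> is given by its components, indexed by lists of length \<open>s\<close>.\<close>

definition grad_tensor ::
  "(real ^ 'd) set \<Rightarrow> (real ^ 'd \<Rightarrow> real) \<Rightarrow> real ^ 'd \<Rightarrow> 'd list \<Rightarrow> real" where
  "grad_tensor S u x is = foldr (partial_deriv S) is u x"

definition tensor_prod :: "(real ^ 'd) list \<Rightarrow> 'd list \<Rightarrow> real" where
  "tensor_prod vs is = (\<Prod>j<length vs. (vs ! j) $ (is ! j))"

definition tensor_inner :: "nat \<Rightarrow> ('d::finite list \<Rightarrow> real) \<Rightarrow> ('d list \<Rightarrow> real) \<Rightarrow> real" where
  "tensor_inner s A B = (\<Sum>is | length is = s. A is * B is)"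

text \<open>In \<open>normal_deriv S Ns \<gamma> u\<close> the list \<open>concat (map2 replicate \<gamma> Ns)\<close> contains the
  \<open>i\<close>-th entry of \<open>Ns\<close> exactly \<open>\<gamma>\<^sub>i\<close> times.\<close>

definition normal_deriv ::
  "(real ^ 'd) set \<Rightarrow> (real ^ 'd) list \<Rightarrow> nat list \<Rightarrow> (real ^ 'd \<Rightarrow> real) \<Rightarrow> real ^ 'd \<Rightarrow> real" where
  "normal_deriv S Ns \<gamma> u x =
     tensor_inner (sum_list \<gamma>) (grad_tensor S u x) (tensor_prod (concat (map2 replicate \<gamma> Ns)))"

definition dof ::
  "(real ^ 'd \<Rightarrow> nat) \<Rightarrow> nat \<Rightarrow> ((real ^ 'd) set \<Rightarrow> (real ^ 'd) list) \<Rightarrow> (real ^ 'd) set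
    \<Rightarrow> (real ^ 'd) set \<times> nat list \<times> nat list \<Rightarrow> (real ^ 'd \<Rightarrow> real) \<Rightarrow> real" where
  "dof num k N T = (\<lambda>(f, a, \<gamma>) u.
     bernstein_dual num f (k - sum_list \<gamma>) a (\<lambda>x\<in>f. normal_deriv T (N f) \<gamma> u x))"

definition dof_index ::
  "(real ^ 'd \<Rightarrow> nat) \<Rightarrow> nat \<Rightarrow> (nat \<Rightarrow> nat) \<Rightarrow> (real ^ 'd) set
    \<Rightarrow> ((real ^ 'd) set \<times> nat list \<times> nat list) set" where
  "dof_index num k r T =
     (\<Union>l\<le>CARD('d). SIGMA f:subsimplices l T. S_hat num k r T l f)"

text \<open>A piecewise polynomial is a family \<open>u\<close> with one polynomial \<open>u T\<close> per element, so that a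
  priori it may take different values on the common boundary of two elements.\<close>

definition fe_space ::
  "(real ^ 'd) set set \<Rightarrow> (real ^ 'd \<Rightarrow> nat) \<Rightarrow> nat \<Rightarrow> (nat \<Rightarrow> nat)
    \<Rightarrow> ((real ^ 'd) set \<Rightarrow> (real ^ 'd) list) \<Rightarrow> ((real ^ 'd) set \<Rightarrow> real ^ 'd \<Rightarrow> real) set" where
  "fe_space Th num k r N =
     {u \<in> (\<Pi>\<^sub>E T\<in>Th. poly_space k T).
        \<forall>T\<in>Th. \<forall>T'\<in>Th. \<forall>l\<le>CARD('d). \<forall>f \<in> subsimplices l T \<inter> subsimplices l T'.
          \<forall>(a, \<gamma>) \<in> S_hat num k r T l f.
            dof num k N T (f, a, \<gamma>) (u T) = dof num k N T' (f, a, \<gamma>) (u T')}"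

text \<open>The class of \<open>m\<close> times continuously differentiable functions on an open set \<open>S\<close>.\<close>

primrec C_diff_on :: "nat \<Rightarrow> (real ^ 'd) set \<Rightarrow> (real ^ 'd \<Rightarrow> real) \<Rightarrow> bool" where
  "C_diff_on 0 S w \<longleftrightarrow> continuous_on S w"
| "C_diff_on (Suc m) S w \<longleftrightarrow>
     w differentiable_on S \<and> (\<forall>i. C_diff_on m S (partial_deriv S i w))"

end

theory Submission
  imports Defs
begin

text \<open>
  Each element \<open>T\<close> carries barycentric coordinates, and they extend to affine functions
  \<open>lam v\<close> on the whole space, so a polynomial of degree \<open>k\<close> is a combination of the
  monomials \<open>mon (verts T) \<alpha>\<close> with exponents \<open>\<alpha> \<in> lattice_on k T\<close>. Up to nonzero
  factors these are the Bernstein polynomials. Everything rests on one triangularity property: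
  at the interior points of a sub-simplex \<open>f\<close>, a monomial vanishes exactly to the order
  \<open>lattice_dist T \<alpha> f\<close>, so the derivatives of order \<open>s\<close> on \<open>f\<close> see only
  the coefficients at distance at most \<open>s\<close> from \<open>f\<close>.

  Suppose that all degrees of freedom on \<open>f\<close> and on its proper sub-simplices vanish. By
  induction on the dimension of \<open>f\<close>, and then on the distance \<open>s\<close> from
  \<open>f\<close>, all coefficients in \<open>lattice_D k T f (r l)\<close> vanish
  (\<open>coefficients_vanish_near_face\<close>). Indeed, an exponent at distance \<open>s\<close> either lies near a
  proper sub-simplex and has been treated before, or it lies in \<open>lattice_S k r T l f\<close>.
  In the second case the functional dual to \<open>\<alpha>\<close> on \<open>f\<close> annihilates all normal
  derivatives of order \<open>s\<close> along the given basis of the normal plane. By polarization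
  (\<open>polarization\<close>) it annihilates the pure derivatives \<open>\<partial>\<^sub>n\<^sup>s\<close> for every normal vector
  \<open>n\<close>. Their leading term is a homogeneous polynomial of degree \<open>s\<close> in \<open>n\<close>
  whose coefficients are the unknown ones. The coordinates of the vertices off \<open>f\<close> take
  arbitrary values on the normal plane, so this polynomial is zero only if its coefficients are
  (\<open>coefficient_at_distance\<close>).

  For \<open>f = T\<close> this says that a polynomial without nonzero degrees of freedom is zero. The
  doubling condition on \<open>r\<close> makes the sets \<open>lattice_S k r T l f\<close> disjoint
  (\<open>lattice_S_disjoint\<close>), hence there are at most as many functionals as coefficients, and the
  square system of linear equations turns injectivity into the basis property
  (\<open>unisolvence\<close>).

  For conformity, extend the polynomials on two elements \<open>T\<close> and \<open>T'\<close> to the whole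
  space and apply the same lemma to their difference and to the common face \<open>f = T \<inter> T'\<close>.
  All coefficients near \<open>f\<close> vanish, and with them \<^emph>\<open>all\<close> derivatives on \<open>f\<close> up to order
  \<open>r l\<close>, which is at least \<open>m\<close> (\<open>common_derivatives\<close>). At every point the polynomials of
  all elements around it therefore have the same derivatives up to order \<open>m\<close>, and this is
  enough to glue them, whether or not these elements are linked by common facets
  (\<open>piecewise_polynomial_C_diff\<close>).
\<close>

section \<open>Polynomial functions and directional derivatives\<close>

text \<open>Polynomial functions of degree at most \<open>n\<close>, generated by multiplication with affine
  functions. Facts about derivatives then follow by induction from the product rule, and
  expansions in coordinates or in barycentric coordinates follow by expanding a single affine
  factor.\<close>

inductive poly_deg :: "nat \<Rightarrow> (real ^ 'd \<Rightarrow> real) \<Rightarrow> bool" where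
  const: "poly_deg n (\<lambda>_. c)"
| add: "poly_deg n p \<Longrightarrow> poly_deg n q \<Longrightarrow> poly_deg n (\<lambda>x. p x + q x)"
| affine_mult: "poly_deg n p \<Longrightarrow> poly_deg (Suc n) (\<lambda>x. (g \<bullet> x + b) * p x)"

definition dir_deriv :: "real ^ 'd \<Rightarrow> (real ^ 'd \<Rightarrow> real) \<Rightarrow> real ^ 'd \<Rightarrow> real" where
  "dir_deriv v p x = frechet_derivative p (at x) v"

lemma poly_deg_0_const: "poly_deg n p \<Longrightarrow> n = 0 \<Longrightarrow> \<exists>c. p = (\<lambda>_. c)"
  by (induction rule: poly_deg.induct) auto

lemma poly_deg_scale: "poly_deg n p \<Longrightarrow> poly_deg n (\<lambda>x. c * p x)"
proof (induction rule: poly_deg.induct)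
  case (add n p q)
  from poly_deg.add[OF add.IH] show ?case by (simp add: algebra_simps)
next
  case (affine_mult n p g b)
  from poly_deg.affine_mult[OF affine_mult.IH, of g b] show ?case by (simp add: algebra_simps)
qed (rule poly_deg.const)

lemma poly_deg_Suc: "poly_deg n p \<Longrightarrow> poly_deg (Suc n) p"
  using poly_deg.affine_mult[of n p 0 1] by simp

lemma poly_deg_mono: "poly_deg n p \<Longrightarrow> n \<le> m \<Longrightarrow> poly_deg m p"
  by (induction m) (auto simp: le_Suc_eq intro: poly_deg_Suc)

lemma poly_deg_sum: "(\<And>i. i \<in> I \<Longrightarrow> poly_deg n (p i)) \<Longrightarrow> poly_deg n (\<lambda>x. \<Sum>i\<in>I. p i x)"
  by (induction I rule: infinite_finite_induct) (auto intro: poly_deg.intros)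

lemma poly_deg_mult: "poly_deg n p \<Longrightarrow> poly_deg m q \<Longrightarrow> poly_deg (n + m) (\<lambda>x. p x * q x)"
proof (induction rule: poly_deg.induct)
  case (const n c)
  show ?case by (rule poly_deg_mono[OF poly_deg_scale[OF const]]) simp
next
  case (add n p q')
  then show ?case using poly_deg.add[of "n + m"] by (simp add: algebra_simps)
next
  case (affine_mult n p g b)
  then show ?case using poly_deg.affine_mult[of "n + m" "\<lambda>x. p x * q x" g b] by (simp add: algebra_simps)
qed

lemma poly_deg_affine: "poly_deg 1 (\<lambda>x. g \<bullet> x + b)"
  using poly_deg.affine_mult[OF poly_deg.const[of 0 1], of g b] by simp

lemma poly_deg_power: "poly_deg 1 p \<Longrightarrow> poly_deg n (\<lambda>x. p x ^ n)"
proof (induction n)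
  case 0
  then show ?case by (simp add: poly_deg.const)
next
  case (Suc n)
  then show ?case using poly_deg_mult[of 1 p n "\<lambda>x. p x ^ n"] by simp
qed

lemma poly_deg_prod: "(\<And>i. i \<in> I \<Longrightarrow> poly_deg (n i) (p i)) \<Longrightarrow> poly_deg (sum n I) (\<lambda>x. \<Prod>i\<in>I. p i x)"
proof (induction I rule: infinite_finite_induct)
  case (insert i I)
  then show ?case using poly_deg_mult[of "n i" "p i" "sum n I"] by simp
qed (auto intro: poly_deg.const)

text \<open>The truncated \<open>n - 1\<close> is correct also for \<open>n = 0\<close>, where the derivative is zero; this is
  the only point where the induction has to look at constants separately.\<close>

lemma poly_deg_has_derivative:
  "poly_deg n p \<Longrightarrow> \<exists>D. (\<forall>x. (p has_derivative D x) (at x)) \<and> (\<forall>v. poly_deg (n - 1) (\<lambda>x. D x v))"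
proof (induction rule: poly_deg.induct)
  case (const n c)
  show ?case by (rule exI[of _ "\<lambda>_ _. 0"]) (auto intro: poly_deg.const)
next
  case (add n p q)
  then obtain D E where "\<forall>x. (p has_derivative D x) (at x)" "\<forall>v. poly_deg (n - 1) (\<lambda>x. D x v)"
    "\<forall>x. (q has_derivative E x) (at x)" "\<forall>v. poly_deg (n - 1) (\<lambda>x. E x v)" by blast
  then show ?case
    by (intro exI[of _ "\<lambda>x v. D x v + E x v"]) (auto intro: poly_deg.add has_derivative_add)
next
  case (affine_mult n p g b)
  then obtain D where D: "\<And>x. (p has_derivative D x) (at x)" "\<And>v. poly_deg (n - 1) (\<lambda>x. D x v)" by blast
  have "((\<lambda>x. (g \<bullet> x + b) * p x) has_derivative (\<lambda>v. (g \<bullet> x + b) * D x v + (g \<bullet> v) * p x)) (at x)" for x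
    by (auto intro!: derivative_eq_intros D)
  moreover have "poly_deg n (\<lambda>x. (g \<bullet> x + b) * D x v + (g \<bullet> v) * p x)" for v
  proof (cases n)
    case 0
    then obtain c where c: "p = (\<lambda>_. c)" using poly_deg_0_const affine_mult.hyps by blast
    have "D x = (\<lambda>_. 0)" for x
      using D(1)[of x] has_derivative_unique unfolding c by (metis has_derivative_const)
    then show ?thesis using c by (simp add: poly_deg.const)
  next
    case (Suc n')
    then show ?thesis
      using poly_deg.affine_mult[OF D(2), of g b v] affine_mult.hyps by (auto intro!: poly_deg.add poly_deg_scale)
  qed
  ultimately show ?case
    by (intro exI[of _ "\<lambda>x v. (g \<bullet> x + b) * D x v + (g \<bullet> v) * p x"]) auto
qed

lemma dir_deriv_eq: "(p has_derivative D) (at x) \<Longrightarrow> dir_deriv v p x = D v"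
  by (metis dir_deriv_def frechet_derivative_at)

lemma poly_deg_deriv: "poly_deg n p \<Longrightarrow> (p has_derivative (\<lambda>v. dir_deriv v p x)) (at x)"
  using poly_deg_has_derivative[of n p] dir_deriv_eq[of p _ x] by (metis (full_types) ext)

lemma poly_deg_dir_deriv: "poly_deg n p \<Longrightarrow> poly_deg (n - 1) (dir_deriv v p)"
proof -
  assume p: "poly_deg n p"
  obtain D where D: "\<And>x. (p has_derivative D x) (at x)" "\<And>v. poly_deg (n - 1) (\<lambda>x. D x v)"
    using poly_deg_has_derivative[OF p] by blast
  have "dir_deriv v p = (\<lambda>x. D x v)" using dir_deriv_eq[OF D(1)] by auto
  then show ?thesis using D by simp
qed

lemma poly_deg_continuous: "poly_deg n p \<Longrightarrow> continuous_on S p"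
  by (meson poly_deg_deriv has_derivative_continuous continuous_at_imp_continuous_on)

lemma dir_deriv_add:
  assumes "poly_deg n p" "poly_deg m q" shows "dir_deriv v (\<lambda>x. p x + q x) = (\<lambda>x. dir_deriv v p x + dir_deriv v q x)"
  by (rule ext, rule dir_deriv_eq[of _ "\<lambda>v. dir_deriv v p x + dir_deriv v q x" for x])
     (intro has_derivative_add poly_deg_deriv[OF assms(1)] poly_deg_deriv[OF assms(2)])

lemma dir_deriv_mult:
  assumes "poly_deg n p" "poly_deg m q"
  shows "dir_deriv v (\<lambda>x. p x * q x) = (\<lambda>x. p x * dir_deriv v q x + dir_deriv v p x * q x)"
  by (rule ext, rule dir_deriv_eq[of _ "\<lambda>v. p x * dir_deriv v q x + dir_deriv v p x * q x" for x])
     (intro has_derivative_mult poly_deg_deriv[OF assms(1)] poly_deg_deriv[OF assms(2)])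

lemma dir_deriv_const: "dir_deriv v (\<lambda>_. c) = (\<lambda>_. 0)"
  by (rule ext, rule dir_deriv_eq[of _ "\<lambda>_. 0"]) simp

lemma dir_deriv_scale: "poly_deg n p \<Longrightarrow> dir_deriv v (\<lambda>x. c * p x) = (\<lambda>x. c * dir_deriv v p x)"
  using dir_deriv_mult[OF poly_deg.const[of 0 c], of n p v] by (simp add: dir_deriv_const)

lemma dir_deriv_affine: "dir_deriv v (\<lambda>x. g \<bullet> x + b) = (\<lambda>_. g \<bullet> v)"
  by (rule ext, rule dir_deriv_eq[of _ "\<lambda>v. g \<bullet> v"]) (auto intro!: derivative_eq_intros)

lemma dir_deriv_sum:
  "(\<And>i. i \<in> I \<Longrightarrow> poly_deg n (p i)) \<Longrightarrow> dir_deriv v (\<lambda>x. \<Sum>i\<in>I. p i x) = (\<lambda>x. \<Sum>i\<in>I. dir_deriv v (p i) x)"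
proof (induction I rule: infinite_finite_induct)
  case (insert i I)
  then show ?case using dir_deriv_add[of n "p i" n "\<lambda>x. \<Sum>i\<in>I. p i x" v] poly_deg_sum[of I n p] by auto
qed (auto simp: dir_deriv_const)

lemma dir_deriv_linear:
  assumes "poly_deg n p" shows "linear (\<lambda>v. dir_deriv v p x)"
  using poly_deg_deriv[OF assms] has_derivative_linear by blast

lemma dir_deriv_commute: "poly_deg n p \<Longrightarrow> dir_deriv v (dir_deriv w p) = dir_deriv w (dir_deriv v p)"
proof (induction rule: poly_deg.induct)
  case (const n c)
  then show ?case by (simp add: dir_deriv_const)
next
  case (add n p q)
  then show ?case
    by (simp add: dir_deriv_add[of n p n q] dir_deriv_add[OF poly_deg_dir_deriv poly_deg_dir_deriv, of n p n q])
next
  case (affine_mult n p g b)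
  have D: "dir_deriv v (\<lambda>x. (g \<bullet> x + b) * p x) = (\<lambda>x. (g \<bullet> x + b) * dir_deriv v p x + (g \<bullet> v) * p x)" for v
    by (simp add: dir_deriv_mult[OF poly_deg_affine affine_mult.hyps] dir_deriv_affine)
  have "dir_deriv v (\<lambda>x. (g \<bullet> x + b) * dir_deriv w p x + (g \<bullet> w) * p x)
    = (\<lambda>x. (g \<bullet> x + b) * dir_deriv v (dir_deriv w p) x + (g \<bullet> v) * dir_deriv w p x + (g \<bullet> w) * dir_deriv v p x)" for v w
    using affine_mult.hyps
    by (simp add: dir_deriv_add[OF poly_deg_mult[OF poly_deg_affine poly_deg_dir_deriv] poly_deg_scale]
        dir_deriv_mult[OF poly_deg_affine poly_deg_dir_deriv] dir_deriv_scale dir_deriv_affine)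
  then show ?case unfolding D using affine_mult.IH by (auto simp: algebra_simps)
qed

abbreviation dir_derivs :: "(real ^ 'd) list \<Rightarrow> (real ^ 'd \<Rightarrow> real) \<Rightarrow> real ^ 'd \<Rightarrow> real" where
  "dir_derivs vs \<equiv> foldr dir_deriv vs"

lemma poly_deg_dir_derivs: "poly_deg n p \<Longrightarrow> poly_deg (n - length vs) (dir_derivs vs p)"
proof (induction vs)
  case (Cons v vs)
  then show ?case using poly_deg_dir_deriv[of "n - length vs" "dir_derivs vs p" v] by simp
qed auto

lemma dir_derivs_add:
  assumes "poly_deg n p" "poly_deg n q"
  shows "dir_derivs vs (\<lambda>x. p x + q x) = (\<lambda>x. dir_derivs vs p x + dir_derivs vs q x)"
  by (induction vs) (simp_all add: dir_deriv_add[OF poly_deg_dir_derivs[OF assms(1)] poly_deg_dir_derivs[OF assms(2)]])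

lemma dir_derivs_scale:
  assumes "poly_deg n p" shows "dir_derivs vs (\<lambda>x. c * p x) = (\<lambda>x. c * dir_derivs vs p x)"
  by (induction vs) (simp_all add: dir_deriv_scale[OF poly_deg_dir_derivs[OF assms]])

lemma dir_derivs_diff:
  assumes "poly_deg n p" "poly_deg n q"
  shows "dir_derivs vs (\<lambda>x. p x - q x) = (\<lambda>x. dir_derivs vs p x - dir_derivs vs q x)"
  using dir_derivs_add[OF assms(1) poly_deg_scale[OF assms(2), of "-1"], of vs]
    dir_derivs_scale[OF assms(2), of vs "-1"] by simp

lemma dir_derivs_sum:
  assumes "\<And>i. i \<in> I \<Longrightarrow> poly_deg n (p i)"
  shows "dir_derivs vs (\<lambda>x. \<Sum>i\<in>I. p i x) = (\<lambda>x. \<Sum>i\<in>I. dir_derivs vs (p i) x)"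
  proof (induction vs)
  case (Cons v vs)
  have "dir_deriv v (\<lambda>x. \<Sum>i\<in>I. dir_derivs vs (p i) x) = (\<lambda>x. \<Sum>i\<in>I. dir_deriv v (dir_derivs vs (p i)) x)"
    by (rule dir_deriv_sum) (rule poly_deg_dir_derivs[OF assms])
  then show ?case using Cons by simp
qed simp

lemma dir_deriv_dir_derivs_commute:
  assumes "poly_deg n p" shows "dir_deriv v (dir_derivs vs p) = dir_derivs vs (dir_deriv v p)"
  by (induction vs) (simp_all flip: dir_deriv_commute[OF poly_deg_dir_derivs[OF assms]])

lemma dir_derivs_move_to_front: "poly_deg n p \<Longrightarrow> dir_derivs (us @ v # ws) p = dir_derivs (v # us @ ws) p"
  using dir_deriv_dir_derivs_commute[OF poly_deg_dir_derivs, of n p v us ws] by simp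

text \<open>Since directional derivatives of polynomials commute, an iterated derivative depends only on
  the multiset of its directions.\<close>

lemma dir_derivs_mset: "poly_deg n p \<Longrightarrow> mset us = mset vs \<Longrightarrow> dir_derivs us p = dir_derivs vs p"
proof (induction us arbitrary: vs)
  case (Cons u us)
  then have "u \<in> set vs" by (metis list.set_intros(1) mset_eq_setD)
  then obtain xs ys where vs: "vs = xs @ u # ys" by (meson split_list)
  then have "mset us = mset (xs @ ys)" using Cons.prems by simp
  then have "dir_derivs us p = dir_derivs (xs @ ys) p" using Cons by blast
  then show ?case using Cons.prems dir_derivs_move_to_front[of n p xs u ys] by (simp add: vs)
qed auto

section \<open>Square linear systems and independence of monomials\<close>

text \<open>Gaussian elimination: an equation with a nonzero coefficient is used to eliminate one unknown.\<close>

lemma underdetermined_system: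
  fixes M :: "'i \<Rightarrow> 'l \<Rightarrow> real"
  assumes "finite I" "finite L" "card I < card L"
  shows "\<exists>c. (\<exists>l\<in>L. c l \<noteq> 0) \<and> (\<forall>i\<in>I. (\<Sum>l\<in>L. M i l * c l) = 0)"
  using assms
proof (induction I arbitrary: L M rule: finite_induct)
  case empty
  then show ?case by (intro exI[of _ "\<lambda>_. 1"]) (auto simp: card_gt_0_iff)
next
  case (insert i I)
  show ?case
  proof (cases "\<forall>l\<in>L. M i l = 0")
    case True
    moreover have "card I < card L" using insert by simp
    ultimately show ?thesis using insert.IH[of L M] insert.prems by simp
  next
    case False
    then obtain l0 where l0: "l0 \<in> L" "M i l0 \<noteq> 0" by blast
    define L' where "L' = L - {l0}"
    have L': "finite L'" "card I < card L'" "L = insert l0 L'" "l0 \<notin> L'"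
      using insert.prems insert.hyps l0 by (auto simp: L'_def)
    from insert.IH[OF L'(1,2), of "\<lambda>j l. M j l - M j l0 * M i l / M i l0"]
    obtain c where c: "\<exists>l\<in>L'. c l \<noteq> 0"
      "\<And>j. j \<in> I \<Longrightarrow> (\<Sum>l\<in>L'. (M j l - M j l0 * M i l / M i l0) * c l) = 0" by blast
    define s where "s = (\<Sum>l\<in>L'. M i l * c l)"
    define c' where "c' = c(l0 := - s / M i l0)"
    have sum: "(\<Sum>l\<in>L. M j l * c' l) = (\<Sum>l\<in>L'. M j l * c l) - M j l0 * s / M i l0" for j
    proof -
      have "(\<Sum>l\<in>L'. M j l * c' l) = (\<Sum>l\<in>L'. M j l * c l)"
        using L'(4) by (intro sum.cong) (auto simp: c'_def)
      then show ?thesis using L' by (simp add: c'_def)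
    qed
    have "(\<Sum>l\<in>L. M j l * c' l) = 0" if "j \<in> I" for j
    proof -
      have "(\<Sum>l\<in>L'. (M j l - M j l0 * M i l / M i l0) * c l)
        = (\<Sum>l\<in>L'. M j l * c l) - (\<Sum>l\<in>L'. M j l0 / M i l0 * (M i l * c l))"
        by (simp add: sum_subtractf algebra_simps)
      then show ?thesis using c(2)[OF that] sum[of j]
        by (simp add: s_def sum_distrib_left sum_divide_distrib)
    qed
    moreover have "(\<Sum>l\<in>L. M i l * c' l) = 0" using sum[of i] l0 by (simp add: s_def)
    moreover have "\<exists>l\<in>L. c' l \<noteq> 0"
      using c(1) L' by (auto simp: c'_def)
    ultimately show ?thesis by blast
  qed
qed

text \<open>Both conclusions apply the preceding lemma to a system with one equation less or one unknown
  more: a dependency among the rows makes one equation redundant, and a right-hand side, adjoined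
  as one further unknown of the transposed system, must enter a nontrivial solution.\<close>

lemma trivial_kernel_square_system:
  fixes M :: "'i \<Rightarrow> 'l \<Rightarrow> real"
  assumes fin: "finite I" "finite L" and card: "card I \<le> card L"
    and ker: "\<And>c. (\<forall>i\<in>I. (\<Sum>l\<in>L. M i l * c l) = 0) \<Longrightarrow> \<forall>l\<in>L. c l = 0"
  shows "(\<forall>l\<in>L. (\<Sum>i\<in>I. c i * M i l) = 0) \<Longrightarrow> \<forall>i\<in>I. c i = 0"
    and "\<exists>c. \<forall>l\<in>L. b l = (\<Sum>i\<in>I. c i * M i l)"
proof -
  show left: "\<forall>i\<in>I. c i = 0" if c: "\<forall>l\<in>L. (\<Sum>i\<in>I. c i * M i l) = 0" for c
  proof (rule ccontr)
    assume "\<not> (\<forall>i\<in>I. c i = 0)"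
    then obtain i0 where i0: "i0 \<in> I" "c i0 \<noteq> 0" by blast
    then have "card (I - {i0}) < card L" using card fin card_Diff1_less[OF fin(1) i0(1)] by linarith
    then obtain x where x: "\<exists>l\<in>L. x l \<noteq> 0" "\<forall>i\<in>I-{i0}. (\<Sum>l\<in>L. M i l * x l) = 0"
      using underdetermined_system[of "I - {i0}" L M] fin by auto
    \<comment> \<open>A solution of the other equations also solves equation \<open>i0\<close>, a combination of them.\<close>
    have "0 = (\<Sum>l\<in>L. (\<Sum>i\<in>I. c i * M i l) * x l)" using c by simp
    also have "\<dots> = (\<Sum>i\<in>I. c i * (\<Sum>l\<in>L. M i l * x l))"
      by (simp add: sum_distrib_left sum_distrib_right mult.assoc sum.swap[of _ I L])
    also have "\<dots> = c i0 * (\<Sum>l\<in>L. M i0 l * x l)"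
      using x(2) fin i0 by (subst sum.remove[of I i0]) auto
    finally have "(\<Sum>l\<in>L. M i0 l * x l) = 0" using i0 by simp
    then have "\<forall>i\<in>I. (\<Sum>l\<in>L. M i l * x l) = 0" using x(2) by blast
    then show False using ker x(1) by blast
  qed
  have cardIL: "card L \<le> card I"
    using underdetermined_system[OF fin, of M] ker by (meson not_le)
  \<comment> \<open>The unknown \<open>None\<close> is the factor of the right-hand side.\<close>
  let ?M = "\<lambda>l j. case j of None \<Rightarrow> b l | Some i \<Rightarrow> M i l"
  have "card L < card (insert None (Some ` I))"
    using cardIL fin by (simp add: card_image)
  then obtain x where x: "\<exists>j\<in>insert None (Some ` I). x j \<noteq> 0"
    "\<forall>l\<in>L. (\<Sum>j\<in>insert None (Some ` I). ?M l j * x j) = 0"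
    using underdetermined_system[OF fin(2), of "insert None (Some ` I)" ?M] fin by auto
  have eq: "b l * x None + (\<Sum>i\<in>I. x (Some i) * M i l) = 0" if "l \<in> L" for l
    using x(2) that fin by (simp add: sum.reindex mult.commute)
  have nz: "x None \<noteq> 0"
  proof
    assume 0: "x None = 0"
    then have "\<forall>i\<in>I. x (Some i) = 0" using left[of "\<lambda>i. x (Some i)"] eq by simp
    then show False using x(1) 0 by auto
  qed
  have "b l = (\<Sum>i\<in>I. - x (Some i) / x None * M i l)" if "l \<in> L" for l
  proof -
    have "(\<Sum>i\<in>I. - x (Some i) / x None * M i l) = - (\<Sum>i\<in>I. x (Some i) * M i l) / x None"
      by (simp add: sum_divide_distrib flip: sum_negf)
    moreover have "(\<Sum>i\<in>I. x (Some i) * M i l) = - b l * x None" using eq[OF that] by simp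
    ultimately show ?thesis using nz by simp
  qed
  then show "\<exists>c. \<forall>l\<in>L. b l = (\<Sum>i\<in>I. c i * M i l)" by (intro exI[of _ "\<lambda>i. - x (Some i) / x None"]) blast
qed

text \<open>Exponents are compared through their restrictions to \<open>W\<close>. In this form the induction on \<open>W\<close> needs no change of the exponents: the coefficients of the
  powers of one variable give the same statement for the exponents with a fixed value at it.
  Positive arguments suffice, which allows evaluation at interior points of a simplex.\<close>

lemma monomials_independent:
  fixes c :: "('w \<Rightarrow> nat) \<Rightarrow> real"
  assumes "finite W" "finite A" "inj_on (\<lambda>\<alpha>. restrict \<alpha> W) A"
    and "\<And>t. (\<And>w. w \<in> W \<Longrightarrow> t w > 0) \<Longrightarrow> (\<Sum>\<alpha>\<in>A. c \<alpha> * (\<Prod>w\<in>W. t w ^ \<alpha> w)) = 0"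
    and "\<alpha> \<in> A"
  shows "c \<alpha> = 0"
  using assms
proof (induction W arbitrary: A rule: finite_induct)
  case empty
  then have "A = {\<alpha>}" by (auto simp: inj_on_def)
  then show ?case using empty.prems(3)[of "\<lambda>_. 1"] by simp
next
  case (insert w W)
  define An where "An = {\<beta> \<in> A. \<beta> w = \<alpha> w}"
  have "inj_on (\<lambda>\<beta>. restrict \<beta> W) An"
  proof (rule inj_onI)
    fix \<beta> \<beta>' assume *: "\<beta> \<in> An" "\<beta>' \<in> An" "restrict \<beta> W = restrict \<beta>' W"
    have "\<beta> v = \<beta>' v" if "v \<in> insert w W" for v
    proof (cases "v = w")
      case True then show ?thesis using * by (simp add: An_def)
    next
      case False
      then have "restrict \<beta> W v = \<beta> v" "restrict \<beta>' W v = \<beta>' v" using that by auto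
      then show ?thesis using * by metis
    qed
    then have "restrict \<beta> (insert w W) = restrict \<beta>' (insert w W)"
      unfolding restrict_def by auto
    then show "\<beta> = \<beta>'" by (rule inj_onD[OF insert.prems(2)]) (use * in \<open>auto simp: An_def\<close>)
  qed
  moreover have "(\<Sum>\<beta>\<in>An. c \<beta> * (\<Prod>v\<in>W. t v ^ \<beta> v)) = 0" if t: "\<And>v. v \<in> W \<Longrightarrow> t v > 0" for t
  proof -
    define P where "P = (\<Sum>\<beta>\<in>A. monom (c \<beta> * (\<Prod>v\<in>W. t v ^ \<beta> v)) (\<beta> w))"
    have "poly P s = 0" if s: "s > 0" for s
    proof -
      have "(\<Prod>v\<in>insert w W. (t(w := s)) v ^ \<beta> v) = s ^ \<beta> w * (\<Prod>v\<in>W. t v ^ \<beta> v)" for \<beta>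
      proof -
        have "(\<Prod>v\<in>W. (t(w := s)) v ^ \<beta> v) = (\<Prod>v\<in>W. t v ^ \<beta> v)"
          using insert.hyps by (intro prod.cong) auto
        then show ?thesis using insert.hyps by simp
      qed
      then have "poly P s = (\<Sum>\<beta>\<in>A. c \<beta> * (\<Prod>v\<in>insert w W. (t(w := s)) v ^ \<beta> v))"
        unfolding P_def poly_sum poly_monom by (intro sum.cong) (simp_all add: mult_ac)
      also have "\<dots> = 0" using t s by (intro insert.prems(3)) auto
      finally show ?thesis .
    qed
    then have "{0<..} \<subseteq> {s. poly P s = 0}" by auto
    then have "P = 0"
      using poly_roots_finite[of P] infinite_Ioi[of "0::real"] finite_subset by blast
    then have "0 = coeff P (\<alpha> w)" by simp
    also have "\<dots> = (\<Sum>\<beta>\<in>A. if \<beta> w = \<alpha> w then c \<beta> * (\<Prod>v\<in>W. t v ^ \<beta> v) else 0)"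
      by (simp add: P_def coeff_sum coeff_monom)
    also have "\<dots> = (\<Sum>\<beta>\<in>An. c \<beta> * (\<Prod>v\<in>W. t v ^ \<beta> v))"
      unfolding An_def using insert.prems(1) by (simp add: sum.inter_filter)
    finally show ?thesis by simp
  qed
  moreover have "finite An" "\<alpha> \<in> An" using insert.prems by (auto simp: An_def)
  ultimately show ?case using insert.IH[of An] by blast
qed

section \<open>Monomial expansions\<close>

definition expansion :: "'i set \<Rightarrow> ('i \<Rightarrow> 'x \<Rightarrow> real) \<Rightarrow> 'x set \<Rightarrow> ('x \<Rightarrow> real) \<Rightarrow> bool" where
  "expansion A m X p \<longleftrightarrow> (\<exists>c. \<forall>x\<in>X. p x = (\<Sum>a\<in>A. c a * m a x))"

lemma expansion_zero: "expansion A m X (\<lambda>_. 0)"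
  unfolding expansion_def by (rule exI[of _ "\<lambda>_. 0"]) simp

lemma expansion_add: "expansion A m X p \<Longrightarrow> expansion A m X q \<Longrightarrow> expansion A m X (\<lambda>x. p x + q x)"
proof -
  assume "expansion A m X p" "expansion A m X q"
  then obtain c d where "\<forall>x\<in>X. p x = (\<Sum>a\<in>A. c a * m a x)" "\<forall>x\<in>X. q x = (\<Sum>a\<in>A. d a * m a x)"
    by (auto simp: expansion_def)
  then show ?thesis unfolding expansion_def
    by (intro exI[of _ "\<lambda>a. c a + d a"]) (simp add: sum.distrib algebra_simps)
qed

lemma expansion_scale: "expansion A m X p \<Longrightarrow> expansion A m X (\<lambda>x. s * p x)"
proof -
  assume "expansion A m X p"
  then obtain c where "\<forall>x\<in>X. p x = (\<Sum>a\<in>A. c a * m a x)"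
    by (auto simp: expansion_def)
  then show ?thesis unfolding expansion_def
    by (intro exI[of _ "\<lambda>a. s * c a"]) (simp add: sum_distrib_left algebra_simps)
qed

lemma expansion_sum:
  "(\<And>i. i \<in> I \<Longrightarrow> expansion A m X (p i)) \<Longrightarrow> expansion A m X (\<lambda>x. \<Sum>i\<in>I. p i x)"
  by (induction I rule: infinite_finite_induct) (auto intro: expansion_zero expansion_add)

lemma expansion_member: "finite A \<Longrightarrow> a \<in> A \<Longrightarrow> expansion A m X (m a)"
  unfolding expansion_def
  by (rule exI[of _ "\<lambda>b. if b = a then 1 else 0"]) (simp add: if_distrib[of "\<lambda>c. c * _"] cong: if_cong)

lemma expansion_cong:
  "expansion A m X p \<Longrightarrow> (\<And>x. x \<in> X \<Longrightarrow> p x = q x) \<Longrightarrow> expansion A m X q"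
  by (auto simp: expansion_def)

lemma expansion_trans:
  assumes "expansion A m X p" "\<And>a. a \<in> A \<Longrightarrow> expansion B m' X (\<lambda>x. h x * m a x)"
  shows "expansion B m' X (\<lambda>x. h x * p x)"
proof -
  obtain c where c: "\<forall>x\<in>X. p x = (\<Sum>a\<in>A. c a * m a x)" using assms(1) by (auto simp: expansion_def)
  have "expansion B m' X (\<lambda>x. \<Sum>a\<in>A. c a * (h x * m a x))"
    by (intro expansion_sum expansion_scale assms(2))
  then show ?thesis
    by (rule expansion_cong) (simp add: c sum_distrib_left algebra_simps)
qed

text \<open>The common core of two expansions, in the monomials of the Cartesian coordinates and in those of
  the barycentric coordinates: it is enough to expand the product of an affine function and one
  monomial.\<close>

lemma poly_deg_expansion:
  assumes "\<And>n c. expansion (A n) m X (\<lambda>_. c)"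
    and "\<And>n a g b. a \<in> A n \<Longrightarrow> expansion (A (Suc n)) m X (\<lambda>x. (g \<bullet> x + b) * m a x)"
  shows "poly_deg n p \<Longrightarrow> expansion (A n) m X p"
proof (induction rule: poly_deg.induct)
  case (affine_mult n p g b)
  show ?case by (rule expansion_trans[OF affine_mult.IH]) (rule assms(2))
qed (auto intro: assms expansion_add)

lemma prod_power_incr:
  fixes f :: "'j \<Rightarrow> real"
  assumes "finite J" "j \<in> J"
  shows "(\<Prod>i\<in>J. f i ^ (a(j := Suc (a j))) i) = f j * (\<Prod>i\<in>J. f i ^ a i)"
proof -
  have "(\<Prod>i\<in>J-{j}. f i ^ (a(j := Suc (a j))) i) = (\<Prod>i\<in>J-{j}. f i ^ a i)"
    by (intro prod.cong) auto
  then show ?thesis using assms by (simp add: prod.remove[of J j] mult_ac)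
qed

lemma sum_incr:
  fixes a :: "'j \<Rightarrow> nat"
  assumes "finite J" "j \<in> J"
  shows "sum (a(j := Suc (a j))) J = Suc (sum a J)"
proof -
  have "sum (a(j := Suc (a j))) (J-{j}) = sum a (J-{j})"
    by (intro sum.cong) auto
  then show ?thesis using assms by (simp add: sum.remove[of J j])
qed

lemma finite_multi_indices_on:
  "finite J \<Longrightarrow> finite {a :: 'j \<Rightarrow> nat. (\<forall>j. j \<notin> J \<longrightarrow> a j = 0) \<and> sum a J \<le> n}"
proof (rule finite_subset)
  assume J: "finite J"
  show "{a :: 'j \<Rightarrow> nat. (\<forall>j. j \<notin> J \<longrightarrow> a j = 0) \<and> sum a J \<le> n}
    \<subseteq> {a. \<forall>j. (j \<in> J \<longrightarrow> a j \<in> {..n}) \<and> (j \<notin> J \<longrightarrow> a j = 0)}"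
  proof safe
    fix a :: "'j \<Rightarrow> nat" and j assume "sum a J \<le> n" "j \<in> J"
    then show "a j \<le> n" using member_le_sum[of j J a] J by simp
  qed auto
  show "finite {a :: 'j \<Rightarrow> nat. \<forall>j. (j \<in> J \<longrightarrow> a j \<in> {..n}) \<and> (j \<notin> J \<longrightarrow> a j = 0)}"
    using J by (rule finite_set_of_finite_funs) simp
qed

lemma poly_space_iff: "u \<in> poly_space k S \<longleftrightarrow> (\<exists>p. poly_deg k p \<and> u = restrict p S)"
proof
  assume "u \<in> poly_space k S"
  then obtain c where u: "u = (\<lambda>x\<in>S. \<Sum>a | sum a UNIV \<le> k. c a * (\<Prod>i\<in>UNIV. (x $ i) ^ a i))"
    by (auto simp: poly_space_def)
  have "poly_deg k (\<lambda>x. c a * (\<Prod>i\<in>UNIV. (x $ i) ^ a i))" if "sum a UNIV \<le> k" for a :: "'a \<Rightarrow> nat"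
  proof -
    have "poly_deg (a i) (\<lambda>x :: real ^ 'a. (x $ i) ^ a i)" for i
      using poly_deg_power[OF poly_deg_affine[of "axis i 1" 0], of "a i"] by (simp add: inner_axis' )
    then show ?thesis using that poly_deg_mono poly_deg_scale poly_deg_prod[of UNIV a "\<lambda>i x. (x $ i) ^ a i"] by blast
  qed
  then have "poly_deg k (\<lambda>x. \<Sum>a | sum a UNIV \<le> k. c a * (\<Prod>i\<in>UNIV. (x $ i) ^ a i))"
    by (intro poly_deg_sum) auto
  then show "\<exists>p. poly_deg k p \<and> u = restrict p S" using u by blast
next
  assume "\<exists>p. poly_deg k p \<and> u = restrict p S"
  then obtain p where p: "poly_deg k p" "u = restrict p S" by blast
  let ?m = "\<lambda>(a :: 'a \<Rightarrow> nat) (x :: real ^ 'a). \<Prod>i\<in>UNIV. (x $ i) ^ a i"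
  let ?A = "\<lambda>n. {a :: 'a \<Rightarrow> nat. sum a UNIV \<le> n}"
  have fin: "finite (?A n)" for n using finite_multi_indices_on[of "UNIV :: 'a set" n] by simp
  have "expansion (?A k) ?m UNIV p"
  proof (rule poly_deg_expansion[OF _ _ p(1)])
    fix n and c :: real
    show "expansion (?A n) ?m UNIV (\<lambda>_. c)"
      using expansion_scale[OF expansion_member[OF fin, of "\<lambda>_. 0" n ?m UNIV], of c] by simp
  next
    fix n g b and a :: "'a \<Rightarrow> nat" assume a: "a \<in> ?A n"
    have mem: "expansion (?A (Suc n)) ?m UNIV (?m (a(i := Suc (a i))))" for i
      using a sum_incr[of UNIV i a] by (intro expansion_member fin) simp
    have "expansion (?A (Suc n)) ?m UNIV
        (\<lambda>x. (\<Sum>i\<in>UNIV. g $ i * ?m (a(i := Suc (a i))) x) + b * ?m a x)"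
      using a by (intro expansion_add expansion_sum expansion_scale mem expansion_member fin) auto
    then show "expansion (?A (Suc n)) ?m UNIV (\<lambda>x. (g \<bullet> x + b) * ?m a x)"
      by (rule expansion_cong)
         (simp only: prod_power_incr[OF finite UNIV_I],
          simp add: inner_vec_def algebra_simps sum_distrib_left sum_distrib_right)
  qed
  then obtain c where "\<forall>x. p x = (\<Sum>a\<in>?A k. c a * ?m a x)" by (auto simp: expansion_def)
  then have eq: "u = (\<lambda>x\<in>S. \<Sum>a | sum a UNIV \<le> k. c a * (\<Prod>i\<in>UNIV. (x $ i) ^ a i))"
    unfolding p(2) by (intro restrict_ext) simp
  show "u \<in> poly_space k S"
    unfolding poly_space_def mem_Collect_eq by (rule exI[of _ c]) (rule conjI[OF eq TrueI])
qed

lemma poly_space_restrict: "poly_deg k p \<Longrightarrow> restrict p S \<in> poly_space k S"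
  unfolding poly_space_iff by (rule exI[of _ p]) simp

section \<open>Faces and barycentric coordinates of simplices\<close>

lemma simplex_verts_indep:
  fixes S :: "(real ^ 'd) set"
  assumes "int n simplex S"
  shows "\<not> affine_dependent (verts S)"
proof -
  from assms[unfolded simplex_def] obtain C where C: "\<not> affine_dependent C" "S = convex hull C"
    by (elim exE conjE)
  have "verts S = C"
    unfolding verts_def C(2) extreme_point_of_convex_hull_affine_independent[OF C(1)] by simp
  with C(1) show ?thesis by simp
qed

lemma face_verts_subset: "f face_of T \<Longrightarrow> verts f \<subseteq> verts T"
  by (auto simp: verts_face)

lemma face_of_simplex:
  fixes T :: "(real ^ 'd) set"
  assumes T: "int n simplex T" and f: "f face_of T"
  shows "f = convex hull verts f" "f \<noteq> {} \<Longrightarrow> f \<in> subsimplices (card (verts f) - 1) T"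
proof -
  note indep = simplex_verts_indep[OF T]
  have hull: "convex hull verts T = T" using simplex_verts(3)[OF T] by (rule sym)
  have "f face_of convex hull verts T" unfolding hull by (rule f)
  then obtain c where c: "c \<subseteq> verts T" "f = convex hull c"
    unfolding face_of_convex_hull_affine_independent[OF indep] by (elim exE conjE)
  have ic: "\<not> affine_dependent c" using indep c(1) affine_dependent_subset by blast
  have vc: "verts f = c"
    unfolding verts_def c(2) extreme_point_of_convex_hull_affine_independent[OF ic] by simp
  show "f = convex hull verts f" unfolding vc by (rule c(2))
  assume "f \<noteq> {}"
  then have "c \<noteq> {}" using c(2) by auto
  then have "card c > 0" using aff_independent_finite[OF ic] by (simp add: card_gt_0_iff)
  then have "int (card c - 1) simplex f"
    unfolding c(2) by (intro simplex_convex_hull conjI ic) simp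
  then show "f \<in> subsimplices (card (verts f) - 1) T" using f vc by (simp add: subsimplices_def)
qed

lemma subsimplices_verts:
  assumes "f \<in> subsimplices l T"
  shows "f face_of T" "int l simplex f" "finite (verts f)" "card (verts f) = l + 1"
    "f = convex hull verts f" "verts f \<subseteq> verts T"
proof -
  show f: "f face_of T" "int l simplex f" using assms by (simp_all add: subsimplices_def)
  show "finite (verts f)" "card (verts f) = l + 1" "f = convex hull verts f"
    by (fact simplex_verts[OF f(2)])+
  show "verts f \<subseteq> verts T" using f(1) by (rule face_verts_subset)
qed

lemma subsimplices_of_vertex_set:
  fixes T :: "(real ^ 'd) set"
  assumes T: "int n simplex T" and c: "c \<subseteq> verts T" "c \<noteq> {}"
  shows "convex hull c \<in> subsimplices (card c - 1) T" "verts (convex hull c) = c"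
proof -
  note indep = simplex_verts_indep[OF T]
  have hull: "convex hull verts T = T" using simplex_verts(3)[OF T] by (rule sym)
  have "convex hull c face_of convex hull verts T"
    unfolding face_of_convex_hull_affine_independent[OF indep] using c(1) by blast
  then have f: "convex hull c face_of T" unfolding hull .
  have ic: "\<not> affine_dependent c" using indep c(1) affine_dependent_subset by blast
  show v: "verts (convex hull c) = c"
    unfolding verts_def extreme_point_of_convex_hull_affine_independent[OF ic] by simp
  show "convex hull c \<in> subsimplices (card c - 1) T"
    using face_of_simplex(2)[OF T f] v c by simp
qed

lemma subsimplices_top:
  fixes T :: "(real ^ 'd) set"
  assumes T: "int n simplex T"
  shows "T \<in> subsimplices n T" "f \<in> subsimplices n T \<Longrightarrow> f = T"
proof -
  show "T \<in> subsimplices n T"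
    using T convex_simplex face_of_refl by (auto simp: subsimplices_def)
  assume f: "f \<in> subsimplices n T"
  then have "verts f = verts T"
    using subsimplices_verts(3,4,6)[OF f] simplex_verts(1,2)[OF T] by (intro card_subset_eq) auto
  then have "convex hull verts f = convex hull verts T" by simp
  then show "f = T"
    unfolding subsimplices_verts(5)[OF f, symmetric] simplex_verts(3)[OF T, symmetric] .
qed

text \<open>The coordinate of the vertex \<open>v\<close> is given as the affine function with gradient \<open>g v\<close> and
  constant term \<open>b v\<close> on the whole space. So it makes sense off the simplex, and its restriction
  serves every face at once.\<close>

definition bary_coords :: "(real ^ 'd) set \<Rightarrow> (real ^ 'd \<Rightarrow> real ^ 'd) \<Rightarrow> (real ^ 'd \<Rightarrow> real) \<Rightarrow> bool" where
  "bary_coords V g b \<longleftrightarrow>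
     (\<forall>x. (\<Sum>v\<in>V. g v \<bullet> x + b v) = 1) \<and> (\<forall>x. (\<Sum>v\<in>V. (g v \<bullet> x + b v) *\<^sub>R v) = x)
     \<and> (\<forall>v\<in>V. \<forall>w\<in>V. g v \<bullet> w + b v = (if v = w then 1 else 0))"

text \<open>The differences of the vertices to one of them, \<open>v0\<close>, form a basis; the linear functionals dual
  to it are the coordinates of the other vertices, and the coordinate of \<open>v0\<close> is what is missing
  to \<open>1\<close>.\<close>

lemma bary_coords_exist:
  fixes V :: "(real ^ 'd) set"
  assumes V: "\<not> affine_dependent V" "card V = CARD('d) + 1"
  shows "\<exists>g b. bary_coords V g b"
proof -
  have finV: "finite V" using V(1) aff_independent_finite by blast
  obtain v0 where v0: "v0 \<in> V" using V(2) by fastforce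
  define B where "B = (\<lambda>v. v - v0) ` (V - {v0})"
  have indB: "independent B"
    using V(1) v0 affine_dependent_iff_dependent2[OF v0] unfolding B_def by (simp add: image_def)
  have "card B = CARD('d)"
    unfolding B_def using v0 V finV by (subst card_image) (auto simp: inj_on_def)
  then have spanB: "span B = UNIV"
    using card_ge_dim_independent[OF subset_UNIV indB] by (simp add: top.extremum_unique)
  have "\<exists>h. linear h \<and> (\<forall>w\<in>B. h w = (if w = v - v0 then 1 else 0 :: real))" for v
     
    using linear_independent_extend[OF indB, of "\<lambda>w. if w = v - v0 then 1 else 0"] by auto
  then have "\<forall>v. \<exists>h. linear h \<and> (\<forall>w\<in>B. h w = (if w = v - v0 then 1 else 0 :: real))" ..
  from choice[OF this] obtain h where
    "\<forall>v. linear (h v) \<and> (\<forall>w\<in>B. h v w = (if w = v - v0 then 1 else 0 :: real))" ..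
  then have h: "\<And>v. linear (h v)" "\<And>v w. w \<in> B \<Longrightarrow> h v w = (if w = v - v0 then 1 else 0 :: real)"
    by simp_all
  define G where "G v = (\<Sum>i\<in>Basis. h v i *\<^sub>R i)" for v
  have G: "G v \<bullet> x = h v x" for v x
  proof -
    have "h v x = h v (\<Sum>i\<in>Basis. (x \<bullet> i) *\<^sub>R i)" by (simp add: euclidean_representation)
    also have "\<dots> = (\<Sum>i\<in>Basis. (x \<bullet> i) * h v i)"
      using h(1)[of v] by (simp add: linear_sum linear_scale)
    finally show ?thesis unfolding G_def inner_sum_left by (simp add: inner_commute mult.commute)
  qed
  define g where "g v = (if v = v0 then - (\<Sum>w\<in>V-{v0}. G w) else G v)" for v
  define b where "b v = (if v = v0 then 1 + (\<Sum>w\<in>V-{v0}. G w \<bullet> v0) else - (G v \<bullet> v0))" for v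
  have lam: "g v \<bullet> x + b v = h v (x - v0)" if "v \<noteq> v0" for v x
    using that by (simp add: g_def b_def inner_diff_right flip: G)
  have lam0: "g v0 \<bullet> x + b v0 = 1 - (\<Sum>w\<in>V-{v0}. h w (x - v0))" for x
    by (simp add: g_def b_def inner_diff_right inner_sum_left sum_subtractf flip: G)
  have one: "(\<Sum>v\<in>V. g v \<bullet> x + b v) = 1" for x
    using finV v0 by (simp add: sum.remove[of V v0] lam0 lam)
  have rep: "(\<Sum>w\<in>V-{v0}. h w y *\<^sub>R (w - v0)) = y" for y
  proof -
    let ?L = "\<lambda>y. \<Sum>w\<in>V-{v0}. h w y *\<^sub>R (w - v0)"
    have "linear (\<lambda>y. h w y *\<^sub>R u)" for w u
      using h(1)[of w] by (auto simp: linear_iff scaleR_left_distrib)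
    then have "linear ?L" by (intro linear_compose_sum) blast
    moreover have "?L y = y" if y: "y \<in> B" for y
    proof -
      obtain u where u: "u \<in> V - {v0}" "y = u - v0" using y by (auto simp: B_def)
      have "?L y = (\<Sum>w\<in>V-{v0}. if w = u then w - v0 else 0)"
        using y u by (intro sum.cong) (auto simp: h(2))
      then show ?thesis using u finV by simp
    qed
    ultimately show ?thesis
      using linear_eq_on_span[OF _ linear_ident, of ?L B y] spanB by blast
  qed
  have "(\<Sum>v\<in>V. (g v \<bullet> x + b v) *\<^sub>R v) = x" for x
  proof -
    have "(\<Sum>v\<in>V. (g v \<bullet> x + b v) *\<^sub>R v)
      = (1 - (\<Sum>w\<in>V-{v0}. h w (x - v0))) *\<^sub>R v0 + (\<Sum>v\<in>V-{v0}. (g v \<bullet> x + b v) *\<^sub>R v)"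
      by (simp only: sum.remove[OF finV v0] lam0)
    also have "(\<Sum>v\<in>V-{v0}. (g v \<bullet> x + b v) *\<^sub>R v) = (\<Sum>v\<in>V-{v0}. h v (x - v0) *\<^sub>R v)"
      by (intro sum.cong) (auto simp: lam)
    also have "(1 - (\<Sum>w\<in>V-{v0}. h w (x - v0))) *\<^sub>R v0 + \<dots> = v0 + (\<Sum>v\<in>V-{v0}. h v (x - v0) *\<^sub>R (v - v0))"
      by (simp only: scaleR_diff_left scaleR_diff_right sum_subtractf scaleR_sum_left scaleR_one) simp
    finally have "(\<Sum>v\<in>V. (g v \<bullet> x + b v) *\<^sub>R v) = v0 + (\<Sum>v\<in>V-{v0}. h v (x - v0) *\<^sub>R (v - v0))" .
    then show ?thesis using rep[of "x - v0"] by simp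
  qed
  moreover have "g v \<bullet> w + b v = (if v = w then 1 else 0)" if vw: "v \<in> V" "w \<in> V" for v w
  proof -
    have *: "h u (w - v0) = (if u = w then 1 else 0)" if "u \<in> V" "u \<noteq> v0" for u
    proof (cases "w = v0")
      case True then show ?thesis using that linear_0[OF h(1)] by simp
    next
      case False then show ?thesis using that vw h(2)[of "w - v0" u] by (auto simp: B_def)
    qed
    show ?thesis
    proof (cases "v = v0")
      case True
      have "(\<Sum>u\<in>V-{v0}. h u (w - v0)) = (\<Sum>u\<in>V-{v0}. if u = w then 1 else 0)"
        using * by (intro sum.cong) auto
      also have "\<dots> = (if w = v0 then 0 else 1)" using vw finV by simp
      finally show ?thesis using True lam0[of w] by auto
    next
      case False
      then show ?thesis using lam[of v w] *[of v] vw by simp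
    qed
  qed
  ultimately have "bary_coords V g b" unfolding bary_coords_def using one by simp
  then show ?thesis by (intro exI)
qed

locale simplex_coordinates =
  fixes T :: "(real ^ 'd) set" and g :: "real ^ 'd \<Rightarrow> real ^ 'd" and b :: "real ^ 'd \<Rightarrow> real"
  assumes simplex: "int CARD('d) simplex T" and coords: "bary_coords (verts T) g b"
begin

definition lam :: "real ^ 'd \<Rightarrow> real ^ 'd \<Rightarrow> real" where "lam v x = g v \<bullet> x + b v"

definition mon :: "(real ^ 'd) set \<Rightarrow> (real ^ 'd \<Rightarrow> nat) \<Rightarrow> real ^ 'd \<Rightarrow> real" where
  "mon S \<alpha> x = (\<Prod>v\<in>S. lam v x ^ \<alpha> v)"

lemma finite_verts: "finite (verts T)" using simplex_verts(1)[OF simplex] .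

lemma lam_sum: "(\<Sum>v\<in>verts T. lam v x) = 1"
  and lam_rep: "(\<Sum>v\<in>verts T. lam v x *\<^sub>R v) = x"
  and lam_vertex: "v \<in> verts T \<Longrightarrow> w \<in> verts T \<Longrightarrow> lam v w = (if v = w then 1 else 0)"
  using coords by (auto simp: bary_coords_def lam_def)

lemma lam_combination:
  assumes W: "W \<subseteq> verts T" and u: "sum u W = 1" and v: "v \<in> verts T"
  shows "lam v (\<Sum>w\<in>W. u w *\<^sub>R w) = (if v \<in> W then u v else 0)"
proof -
  have fin: "finite W" using W finite_verts finite_subset by blast
  have "lam v (\<Sum>w\<in>W. u w *\<^sub>R w) = (\<Sum>w\<in>W. u w * (g v \<bullet> w)) + b v * sum u W"
    using u by (simp add: lam_def inner_sum_right)
  also have "\<dots> = (\<Sum>w\<in>W. u w * lam v w)"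
    by (simp add: lam_def algebra_simps sum.distrib sum_distrib_left)
  also have "\<dots> = (\<Sum>w\<in>W. if w = v then u w else 0)"
    using W v by (intro sum.cong) (auto simp: lam_vertex)
  finally show ?thesis using fin by simp
qed

lemma face_point:
  assumes f: "f face_of T" and u: "sum u (verts f) = 1" "\<And>w. w \<in> verts f \<Longrightarrow> u w \<ge> 0"
  shows "(\<Sum>w\<in>verts f. u w *\<^sub>R w) \<in> f"
proof -
  have "finite (verts f)" using face_verts_subset[OF f] finite_verts finite_subset by blast
  then have "(\<Sum>w\<in>verts f. u w *\<^sub>R w) \<in> convex hull verts f"
    using u by (auto simp: convex_hull_finite)
  then show ?thesis by (simp only: face_of_simplex(1)[OF simplex f, symmetric])
qed

lemma face_coords:
  assumes f: "f face_of T" and x: "x \<in> f"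
  shows "v \<in> verts T - verts f \<Longrightarrow> lam v x = 0"
    "(\<Sum>v\<in>verts f. lam v x) = 1" "(\<Sum>v\<in>verts f. lam v x *\<^sub>R v) = x"
proof -
  have sub: "verts f \<subseteq> verts T" using face_verts_subset[OF f] .
  then have fin: "finite (verts f)" using finite_verts finite_subset by blast
  have "x \<in> convex hull verts f" using x by (simp only: face_of_simplex(1)[OF simplex f, symmetric])
  then obtain u where u: "\<forall>w\<in>verts f. 0 \<le> u w" "sum u (verts f) = 1" "(\<Sum>w\<in>verts f. u w *\<^sub>R w) = x"
    using fin by (auto simp: convex_hull_finite)
  have lam: "lam v x = (if v \<in> verts f then u v else 0)" if "v \<in> verts T" for v
    using lam_combination[OF sub u(2) that] u(3) by simp
  show "v \<in> verts T - verts f \<Longrightarrow> lam v x = 0" using lam by simp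
  have eq: "lam v x = u v" if "v \<in> verts f" for v using lam sub that by auto
  show "(\<Sum>v\<in>verts f. lam v x) = 1" using u(2) eq by simp
  show "(\<Sum>v\<in>verts f. lam v x *\<^sub>R v) = x" using u(3) eq by simp
qed

lemma barycentric_eq_lam:
  assumes f: "f face_of T" and x: "x \<in> f" and v: "v \<in> verts f"
  shows "barycentric f x v = lam v x"
proof -
  have sub: "verts f \<subseteq> verts T" using face_verts_subset[OF f] .
  define w where "w v = (if v \<in> verts f then lam v x else 0)" for v
  have "barycentric f x = w"
    unfolding barycentric_def
  proof (rule the_equality)
    show "(\<forall>v. v \<notin> verts f \<longrightarrow> w v = 0) \<and> sum w (verts f) = 1 \<and> (\<Sum>v\<in>verts f. w v *\<^sub>R v) = x"
      using face_coords[OF f x] by (simp add: w_def)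
  next
    fix w' assume w': "(\<forall>v. v \<notin> verts f \<longrightarrow> w' v = 0) \<and> sum w' (verts f) = 1 \<and> (\<Sum>v\<in>verts f. w' v *\<^sub>R v) = x"
    then have "w' v = w v" for v
      using lam_combination[OF sub, of w' v] sub by (auto simp: w_def)
    then show "w' = w" by blast
  qed
  then show ?thesis using v by (simp add: w_def)
qed

lemma poly_deg_mon: "poly_deg (sum \<alpha> S) (mon S \<alpha>)"
  unfolding mon_def[abs_def] lam_def by (intro poly_deg_prod poly_deg_power poly_deg_affine)

lemma poly_deg_mon_eq: "sum \<alpha> S = n \<Longrightarrow> poly_deg n (mon S \<alpha>)"
  using poly_deg_mon by blast

lemma finite_lattice_on: "finite (verts f) \<Longrightarrow> finite (lattice_on n f)"
  unfolding lattice_on_def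
  by (rule finite_subset[OF _ finite_multi_indices_on[of "verts f" n]]) auto

text \<open>On a set where the coordinates of the vertices of \<open>f\<close> sum up to \<open>1\<close> and reproduce the points,
  an affine function is a linear form in these coordinates, so every polynomial of degree at most
  \<open>n\<close> can be written homogeneously of degree \<open>n\<close>. The set \<open>X\<close> will be \<open>f\<close> itself and, for
  \<open>f = T\<close>, the whole space.\<close>

lemma lattice_expansion:
  assumes fin: "finite (verts f)"
    and X: "\<And>x. x \<in> X \<Longrightarrow> (\<Sum>v\<in>verts f. lam v x) = 1"
      "\<And>x. x \<in> X \<Longrightarrow> (\<Sum>v\<in>verts f. lam v x *\<^sub>R v) = x"
    and p: "poly_deg n p"
  shows "expansion (lattice_on n f) (mon (verts f)) X p"
proof -
  note finL = finite_lattice_on[OF fin]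
  have affine: "expansion (lattice_on (Suc n) f) (mon (verts f)) X (\<lambda>x. (h \<bullet> x + d) * mon (verts f) a x)"
    if a: "a \<in> lattice_on n f" for n a h d
  proof -
    have "a(v := Suc (a v)) \<in> lattice_on (Suc n) f" if "v \<in> verts f" for v
      using a that sum_incr[OF fin that, of a] by (auto simp: lattice_on_def simp del: fun_upd_apply)
         (auto)
    then have mem: "expansion (lattice_on (Suc n) f) (mon (verts f)) X (mon (verts f) (a(v := Suc (a v))))"
      if "v \<in> verts f" for v
      using that by (intro expansion_member finL)
    have "expansion (lattice_on (Suc n) f) (mon (verts f)) X
        (\<lambda>x. \<Sum>v\<in>verts f. (h \<bullet> v + d) * mon (verts f) (a(v := Suc (a v))) x)"
      by (intro expansion_sum expansion_scale mem)
    then show ?thesis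
    proof (rule expansion_cong)
      fix x assume x: "x \<in> X"
      have "h \<bullet> x + d = h \<bullet> (\<Sum>v\<in>verts f. lam v x *\<^sub>R v) + d * (\<Sum>v\<in>verts f. lam v x)"
        using X[OF x] by simp
      also have "\<dots> = (\<Sum>v\<in>verts f. (h \<bullet> v + d) * lam v x)"
        by (simp add: inner_sum_right algebra_simps sum.distrib sum_distrib_left)
      finally have "h \<bullet> x + d = (\<Sum>v\<in>verts f. (h \<bullet> v + d) * lam v x)" .
      moreover have "mon (verts f) (a(v := Suc (a v))) x = lam v x * mon (verts f) a x"
        if "v \<in> verts f" for v
        unfolding mon_def by (rule prod_power_incr[OF fin that])
      ultimately show "(\<Sum>v\<in>verts f. (h \<bullet> v + d) * mon (verts f) (a(v := Suc (a v))) x)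
          = (h \<bullet> x + d) * mon (verts f) a x"
        by (simp add: sum_distrib_right mult.assoc)
    qed
  qed
  show ?thesis
  proof (rule poly_deg_expansion[where A = "\<lambda>n. lattice_on n f", OF _ affine p])
    fix n and c :: real
    show "expansion (lattice_on n f) (mon (verts f)) X (\<lambda>_. c)"
    proof (induction n)
      case 0
      have "(\<lambda>_. 0) \<in> lattice_on 0 f" by (simp add: lattice_on_def)
      from expansion_scale[OF expansion_member[OF finL this], of "mon (verts f)" X c]
      show ?case by (rule expansion_cong) (simp add: mon_def)
    next
      case (Suc n)
      from expansion_trans[OF Suc affine[where h = 0 and d = 1]]
      show ?case by simp
    qed
  qed
qed

lemma face_expansion:
  assumes f: "f face_of T" and p: "poly_deg n p"
  shows "expansion (lattice_on n f) (mon (verts f)) f p"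
  using face_verts_subset[OF f] finite_verts finite_subset
  by (intro lattice_expansion p) (auto simp: face_coords[OF f])

text \<open>By homogeneity a relation on \<open>f\<close>, where the coordinates sum up to \<open>1\<close>, extends to all positive
  values of the coordinates.\<close>

lemma face_independent:
  assumes f: "f face_of T" "f \<noteq> {}" and 0: "\<And>x. x \<in> f \<Longrightarrow> (\<Sum>\<beta>\<in>lattice_on n f. c \<beta> * mon (verts f) \<beta> x) = 0"
    and \<beta>: "\<beta> \<in> lattice_on n f"
  shows "c \<beta> = 0"
proof -
  have sub: "verts f \<subseteq> verts T" using face_verts_subset[OF f(1)] .
  then have fin: "finite (verts f)" using finite_verts finite_subset by blast
  have ne: "verts f \<noteq> {}" using f(2) face_of_simplex(1)[OF simplex f(1)] by (metis convex_hull_empty)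
  show ?thesis
  proof (rule monomials_independent[OF fin finite_lattice_on[OF fin] _ _ \<beta>])
    show "inj_on (\<lambda>\<alpha>. restrict \<alpha> (verts f)) (lattice_on n f)"
    proof (rule inj_onI)
      fix \<alpha> \<alpha>' assume *: "\<alpha> \<in> lattice_on n f" "\<alpha>' \<in> lattice_on n f"
        "restrict \<alpha> (verts f) = restrict \<alpha>' (verts f)"
      have "\<alpha> v = \<alpha>' v" for v
      proof (cases "v \<in> verts f")
        case True
        then show ?thesis using *(3) by (metis restrict_apply')
      next
        case False
        then show ?thesis using * by (simp add: lattice_on_def)
      qed
      then show "\<alpha> = \<alpha>'" by blast
    qed
  next
    fix t :: "real ^ 'd \<Rightarrow> real" assume t: "\<And>w. w \<in> verts f \<Longrightarrow> t w > 0"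
    define s where "s = sum t (verts f)"
    have s: "s > 0" unfolding s_def using t fin ne by (intro sum_pos) auto
    define x where "x = (\<Sum>w\<in>verts f. (t w / s) *\<^sub>R w)"
    have sum1: "(\<Sum>w\<in>verts f. t w / s) = 1"
      using s by (simp add: s_def flip: sum_divide_distrib)
    have x: "x \<in> f"
      unfolding x_def using s t by (intro face_point[OF f(1) sum1]) (auto intro: less_imp_le)
    have lam: "lam v x = t v / s" if "v \<in> verts f" for v
      using lam_combination[OF sub sum1, of v] that sub by (auto simp: x_def)
    have "mon (verts f) \<alpha> x = (\<Prod>w\<in>verts f. t w ^ \<alpha> w) / s ^ n" if "\<alpha> \<in> lattice_on n f" for \<alpha>
    proof -
      have "mon (verts f) \<alpha> x = (\<Prod>w\<in>verts f. t w ^ \<alpha> w / s ^ \<alpha> w)"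
        unfolding mon_def by (intro prod.cong) (auto simp: lam power_divide)
      then show ?thesis using that by (simp add: prod_dividef lattice_on_def flip: power_sum)
    qed
    then have "(\<Sum>\<alpha>\<in>lattice_on n f. c \<alpha> * mon (verts f) \<alpha> x)
        = (\<Sum>\<alpha>\<in>lattice_on n f. c \<alpha> * (\<Prod>w\<in>verts f. t w ^ \<alpha> w)) / s ^ n"
      by (simp add: sum_divide_distrib)
    then show "(\<Sum>\<alpha>\<in>lattice_on n f. c \<alpha> * (\<Prod>w\<in>verts f. t w ^ \<alpha> w)) = 0"
      using 0[OF x] s by simp
  qed
qed

end

section \<open>Bernstein functionals\<close>

lemma dual_space_linear:
  assumes \<phi>: "\<phi> \<in> dual_space S (poly_space k S)" and p: "poly_deg k p" "poly_deg k q"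
  shows "\<phi> (\<lambda>x\<in>S. s * p x + t * q x) = s * \<phi> (restrict p S) + t * \<phi> (restrict q S)"
proof -
  have "restrict p S \<in> poly_space k S" "restrict q S \<in> poly_space k S"
    by (rule p[THEN poly_space_restrict])+
  note lin = \<phi>[unfolded dual_space_def, THEN CollectD, rule_format, OF this, of s t]
  have eq: "(\<lambda>x\<in>S. s * restrict p S x + t * restrict q S x) = (\<lambda>x\<in>S. s * p x + t * q x)"
    by (rule restrict_ext) simp
  show ?thesis using lin unfolding eq .
qed

lemma dual_space_sum:
  assumes \<phi>: "\<phi> \<in> dual_space S (poly_space k S)" and p: "\<And>i. i \<in> I \<Longrightarrow> poly_deg k (p i)"
  shows "\<phi> (\<lambda>x\<in>S. \<Sum>i\<in>I. c i * p i x) = (\<Sum>i\<in>I. c i * \<phi> (restrict (p i) S))"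
proof -
  have 0: "\<phi> (\<lambda>x\<in>S. 0) = 0"
    using dual_space_linear[OF \<phi>, of "\<lambda>_. 0" "\<lambda>_. 0" 0 0] by (simp only: poly_deg.const mult_zero_left add_0)
  show ?thesis
    using p
  proof (induction I rule: infinite_finite_induct)
    case (insert i I)
    have "\<phi> (\<lambda>x\<in>S. c i * p i x + 1 * (\<Sum>i\<in>I. c i * p i x))
        = c i * \<phi> (restrict (p i) S) + 1 * \<phi> (\<lambda>x\<in>S. \<Sum>i\<in>I. c i * p i x)"
      using insert.prems by (intro dual_space_linear[OF \<phi>] poly_deg_sum poly_deg_scale) auto
    then show ?case using insert by (simp del: restrict_apply)
  next
    case (infinite I)
    show ?case by (simp only: sum.infinite[OF infinite.hyps] 0)
  qed (simp only: sum.empty 0)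
qed

lemma prod_over_distinct_list:
  "distinct xs \<Longrightarrow> (\<Prod>i<length xs. h (xs ! i)) = prod h (set xs)"
  using prod.reindex_bij_betw[OF bij_betw_nth[of xs "{..<length xs}" "set xs"], of h] by simp

lemma (in linorder) distinct_sorted_key_list:
  assumes "inj_on g A"
  shows "distinct (sorted_key_list_of_set g A)"
proof -
  interpret folding_insort_key "(\<le>)" "(<)" A g
    by standard (fact assms)
  show ?thesis using distinct_sorted_key_list_of_set[of A] by (simp add: distinct_map)
qed

text \<open>The numbering of the vertices matters only for translating the index lists of the degrees of
  freedom into exponents indexed by vertices.\<close>

locale simplex_numbering = simplex_coordinates T g b
  for T :: "(real ^ 'd) set" and g b +
  fixes num :: "real ^ 'd \<Rightarrow> nat"
  assumes num: "inj_on num (verts T)"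
begin

lemma vlist:
  assumes f: "f face_of T"
  shows "set (vlist num f) = verts f" "distinct (vlist num f)" "length (vlist num f) = card (verts f)"
proof -
  have sub: "verts f \<subseteq> verts T" using face_verts_subset[OF f] .
  have fin: "finite (verts f)" using sub finite_verts finite_subset by blast
  have inj: "inj_on num (verts f)" using num sub inj_on_subset by blast
  show s: "set (vlist num f) = verts f"
    unfolding vlist_def using inj fin by (rule set_sorted_key_list)
  show d: "distinct (vlist num f)"
    unfolding vlist_def using inj by (rule distinct_sorted_key_list)
  show "length (vlist num f) = card (verts f)" using distinct_card[OF d] s by simp
qed

lemma lattice_R_multi_indices:
  assumes f: "f face_of T"
  shows "lattice_R num f ` lattice_on j f = multi_indices (card (verts f)) j"
proof
  show "lattice_R num f ` lattice_on j f \<subseteq> multi_indices (card (verts f)) j"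
    using vlist[OF f] by (auto simp: lattice_R_def multi_indices_def lattice_on_def
        sum_list_distinct_conv_sum_set)
  show "multi_indices (card (verts f)) j \<subseteq> lattice_R num f ` lattice_on j f"
  proof
    fix \<mu> assume \<mu>: "\<mu> \<in> multi_indices (card (verts f)) j"
    define \<beta> where "\<beta> v = (if v \<in> verts f then the (map_of (zip (vlist num f) \<mu>) v) else 0)" for v
    have len: "length (vlist num f) = length \<mu>" using \<mu> vlist[OF f] by (simp add: multi_indices_def)
    have "map \<beta> (vlist num f) = \<mu>"
      using len vlist(1,2)[OF f]
      by (intro nth_equalityI) (auto simp: \<beta>_def map_of_zip_nth)
    moreover have "sum \<beta> (verts f) = sum_list (map \<beta> (vlist num f))"
      using vlist(1,2)[OF f] by (simp add: sum_list_distinct_conv_sum_set)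
    moreover have "\<beta> v = 0" if "v \<notin> verts f" for v using that by (simp add: \<beta>_def)
    ultimately have "map \<beta> (vlist num f) = \<mu>" "\<beta> \<in> lattice_on j f"
      using \<mu> by (auto simp: lattice_on_def multi_indices_def)
    then show "\<mu> \<in> lattice_R num f ` lattice_on j f" by (force simp: lattice_R_def)
  qed
qed

lemma lattice_R_eq_iff:
  assumes f: "f face_of T"
  shows "lattice_R num f \<alpha> = lattice_R num f \<beta> \<longleftrightarrow> (\<forall>v\<in>verts f. \<alpha> v = \<beta> v)"
  using vlist(1)[OF f] by (simp add: lattice_R_def)

definition bernstein_factor :: "(real ^ 'd) set \<Rightarrow> nat \<Rightarrow> (real ^ 'd \<Rightarrow> nat) \<Rightarrow> real" where
  "bernstein_factor f j \<beta> = fact j / (\<Prod>v\<in>verts f. fact (\<beta> v))"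

lemma bernstein_factor_nz: "bernstein_factor f j \<beta> \<noteq> 0"
proof -
  have "(\<Prod>v\<in>verts f. fact (\<beta> v)) > (0 :: real)" by (intro prod_pos) simp
  then show ?thesis by (simp add: bernstein_factor_def)
qed

lemma bernstein_eq_mon:
  assumes f: "f face_of T"
  shows "bernstein num f j (lattice_R num f \<beta>) = (\<lambda>x\<in>f. bernstein_factor f j \<beta> * mon (verts f) \<beta> x)"
proof -
  note vl = vlist[OF f]
  have 1: "(\<Prod>i<length (vlist num f). fact (\<beta> (vlist num f ! i)) :: real) = (\<Prod>v\<in>verts f. fact (\<beta> v))"
    using prod_over_distinct_list[OF vl(2), of "\<lambda>v. fact (\<beta> v) :: real"] vl(1) by simp
  have 2: "(\<Prod>i<length (vlist num f). lam (vlist num f ! i) x ^ \<beta> (vlist num f ! i)) = mon (verts f) \<beta> x" for x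
    using prod_over_distinct_list[OF vl(2), of "\<lambda>v. lam v x ^ \<beta> v"] vl(1) by (simp add: mon_def)
  have 3: "(\<Prod>i<length (vlist num f). barycentric f x (vlist num f ! i) ^ \<beta> (vlist num f ! i))
     = mon (verts f) \<beta> x" if "x \<in> f" for x
  proof -
    have "vlist num f ! i \<in> verts f" if "i < length (vlist num f)" for i
      using vl(1) nth_mem[OF that] by simp
    then show ?thesis
      unfolding 2[symmetric] using that by (intro prod.cong) (auto simp: barycentric_eq_lam[OF f])
  qed
  show ?thesis
    unfolding bernstein_def
    by (rule restrict_ext) (simp add: lattice_R_def bernstein_factor_def 1 3)
qed

text \<open>The functional chosen in the definition of \<^const>\<open>bernstein_dual\<close> exists: it reads off one
  coefficient of the expansion, which is unique by the independence of the monomials.\<close>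

lemma bernstein_dual_props:
  assumes f: "f face_of T" "f \<noteq> {}" and \<beta>: "\<beta> \<in> lattice_on j f"
  defines "B \<equiv> bernstein_dual num f j (lattice_R num f \<beta>)"
  shows "B \<in> dual_space f (poly_space j f)"
    "\<nu> \<in> lattice_on j f \<Longrightarrow> B (bernstein num f j (lattice_R num f \<nu>)) = (if \<nu> = \<beta> then 1 else 0)"
proof -
  have sub: "verts f \<subseteq> verts T" using face_verts_subset[OF f(1)] .
  have fin: "finite (verts f)" using sub finite_verts finite_subset by blast
  note finL = finite_lattice_on[OF fin, of j]
  define cf where "cf u = (SOME c. \<forall>x\<in>f. u x = (\<Sum>\<alpha>\<in>lattice_on j f. c \<alpha> * mon (verts f) \<alpha> x))" for u
  have uniq: "cf u \<alpha> = c \<alpha>"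
    if u: "\<forall>x\<in>f. u x = (\<Sum>\<alpha>\<in>lattice_on j f. c \<alpha> * mon (verts f) \<alpha> x)" and \<alpha>: "\<alpha> \<in> lattice_on j f" for u c \<alpha>
  proof -
    have "\<forall>x\<in>f. u x = (\<Sum>\<alpha>\<in>lattice_on j f. cf u \<alpha> * mon (verts f) \<alpha> x)"
      unfolding cf_def by (rule someI[of _ c]) (rule u)
    then have "(\<Sum>\<alpha>\<in>lattice_on j f. (cf u \<alpha> - c \<alpha>) * mon (verts f) \<alpha> x) = 0" if "x \<in> f" for x
      using u that by (simp add: sum_subtractf algebra_simps)
    from face_independent[OF f this \<alpha>] show ?thesis by simp
  qed
  have ex: "\<exists>c. \<forall>x\<in>f. u x = (\<Sum>\<alpha>\<in>lattice_on j f. c \<alpha> * mon (verts f) \<alpha> x)" if u: "u \<in> poly_space j f" for u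
  proof -
    obtain p where p: "poly_deg j p" "u = restrict p f" using u unfolding poly_space_iff by (elim exE conjE)
    obtain c where "\<forall>x\<in>f. p x = (\<Sum>\<alpha>\<in>lattice_on j f. c \<alpha> * mon (verts f) \<alpha> x)"
      using face_expansion[OF f(1) p(1)] unfolding expansion_def by (elim exE)
    then show ?thesis unfolding p(2) by (intro exI[of _ c]) simp
  qed
  define b0 where "b0 u = cf u \<beta> / bernstein_factor f j \<beta>" for u
  have lin: "b0 \<in> dual_space f (poly_space j f)"
    unfolding dual_space_def
  proof (intro CollectI ballI allI)
    fix p q s t assume pq: "p \<in> poly_space j f" "q \<in> poly_space j f"
    obtain c d where c: "\<forall>x\<in>f. p x = (\<Sum>\<alpha>\<in>lattice_on j f. c \<alpha> * mon (verts f) \<alpha> x)"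
      and d: "\<forall>x\<in>f. q x = (\<Sum>\<alpha>\<in>lattice_on j f. d \<alpha> * mon (verts f) \<alpha> x)"
      using ex[OF pq(1)] ex[OF pq(2)] by blast
    have "\<forall>x\<in>f. (\<lambda>x\<in>f. s * p x + t * q x) x = (\<Sum>\<alpha>\<in>lattice_on j f. (s * c \<alpha> + t * d \<alpha>) * mon (verts f) \<alpha> x)"
      using c d by (simp add: sum.distrib sum_distrib_left algebra_simps)
    from uniq[OF this \<beta>] uniq[OF c \<beta>] uniq[OF d \<beta>]
    show "b0 (\<lambda>x\<in>f. s * p x + t * q x) = s * b0 p + t * b0 q"
      by (simp only: b0_def add_divide_distrib times_divide_eq_right)
  qed
  have dual: "b0 (bernstein num f j (lattice_R num f \<nu>)) = (if \<nu> = \<beta> then 1 else 0)"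
    if \<nu>: "\<nu> \<in> lattice_on j f" for \<nu>
  proof -
    have "\<forall>x\<in>f. bernstein num f j (lattice_R num f \<nu>) x
      = (\<Sum>\<alpha>\<in>lattice_on j f. (if \<alpha> = \<nu> then bernstein_factor f j \<nu> else 0) * mon (verts f) \<alpha> x)"
      using \<nu> finL by (simp add: bernstein_eq_mon[OF f(1)] if_distrib[of "\<lambda>c. c * _"] cong: if_cong)
    from uniq[OF this \<beta>] show ?thesis using bernstein_factor_nz[of f j \<beta>] by (auto simp: b0_def)
  qed
  have R: "lattice_R num f \<nu> = lattice_R num f \<beta> \<longleftrightarrow> \<nu> = \<beta>" if "\<nu> \<in> lattice_on j f" for \<nu>
  proof
    assume "lattice_R num f \<nu> = lattice_R num f \<beta>"
    then have "\<nu> v = \<beta> v" for v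
      using that \<beta> lattice_R_eq_iff[OF f(1), of \<nu> \<beta>] by (cases "v \<in> verts f") (auto simp: lattice_on_def)
    then show "\<nu> = \<beta>" by blast
  qed simp
  have "b0 \<in> dual_space f (poly_space j f) \<and>
    (\<forall>\<nu>\<in>multi_indices (card (verts f)) j.
      b0 (bernstein num f j \<nu>) = (if \<nu> = lattice_R num f \<beta> then 1 else 0))"
    unfolding lattice_R_multi_indices[OF f(1), symmetric] using lin dual R by auto
  then have B: "B \<in> dual_space f (poly_space j f) \<and>
    (\<forall>\<nu>\<in>multi_indices (card (verts f)) j.
      B (bernstein num f j \<nu>) = (if \<nu> = lattice_R num f \<beta> then 1 else 0))"
    unfolding B_def bernstein_dual_def by (rule someI[of _ b0])
  then show "B \<in> dual_space f (poly_space j f)" by blast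
  show "B (bernstein num f j (lattice_R num f \<nu>)) = (if \<nu> = \<beta> then 1 else 0)" if "\<nu> \<in> lattice_on j f"
    using B that R[OF that] unfolding lattice_R_multi_indices[OF f(1), symmetric] by auto
qed

definition bernstein_fun :: "(real ^ 'd) set \<Rightarrow> nat \<Rightarrow> (real ^ 'd \<Rightarrow> nat) \<Rightarrow> (real ^ 'd \<Rightarrow> real) \<Rightarrow> real" where
  "bernstein_fun f j \<beta> p = bernstein_dual num f j (lattice_R num f \<beta>) (\<lambda>x\<in>f. p x)"

lemma bernstein_fun_cong: "(\<And>x. x \<in> f \<Longrightarrow> p x = q x) \<Longrightarrow> bernstein_fun f j \<beta> p = bernstein_fun f j \<beta> q"
  by (simp add: bernstein_fun_def cong: restrict_cong)

lemma bernstein_fun_linear: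
  assumes f: "f face_of T" "f \<noteq> {}" and \<beta>: "\<beta> \<in> lattice_on j f"
    and p: "poly_deg j p" "poly_deg j q"
  shows "bernstein_fun f j \<beta> (\<lambda>x. s * p x + t * q x) = s * bernstein_fun f j \<beta> p + t * bernstein_fun f j \<beta> q"
  unfolding bernstein_fun_def by (rule dual_space_linear[OF bernstein_dual_props(1)[OF f \<beta>] p])

lemma bernstein_fun_sum:
  assumes f: "f face_of T" "f \<noteq> {}" and \<beta>: "\<beta> \<in> lattice_on j f"
    and p: "\<And>i. i \<in> I \<Longrightarrow> poly_deg j (p i)"
  shows "bernstein_fun f j \<beta> (\<lambda>x. \<Sum>i\<in>I. c i * p i x) = (\<Sum>i\<in>I. c i * bernstein_fun f j \<beta> (p i))"
  unfolding bernstein_fun_def by (rule dual_space_sum[OF bernstein_dual_props(1)[OF f \<beta>] p])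

lemma bernstein_fun_coefficient:
  assumes f: "f face_of T" "f \<noteq> {}" and \<beta>: "\<beta> \<in> lattice_on j f"
    and p: "\<And>x. x \<in> f \<Longrightarrow> p x = (\<Sum>\<alpha>\<in>lattice_on j f. c \<alpha> * mon (verts f) \<alpha> x)"
  shows "bernstein_fun f j \<beta> p = c \<beta> / bernstein_factor f j \<beta>"
proof -
  let ?B = "bernstein_fun f j \<beta>"
  have fin: "finite (verts f)" using face_verts_subset[OF f(1)] finite_verts finite_subset by blast
  have pm: "poly_deg j (mon (verts f) \<alpha>)" if "\<alpha> \<in> lattice_on j f" for \<alpha>
    using that by (intro poly_deg_mon_eq) (simp add: lattice_on_def)
  have Bm: "?B (mon (verts f) \<alpha>) = (if \<alpha> = \<beta> then 1 / bernstein_factor f j \<beta> else 0)"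
    if \<alpha>: "\<alpha> \<in> lattice_on j f" for \<alpha>
  proof -
    have "?B (\<lambda>x. bernstein_factor f j \<alpha> * mon (verts f) \<alpha> x) = (if \<alpha> = \<beta> then 1 else 0)"
      using bernstein_dual_props(2)[OF f \<beta> \<alpha>] unfolding bernstein_eq_mon[OF f(1)] bernstein_fun_def .
    moreover have "?B (\<lambda>x. bernstein_factor f j \<alpha> * mon (verts f) \<alpha> x) = bernstein_factor f j \<alpha> * ?B (mon (verts f) \<alpha>)"
      using bernstein_fun_linear[OF f \<beta> pm[OF \<alpha>] pm[OF \<alpha>], of "bernstein_factor f j \<alpha>" 0] by simp
    ultimately show ?thesis using bernstein_factor_nz[of f j \<alpha>] by (auto simp: field_simps split: if_splits)
  qed
  have "?B p = ?B (\<lambda>x. \<Sum>\<alpha>\<in>lattice_on j f. c \<alpha> * mon (verts f) \<alpha> x)"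
    by (rule bernstein_fun_cong) (rule p)
  then have "?B p = (\<Sum>\<alpha>\<in>lattice_on j f. c \<alpha> * ?B (mon (verts f) \<alpha>))"
    using bernstein_fun_sum[OF f \<beta>, of "lattice_on j f" "mon (verts f)" c] pm by simp
  also have "\<dots> = (\<Sum>\<alpha>\<in>lattice_on j f. if \<alpha> = \<beta> then c \<beta> / bernstein_factor f j \<beta> else 0)"
    by (intro sum.cong) (auto simp: Bm)
  finally show ?thesis using \<beta> finite_lattice_on[OF fin] by simp
qed

end

section \<open>Polarization and order of vanishing\<close>

lemma dir_deriv_along_line:
  assumes p: "poly_deg n p" and P: "\<And>t. p (x + t *\<^sub>R v) = poly P t"
  shows "dir_deriv v p (x + t *\<^sub>R v) = poly (pderiv P) t"
proof -
  have "((\<lambda>t. p (x + t *\<^sub>R v)) has_derivative (\<lambda>s. dir_deriv (s *\<^sub>R v) p (x + t *\<^sub>R v))) (at t)"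
    by (rule has_derivative_compose[OF _ poly_deg_deriv[OF p]]) (auto intro!: derivative_eq_intros)
  moreover have "dir_deriv (s *\<^sub>R v) p (x + t *\<^sub>R v) = dir_deriv v p (x + t *\<^sub>R v) * s" for s
    using linear_scale[OF dir_deriv_linear[OF p]] by simp
  moreover have "(\<lambda>t. p (x + t *\<^sub>R v)) = poly P" using P by blast
  ultimately have "(poly P has_real_derivative dir_deriv v p (x + t *\<^sub>R v)) (at t)"
    by (simp add: has_field_derivative_def)
  then show ?thesis using poly_DERIV DERIV_unique by blast
qed

text \<open>Restricted to a line, a polynomial is a polynomial in one variable, and its Taylor coefficients
  at \<open>0\<close> are the pure directional derivatives. This replaces a Leibniz formula for the iterated
  derivatives of products: products of affine functions become products of linear polynomials.\<close>

lemma dir_derivs_replicate_eq_coeff: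
  "poly_deg n p \<Longrightarrow> (\<And>t. p (x + t *\<^sub>R v) = poly P t) \<Longrightarrow> dir_derivs (replicate j v) p x = fact j * coeff P j"
proof (induction j arbitrary: n p P)
  case 0
  then show ?case using "0.prems"(2)[of 0] by (simp add: poly_0_coeff_0)
next
  case (Suc j)
  have "dir_derivs (replicate (Suc j) v) p x = dir_derivs (replicate j v) (dir_deriv v p) x"
    using dir_deriv_dir_derivs_commute[OF Suc.prems(1), of v "replicate j v"]
    by (simp only: replicate_Suc foldr.simps o_apply)
  also have "\<dots> = fact j * coeff (pderiv P) j"
    by (rule Suc.IH[OF poly_deg_dir_deriv[OF Suc.prems(1)]]) (rule dir_deriv_along_line[OF Suc.prems])
  finally show ?case by (simp add: coeff_pderiv algebra_simps)
qed

lemma prod_monom_power: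
  fixes a :: "'w \<Rightarrow> real"
  shows "(\<Prod>v\<in>W. [:0, a v:] ^ \<alpha> v) = monom (\<Prod>v\<in>W. a v ^ \<alpha> v) (sum \<alpha> W)"
proof (induction W rule: infinite_finite_induct)
  case (insert v W)
  have "[:0, a v:] = monom (a v) 1" by (simp add: monom_Suc monom_0)
  then show ?case using insert by (simp add: monom_power mult_monom)
qed (simp_all add: monom_0 flip: one_pCons)

text \<open>The iterated derivative is linear in each of its directions, so its vanishing for directions in
  \<open>S\<close> spreads to directions in the span. The list \<open>us\<close> collects the directions still
  in \<open>S\<close>; in the induction step a direction from the span is first exchanged for one in
  \<open>S\<close>, which then moves to \<open>us\<close>.\<close>

lemma polarization:
  fixes \<Phi> :: "(real ^ 'd \<Rightarrow> real) \<Rightarrow> real"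
  assumes p: "poly_deg n p"
    and lin: "\<And>p q s t. poly_deg j p \<Longrightarrow> poly_deg j q \<Longrightarrow> \<Phi> (\<lambda>x. s * p x + t * q x) = s * \<Phi> p + t * \<Phi> q"
    and j: "n - d \<le> j"
    and zero: "\<And>ws. set ws \<subseteq> S \<Longrightarrow> length ws = d \<Longrightarrow> \<Phi> (dir_derivs ws p) = 0"
  shows "set us \<subseteq> S \<Longrightarrow> set ws \<subseteq> span S \<Longrightarrow> length us + length ws = d \<Longrightarrow> \<Phi> (dir_derivs (us @ ws) p) = 0"
proof (induction ws arbitrary: us)
  case Nil
  then show ?case using zero by simp
next
  case (Cons w ws)
  let ?q = "dir_derivs ws p"
  have q: "poly_deg (n - length ws) ?q" by (rule poly_deg_dir_derivs[OF p])
  have deg: "poly_deg j (dir_derivs us (dir_deriv v ?q))" for v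
    using poly_deg_dir_derivs[OF poly_deg_dir_deriv[OF q], of us v] Cons.prems(3) j
    by (elim poly_deg_mono) simp
  have "w \<in> span S" using Cons.prems by simp
  then have "\<Phi> (dir_derivs us (dir_deriv w ?q)) = 0"
  proof (induction rule: span_induct)
    case base
    show ?case
    proof (unfold subspace_def, intro conjI ballI allI)
      have *: "\<Phi> (dir_derivs us (dir_deriv (s *\<^sub>R v + t *\<^sub>R v') ?q))
          = s * \<Phi> (dir_derivs us (dir_deriv v ?q)) + t * \<Phi> (dir_derivs us (dir_deriv v' ?q))" for s t v v'
      proof -
        have "dir_deriv (s *\<^sub>R v + t *\<^sub>R v') ?q = (\<lambda>x. s * dir_deriv v ?q x + t * dir_deriv v' ?q x)"
          by (rule ext) (simp add: linear_add[OF dir_deriv_linear[OF q]] linear_scale[OF dir_deriv_linear[OF q]])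
        then have "dir_derivs us (dir_deriv (s *\<^sub>R v + t *\<^sub>R v') ?q)
            = (\<lambda>x. s * dir_derivs us (dir_deriv v ?q) x + t * dir_derivs us (dir_deriv v' ?q) x)"
          using dir_derivs_add[OF poly_deg_scale[OF poly_deg_dir_deriv[OF q]] poly_deg_scale[OF poly_deg_dir_deriv[OF q]]]
            dir_derivs_scale[OF poly_deg_dir_deriv[OF q]] by simp
        then show ?thesis using lin[OF deg deg] by simp
      qed
      show "0 \<in> {v. \<Phi> (dir_derivs us (dir_deriv v ?q)) = 0}" using *[of 0 0 0 0] by simp
      show "v + v' \<in> {v. \<Phi> (dir_derivs us (dir_deriv v ?q)) = 0}"
        if "v \<in> {v. \<Phi> (dir_derivs us (dir_deriv v ?q)) = 0}" "v' \<in> {v. \<Phi> (dir_derivs us (dir_deriv v ?q)) = 0}" for v v'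
        using *[of 1 v 1 v'] that by simp
      show "s *\<^sub>R v \<in> {v. \<Phi> (dir_derivs us (dir_deriv v ?q)) = 0}"
        if "v \<in> {v. \<Phi> (dir_derivs us (dir_deriv v ?q)) = 0}" for s v
        using *[of s v 0 v] that by simp
    qed
  next
    case (step v)
    then show ?case using Cons.IH[of "us @ [v]"] Cons.prems by simp
  qed
  then show ?case by simp
qed

lemma count_concat_replicate:
  "distinct Ns \<Longrightarrow> count (mset (concat (map2 replicate (map c Ns) Ns))) v = (if v \<in> set Ns then c v else 0)"
  by (induction Ns) auto

lemma length_concat_replicate:
  "length \<gamma> = length Ns \<Longrightarrow> length (concat (map2 replicate \<gamma> Ns)) = sum_list \<gamma>"
  by (induction \<gamma> Ns rule: list_induct2) auto

text \<open>Lists of basis vectors, up to order, correspond to multi-indices. So the normal derivatives in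
  the degrees of freedom cover all iterated derivatives along vectors of the basis.\<close>

lemma mset_sorted_by_basis:
  assumes "distinct Ns" "set ws \<subseteq> set Ns"
  obtains \<gamma> where "\<gamma> \<in> multi_indices (length Ns) (length ws)"
    "mset ws = mset (concat (map2 replicate \<gamma> Ns))"
proof
  let ?\<gamma> = "map (count (mset ws)) Ns"
  show *: "mset ws = mset (concat (map2 replicate ?\<gamma> Ns))"
  proof (rule multiset_eqI)
    fix v show "count (mset ws) v = count (mset (concat (map2 replicate ?\<gamma> Ns))) v"
      using assms(2) unfolding count_concat_replicate[OF assms(1)] by (auto simp: count_eq_zero_iff)
  qed
  show "?\<gamma> \<in> multi_indices (length Ns) (length ws)"
    using mset_eq_length[OF *] length_concat_replicate[of ?\<gamma> Ns] by (simp add: multi_indices_def)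
qed

definition vanishes_to_order :: "nat \<Rightarrow> real ^ 'd \<Rightarrow> (real ^ 'd \<Rightarrow> real) \<Rightarrow> bool" where
  "vanishes_to_order n x p \<longleftrightarrow> (\<forall>vs. length vs < n \<longrightarrow> dir_derivs vs p x = 0)"

lemma vanishes_to_order_mono: "vanishes_to_order n x p \<Longrightarrow> m \<le> n \<Longrightarrow> vanishes_to_order m x p"
  by (auto simp: vanishes_to_order_def)

lemma vanishes_to_order_0: "vanishes_to_order 0 x p" by (simp add: vanishes_to_order_def)

lemma vanishes_to_order_Suc:
  assumes "poly_deg m p"
  shows "vanishes_to_order (Suc n) x p \<longleftrightarrow> p x = 0 \<and> (\<forall>v. vanishes_to_order n x (dir_deriv v p))"
proof
  assume L: "vanishes_to_order (Suc n) x p"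
  have "dir_derivs vs (dir_deriv v p) x = 0" if "length vs < n" for v vs
    using L that dir_deriv_dir_derivs_commute[OF assms, of v vs]
    by (auto simp: vanishes_to_order_def dest: spec[of _ "v # vs"])
  moreover have "p x = 0" using L by (auto simp: vanishes_to_order_def dest: spec[of _ "[]"])
  ultimately show "p x = 0 \<and> (\<forall>v. vanishes_to_order n x (dir_deriv v p))" by (auto simp: vanishes_to_order_def)
next
  assume R: "p x = 0 \<and> (\<forall>v. vanishes_to_order n x (dir_deriv v p))"
  have "dir_derivs vs p x = 0" if "length vs < Suc n" for vs
  proof (cases vs)
    case Nil
    then show ?thesis using R by simp
  next
    case (Cons v vs')
    then show ?thesis using R that dir_deriv_dir_derivs_commute[OF assms, of v vs'] by (auto simp: vanishes_to_order_def)
  qed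
  then show "vanishes_to_order (Suc n) x p" by (simp add: vanishes_to_order_def)
qed

lemma vanishes_to_order_add: "poly_deg m p \<Longrightarrow> poly_deg m q \<Longrightarrow> vanishes_to_order n x p \<Longrightarrow> vanishes_to_order n x q \<Longrightarrow> vanishes_to_order n x (\<lambda>x. p x + q x)"
  by (simp add: vanishes_to_order_def dir_derivs_add)

lemma vanishes_to_order_scale: "poly_deg m p \<Longrightarrow> vanishes_to_order n x p \<Longrightarrow> vanishes_to_order n x (\<lambda>x. c * p x)"
  by (simp add: vanishes_to_order_def dir_derivs_scale)

lemma vanishes_to_order_sum:
  "(\<And>i. i \<in> I \<Longrightarrow> poly_deg m (p i)) \<Longrightarrow> (\<And>i. i \<in> I \<Longrightarrow> vanishes_to_order n x (p i)) \<Longrightarrow> vanishes_to_order n x (\<lambda>x. \<Sum>i\<in>I. p i x)"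
  using dir_derivs_sum[of I m p] by (simp add: vanishes_to_order_def)

text \<open>The induction is on the total order \<open>N\<close> by the product rule. If one factor does not vanish, its
  derivative has no order to lose, and the order of the other factor may be lowered by one.\<close>

lemma vanishes_to_order_mult:
  "poly_deg a p \<Longrightarrow> poly_deg b q \<Longrightarrow> vanishes_to_order n x p \<Longrightarrow> vanishes_to_order m x q \<Longrightarrow> N = n + m \<Longrightarrow> vanishes_to_order N x (\<lambda>x. p x * q x)"
proof (induction N arbitrary: a b p q n m)
  case (Suc N)
  note D = dir_deriv_mult[OF Suc.prems(1,2)]
  have Dp: "vanishes_to_order (n - 1) x (dir_deriv v p)" for v
    using Suc.prems(3) vanishes_to_order_Suc[OF Suc.prems(1)] by (cases n) (auto simp: vanishes_to_order_0)
  have Dq: "vanishes_to_order (m - 1) x (dir_deriv v q)" for v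
    using Suc.prems(4) vanishes_to_order_Suc[OF Suc.prems(2)] by (cases m) (auto simp: vanishes_to_order_0)
  have 0: "p x * q x = 0"
  proof (cases n)
    case 0
    then have "m = Suc N" using Suc.prems by simp
    then show ?thesis using Suc.prems(4) vanishes_to_order_Suc[OF Suc.prems(2)] by simp
  next
    case (Suc n')
    then show ?thesis using Suc.prems(3) vanishes_to_order_Suc[OF Suc.prems(1)] by simp
  qed
  have "vanishes_to_order N x (\<lambda>x. p x * dir_deriv v q x)" for v
  proof (cases m)
    case 0
    then show ?thesis
      using Suc.IH[OF Suc.prems(1) poly_deg_dir_deriv[OF Suc.prems(2)] vanishes_to_order_mono[OF Suc.prems(3), of N] vanishes_to_order_0] Suc.prems
      by simp
  next
    case (Suc m')
    then show ?thesis
      using Suc.IH[OF Suc.prems(1) poly_deg_dir_deriv[OF Suc.prems(2)] Suc.prems(3) Dq] Suc.prems by simp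
  qed
  moreover have "vanishes_to_order N x (\<lambda>x. dir_deriv v p x * q x)" for v
  proof (cases n)
    case 0
    then show ?thesis
      using Suc.IH[OF poly_deg_dir_deriv[OF Suc.prems(1)] Suc.prems(2) vanishes_to_order_0 vanishes_to_order_mono[OF Suc.prems(4), of N]] Suc.prems
      by simp
  next
    case (Suc n')
    then show ?thesis
      using Suc.IH[OF poly_deg_dir_deriv[OF Suc.prems(1)] Suc.prems(2) Dp Suc.prems(4)] Suc.prems by simp
  qed
  moreover have "poly_deg (a + b) (\<lambda>x. p x * dir_deriv v q x)" "poly_deg (a + b) (\<lambda>x. dir_deriv v p x * q x)" for v
    using Suc.prems by (auto intro!: poly_deg_mono[OF poly_deg_mult] poly_deg_dir_deriv)
  ultimately have "vanishes_to_order N x (dir_deriv v (\<lambda>x. p x * q x))" for v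
    unfolding D by (intro vanishes_to_order_add) auto
  then show ?case using 0 vanishes_to_order_Suc[OF poly_deg_mult[OF Suc.prems(1,2)]] by simp
qed (rule vanishes_to_order_0)

lemma vanishes_to_order_power: "poly_deg 1 p \<Longrightarrow> p x = 0 \<Longrightarrow> vanishes_to_order n x (\<lambda>x. p x ^ n)"
proof (induction n)
  case (Suc n)
  have "vanishes_to_order 1 x p" using Suc.prems by (simp add: vanishes_to_order_def)
  from vanishes_to_order_mult[OF Suc.prems(1) poly_deg_power[OF Suc.prems(1)] this Suc.IH[OF Suc.prems]]
  show ?case by simp
qed (rule vanishes_to_order_0)

lemma vanishes_to_order_prod:
  "(\<And>w. w \<in> W \<Longrightarrow> poly_deg (a w) (p w)) \<Longrightarrow> (\<And>w. w \<in> W \<Longrightarrow> vanishes_to_order (n w) x (p w))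
    \<Longrightarrow> vanishes_to_order (sum n W) x (\<lambda>x. \<Prod>w\<in>W. p w x)"
proof (induction W rule: infinite_finite_induct)
  case (insert w W)
  then show ?case
    using vanishes_to_order_mult[of "a w" "p w" "sum a W" "\<lambda>x. \<Prod>w\<in>W. p w x" "n w" x "sum n W"] poly_deg_prod[of W a p]
    by simp
qed (auto intro: vanishes_to_order_0)

section \<open>Bernstein coefficients near a sub-simplex\<close>

context simplex_coordinates
begin

text \<open>The coordinates of the vertices off \<open>f\<close> are constant on \<open>f\<close>, so their linear parts do not see the
  tangential component of a vector; it can be dropped from any vector with the prescribed values.\<close>

lemma normal_vector_exists:
  assumes f: "f face_of T" "f \<noteq> {}"
  shows "\<exists>n\<in>normal_plane f. \<forall>w\<in>verts T - verts f. g w \<bullet> n = t w"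
proof -
  have sub: "verts f \<subseteq> verts T" using face_verts_subset[OF f(1)] .
  have "verts f \<noteq> {}" using f(2) face_of_simplex(1)[OF simplex f(1)] by (metis convex_hull_empty)
  then obtain v0 where v0: "v0 \<in> verts f" by blast
  define y where "y = (\<Sum>w\<in>verts T - verts f. t w *\<^sub>R (w - v0))"
  have gdiff: "g w \<bullet> (x - z) = lam w x - lam w z" for w x z
    by (simp add: lam_def inner_diff_right)
  have gy: "g w \<bullet> y = t w" if w: "w \<in> verts T - verts f" for w
  proof -
    have "w \<noteq> v0" "v0 \<in> verts T" using w v0 sub by blast+
    then have l0: "lam w v0 = 0" using lam_vertex[of w v0] w by simp
    have "g w \<bullet> y = (\<Sum>u\<in>verts T - verts f. t u * (lam w u - lam w v0))"
      unfolding y_def by (simp add: inner_sum_right gdiff)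
    also have "\<dots> = (\<Sum>u\<in>verts T - verts f. if u = w then t u else 0)"
      using w l0 by (intro sum.cong) (auto simp: lam_vertex)
    finally show ?thesis using w finite_verts by simp
  qed
  have tangent: "g w \<bullet> z = 0" if w: "w \<in> verts T - verts f" and z: "z \<in> tangent_space f" for w z
    using z unfolding tangent_space_def
  proof (induction rule: span_induct)
    case base
    show ?case by (auto simp: subspace_def inner_add_right)
  next
    case (step z)
    then show ?case using face_coords(1)[OF f(1) _ w] by (auto simp: gdiff)
  qed
  obtain z n where zn: "z \<in> span (tangent_space f)" "\<And>u. u \<in> span (tangent_space f) \<Longrightarrow> orthogonal n u"
    "y = z + n"
    using orthogonal_subspace_decomp_exists[of "tangent_space f" y] by metis
  have "z \<in> tangent_space f" using zn(1) unfolding tangent_space_def by (simp add: span_span)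
  then have "g w \<bullet> n = t w" if "w \<in> verts T - verts f" for w
    using tangent[OF that] gy[OF that] zn(3) by (simp add: inner_add_right)
  moreover have "n \<in> normal_plane f"
    using zn(2) span_base by (auto simp: normal_plane_def orthogonal_comp_def orthogonal_commute)
  ultimately show ?thesis by blast
qed

text \<open>Along a line through a point of \<open>f\<close> the coordinates of the vertices off \<open>f\<close> become multiples of
  the parameter, so that exactly \<open>lattice_dist T \<alpha> f\<close> powers of it split off from the monomial.\<close>

lemma coeff_mon_along_line:
  fixes n :: "real ^ 'd"
  assumes f: "f face_of T" and x: "x \<in> f"
  defines "P \<equiv> \<lambda>\<alpha>. \<Prod>v\<in>verts T. [:lam v x, g v \<bullet> n:] ^ \<alpha> v"
  shows "mon (verts T) \<alpha> (x + t *\<^sub>R n) = poly (P \<alpha>) t"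
    "s < lattice_dist T \<alpha> f \<Longrightarrow> coeff (P \<alpha>) s = 0"
    "s = lattice_dist T \<alpha> f \<Longrightarrow>
      coeff (P \<alpha>) s = (\<Prod>w\<in>verts T - verts f. (g w \<bullet> n) ^ \<alpha> w) * mon (verts f) \<alpha> x"
proof -
  have sub: "verts f \<subseteq> verts T" using face_verts_subset[OF f] .
  show "mon (verts T) \<alpha> (x + t *\<^sub>R n) = poly (P \<alpha>) t"
    unfolding mon_def P_def poly_prod
    by (intro prod.cong) (simp_all add: lam_def inner_add_right algebra_simps)
  define Q where "Q = (\<Prod>v\<in>verts f. [:lam v x, g v \<bullet> n:] ^ \<alpha> v)"
  have "P \<alpha> = (\<Prod>w\<in>verts T - verts f. [:lam w x, g w \<bullet> n:] ^ \<alpha> w) * Q"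
    unfolding P_def Q_def by (rule prod.subset_diff[OF sub finite_verts])
  also have "(\<Prod>w\<in>verts T - verts f. [:lam w x, g w \<bullet> n:] ^ \<alpha> w)
    = (\<Prod>w\<in>verts T - verts f. [:0, g w \<bullet> n:] ^ \<alpha> w)"
    using face_coords(1)[OF f x] by (intro prod.cong) auto
  also have "\<dots> = monom (\<Prod>w\<in>verts T - verts f. (g w \<bullet> n) ^ \<alpha> w) (lattice_dist T \<alpha> f)"
    unfolding lattice_dist_def by (rule prod_monom_power)
  finally have P: "P \<alpha> = monom (\<Prod>w\<in>verts T - verts f. (g w \<bullet> n) ^ \<alpha> w) (lattice_dist T \<alpha> f) * Q" .
  show "s < lattice_dist T \<alpha> f \<Longrightarrow> coeff (P \<alpha>) s = 0"
    unfolding P by (simp add: coeff_monom_mult)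
  have "coeff Q 0 = mon (verts f) \<alpha> x"
    unfolding mon_def Q_def by (simp add: poly_prod flip: poly_0_coeff_0)
  then show "s = lattice_dist T \<alpha> f \<Longrightarrow>
      coeff (P \<alpha>) s = (\<Prod>w\<in>verts T - verts f. (g w \<bullet> n) ^ \<alpha> w) * mon (verts f) \<alpha> x"
    unfolding P by (simp add: coeff_monom_mult)
qed

definition lattice_poly :: "nat \<Rightarrow> ((real ^ 'd \<Rightarrow> nat) \<Rightarrow> real) \<Rightarrow> real ^ 'd \<Rightarrow> real" where
  "lattice_poly k c x = (\<Sum>\<alpha>\<in>lattice_on k T. c \<alpha> * mon (verts T) \<alpha> x)"

lemma poly_deg_lattice_poly: "poly_deg k (lattice_poly k c)"
  unfolding lattice_poly_def[abs_def]
  by (intro poly_deg_sum poly_deg_scale poly_deg_mon_eq) (simp add: lattice_on_def)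

lemma lattice_dist_split: "f face_of T \<Longrightarrow> \<alpha> \<in> lattice_on k T \<Longrightarrow> sum \<alpha> (verts f) + lattice_dist T \<alpha> f = k"
  unfolding lattice_dist_def lattice_on_def
  using sum.subset_diff[OF face_verts_subset finite_verts, of f \<alpha>] by simp

text \<open>When all coefficients at a smaller distance are zero, the derivative of order \<open>s\<close> on \<open>f\<close> is given
  by the coefficients at distance \<open>s\<close>. Grouped by the exponents \<open>\<beta>\<close> on the vertices of \<open>f\<close>, it is
  an expansion in the monomials of \<open>f\<close>, from which Bernstein functionals can read off the
  coefficients.\<close>

lemma normal_derivative_expansion:
  assumes f: "f face_of T" and x: "x \<in> f"
    and low: "\<And>\<alpha>. \<alpha> \<in> lattice_on k T \<Longrightarrow> lattice_dist T \<alpha> f < s \<Longrightarrow> c \<alpha> = 0"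
  shows "dir_derivs (replicate s n) (lattice_poly k c) x
    = (\<Sum>\<beta>\<in>lattice_on (k - s) f.
        (fact s * (\<Sum>\<alpha> | \<alpha> \<in> lattice_on k T \<and> lattice_dist T \<alpha> f = s \<and> (\<lambda>v. if v \<in> verts f then \<alpha> v else 0) = \<beta>.
          c \<alpha> * (\<Prod>w\<in>verts T - verts f. (g w \<bullet> n) ^ \<alpha> w))) * mon (verts f) \<beta> x)"
proof -
  let ?res = "\<lambda>\<alpha> v. if v \<in> verts f then \<alpha> v else (0 :: nat)"
  let ?P = "\<lambda>\<alpha>. \<Prod>v\<in>verts T. [:lam v x, g v \<bullet> n:] ^ \<alpha> v"
  let ?E = "\<lambda>\<alpha>. \<Prod>w\<in>verts T - verts f. (g w \<bullet> n) ^ \<alpha> w"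
  let ?L = "{\<alpha> \<in> lattice_on k T. lattice_dist T \<alpha> f = s}"
  note line = coeff_mon_along_line[OF f x]
  have sub: "verts f \<subseteq> verts T" using face_verts_subset[OF f] .
  have fin: "finite (verts f)" using sub finite_verts finite_subset by blast
  note finT = finite_lattice_on[OF finite_verts, of k]
  have "lattice_poly k c (x + t *\<^sub>R n) = poly (\<Sum>\<alpha>\<in>lattice_on k T. smult (c \<alpha>) (?P \<alpha>)) t" for t
    unfolding lattice_poly_def poly_sum by (intro sum.cong) (simp_all add: line(1))
  from dir_derivs_replicate_eq_coeff[OF poly_deg_lattice_poly this]
  have "dir_derivs (replicate s n) (lattice_poly k c) x = fact s * (\<Sum>\<alpha>\<in>lattice_on k T. c \<alpha> * coeff (?P \<alpha>) s)"
    by (simp add: coeff_sum)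
  also have "(\<Sum>\<alpha>\<in>lattice_on k T. c \<alpha> * coeff (?P \<alpha>) s)
    = (\<Sum>\<alpha>\<in>lattice_on k T. if lattice_dist T \<alpha> f = s then c \<alpha> * (?E \<alpha> * mon (verts f) \<alpha> x) else 0)"
  proof (intro sum.cong refl)
    fix \<alpha> assume \<alpha>: "\<alpha> \<in> lattice_on k T"
    consider "lattice_dist T \<alpha> f < s" | "lattice_dist T \<alpha> f = s" | "s < lattice_dist T \<alpha> f" by linarith
    then show "c \<alpha> * coeff (?P \<alpha>) s
      = (if lattice_dist T \<alpha> f = s then c \<alpha> * (?E \<alpha> * mon (verts f) \<alpha> x) else 0)"
      by cases (simp_all add: low[OF \<alpha>] line(2) line(3))
  qed
  also have "\<dots> = (\<Sum>\<alpha>\<in>?L. c \<alpha> * (?E \<alpha> * mon (verts f) \<alpha> x))"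
    using finT by (simp add: sum.inter_filter)
  also have "\<dots> = (\<Sum>\<alpha>\<in>?L. c \<alpha> * (?E \<alpha> * mon (verts f) (?res \<alpha>) x))"
    by (intro sum.cong) (simp_all add: mon_def)
  \<comment> \<open>Group the exponents by their values on the vertices of \<open>f\<close>.\<close>
  also have "\<dots> = (\<Sum>\<beta>\<in>lattice_on (k - s) f. \<Sum>\<alpha> | \<alpha> \<in> ?L \<and> ?res \<alpha> = \<beta>.
      c \<alpha> * (?E \<alpha> * mon (verts f) (?res \<alpha>) x))"
  proof (rule sum.group[symmetric])
    show "?res ` ?L \<subseteq> lattice_on (k - s) f"
    proof (rule image_subsetI)
      fix \<alpha> assume "\<alpha> \<in> ?L"
      then have "sum \<alpha> (verts f) = k - s" using lattice_dist_split[OF f, of \<alpha> k] by auto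
      moreover have "sum (?res \<alpha>) (verts f) = sum \<alpha> (verts f)" by (intro sum.cong) simp_all
      ultimately show "?res \<alpha> \<in> lattice_on (k - s) f" by (simp add: lattice_on_def)
    qed
  qed (use finT finite_lattice_on[OF fin] in simp_all)
  also have "\<dots> = (\<Sum>\<beta>\<in>lattice_on (k - s) f.
      (\<Sum>\<alpha> | \<alpha> \<in> lattice_on k T \<and> lattice_dist T \<alpha> f = s \<and> ?res \<alpha> = \<beta>. c \<alpha> * ?E \<alpha>) * mon (verts f) \<beta> x)"
    unfolding sum_distrib_right by (intro sum.cong) auto
  finally show ?thesis by (simp only: mult.assoc sum_distrib_left[symmetric])
qed

lemma derivatives_vanish_on_face:
  assumes f: "f face_of T" and x: "x \<in> f"
    and c: "\<And>\<alpha>. \<alpha> \<in> lattice_on k T \<Longrightarrow> lattice_dist T \<alpha> f \<le> s \<Longrightarrow> c \<alpha> = 0"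
    and vs: "length vs \<le> s"
  shows "dir_derivs vs (lattice_poly k c) x = 0"
proof -
  have "vanishes_to_order (Suc s) x (\<lambda>x. c \<alpha> * mon (verts T) \<alpha> x)" if \<alpha>: "\<alpha> \<in> lattice_on k T" for \<alpha>
  proof (cases "lattice_dist T \<alpha> f \<le> s")
    case True
    then show ?thesis using c[OF \<alpha> True] by (simp add: vanishes_to_order_scale[OF poly_deg.const[of 0 0]] vanishes_to_order_def)
      (metis dir_derivs_scale[OF poly_deg.const[of 0 0], of _ 0] mult_zero_left)
  next
    case False
    let ?n = "\<lambda>v. if v \<in> verts f then 0 else \<alpha> v"
    have "vanishes_to_order (?n v) x (\<lambda>x. lam v x ^ \<alpha> v)" if "v \<in> verts T" for v
      using face_coords(1)[OF f x, of v] that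
      by (auto simp: vanishes_to_order_0 lam_def intro!: vanishes_to_order_power poly_deg_affine)
    then have "vanishes_to_order (sum ?n (verts T)) x (mon (verts T) \<alpha>)"
      unfolding mon_def[abs_def] lam_def
      by (intro vanishes_to_order_prod[of _ \<alpha>] poly_deg_power poly_deg_affine) (simp_all add: lam_def)
    moreover have "sum ?n (verts T) = lattice_dist T \<alpha> f"
      unfolding lattice_dist_def using finite_verts
      by (simp add: sum.If_cases Diff_eq)
    ultimately have "vanishes_to_order (Suc s) x (mon (verts T) \<alpha>)" using False vanishes_to_order_mono by fastforce
    then show ?thesis by (rule vanishes_to_order_scale[OF poly_deg_mon])
  qed
  then have "vanishes_to_order (Suc s) x (lattice_poly k c)"
    unfolding lattice_poly_def[abs_def]
    by (intro vanishes_to_order_sum[of _ k] poly_deg_scale poly_deg_mon_eq) (simp_all add: lattice_on_def)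
  then show ?thesis using vs by (simp add: vanishes_to_order_def)
qed

end

section \<open>Determination of the coefficients by the degrees of freedom\<close>

lemma subsimplices_trans: "e \<in> subsimplices i f \<Longrightarrow> f \<in> subsimplices l T \<Longrightarrow> e \<in> subsimplices i T"
  by (auto simp: subsimplices_def intro: face_of_trans)

context simplex_numbering
begin

lemma subsimplices_nonempty: "f \<in> subsimplices l T \<Longrightarrow> f \<noteq> {}"
  by (auto simp: subsimplices_def)

lemma subsimplices_dim_le: "f \<in> subsimplices l T \<Longrightarrow> l \<le> CARD('d)"
  using subsimplices_verts(4,6)[of f l T] card_mono[OF finite_verts, of "verts f"]
    simplex_verts(2)[OF simplex] by simp

text \<open>The functional belonging to \<open>\<beta>\<close> turns the derivative in the normal direction \<open>n\<close> into a polynomial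
  in the values at \<open>n\<close> of the linear parts of the coordinates off \<open>f\<close>. These values are
  arbitrary, so the coefficients of the polynomial vanish, and \<open>c \<alpha>0\<close> is one of them.\<close>

lemma coefficient_at_distance:
  assumes f: "f face_of T" "f \<noteq> {}"
    and \<alpha>0: "\<alpha>0 \<in> lattice_on k T" "lattice_dist T \<alpha>0 f = s"
    and \<beta>: "\<beta> = (\<lambda>v. if v \<in> verts f then \<alpha>0 v else 0)"
    and low: "\<And>\<alpha>. \<alpha> \<in> lattice_on k T \<Longrightarrow> lattice_dist T \<alpha> f < s \<Longrightarrow> c \<alpha> = 0"
    and zero: "\<And>n. n \<in> normal_plane f \<Longrightarrow> bernstein_fun f (k - s) \<beta> (dir_derivs (replicate s n) (lattice_poly k c)) = 0"
  shows "c \<alpha>0 = 0"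
proof -
  let ?res = "\<lambda>\<alpha> v. if v \<in> verts f then \<alpha> v else (0 :: nat)"
  let ?W = "verts T - verts f"
  let ?A = "{\<alpha>. \<alpha> \<in> lattice_on k T \<and> lattice_dist T \<alpha> f = s \<and> ?res \<alpha> = \<beta>}"
  have "sum \<beta> (verts f) = sum \<alpha>0 (verts f)" unfolding \<beta> by (intro sum.cong) simp_all
  then have \<beta>L: "\<beta> \<in> lattice_on (k - s) f"
    using lattice_dist_split[OF f(1) \<alpha>0(1)] \<alpha>0(2) by (simp add: lattice_on_def \<beta>)
  have sum0: "(\<Sum>\<alpha>\<in>?A. c \<alpha> * (\<Prod>w\<in>?W. (g w \<bullet> n) ^ \<alpha> w)) = 0" if n: "n \<in> normal_plane f" for n
  proof -
    have "bernstein_fun f (k - s) \<beta> (dir_derivs (replicate s n) (lattice_poly k c))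
      = fact s * (\<Sum>\<alpha>\<in>?A. c \<alpha> * (\<Prod>w\<in>?W. (g w \<bullet> n) ^ \<alpha> w)) / bernstein_factor f (k - s) \<beta>"
      by (rule bernstein_fun_coefficient[OF f \<beta>L]) (rule normal_derivative_expansion[OF f(1) _ low])
    then show ?thesis using zero[OF n] bernstein_factor_nz by simp
  qed
  show ?thesis
  proof (rule monomials_independent[of ?W ?A c \<alpha>0])
    show "finite ?W" using finite_verts by simp
    show "finite ?A" using finite_lattice_on[OF finite_verts, of k] by simp
    show "\<alpha>0 \<in> ?A" using \<alpha>0 \<beta> by simp
    show "inj_on (\<lambda>\<alpha>. restrict \<alpha> ?W) ?A"
    proof (rule inj_onI)
      fix \<alpha> \<alpha>' assume *: "\<alpha> \<in> ?A" "\<alpha>' \<in> ?A" "restrict \<alpha> ?W = restrict \<alpha>' ?W"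
      have "\<alpha> v = \<alpha>' v" for v
      proof -
        consider "v \<in> verts f" | "v \<in> ?W" | "v \<notin> verts T" by blast
        then show ?thesis
        proof cases
          case 1
          have "?res \<alpha> = \<beta>" "?res \<alpha>' = \<beta>" using *(1,2) by blast+
          from fun_cong[OF trans[OF this(1) this(2)[symmetric]], of v]
          have "?res \<alpha> v = ?res \<alpha>' v" .
          then show ?thesis using 1 by simp
        next
          case 2
          then show ?thesis using *(3) by (metis restrict_apply')
        next
          case 3
          then show ?thesis using *(1,2) by (simp add: lattice_on_def)
        qed
      qed
      then show "\<alpha> = \<alpha>'" by blast
    qed
    fix t :: "real ^ 'd \<Rightarrow> real"
    obtain n where n: "n \<in> normal_plane f" "\<forall>w\<in>?W. g w \<bullet> n = t w"
      using normal_vector_exists[OF f, of t] by blast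
    have "(\<Sum>\<alpha>\<in>?A. c \<alpha> * (\<Prod>w\<in>?W. t w ^ \<alpha> w)) = (\<Sum>\<alpha>\<in>?A. c \<alpha> * (\<Prod>w\<in>?W. (g w \<bullet> n) ^ \<alpha> w))"
      using n(2) by (intro sum.cong arg_cong2[where f = "(*)"] prod.cong) auto
    then show "(\<Sum>\<alpha>\<in>?A. c \<alpha> * (\<Prod>w\<in>?W. t w ^ \<alpha> w)) = 0" using sum0[OF n(1)] by simp
  qed
qed

text \<open>The degrees of freedom on \<open>f\<close> and its sub-simplices, expressed for a polynomial \<open>q\<close> on the whole
  space. This form does not refer to the values of \<open>q\<close> on one element and applies to the
  difference of polynomials that belong to different elements.\<close>

definition dofs_vanish_on ::
  "((real ^ 'd) set \<Rightarrow> (real ^ 'd) list) \<Rightarrow> nat \<Rightarrow> (nat \<Rightarrow> nat) \<Rightarrow> (real ^ 'd \<Rightarrow> real) \<Rightarrow> (real ^ 'd) set \<Rightarrow> bool"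
  where "dofs_vanish_on N k r q f \<longleftrightarrow>
    (\<forall>i. \<forall>e\<in>subsimplices i f. \<forall>(a, \<gamma>)\<in>S_hat num k r T i e.
      bernstein_dual num e (k - sum_list \<gamma>) a (\<lambda>x\<in>e. dir_derivs (concat (map2 replicate \<gamma> (N e))) q x) = 0)"

definition normal_bases :: "((real ^ 'd) set \<Rightarrow> (real ^ 'd) list) \<Rightarrow> bool" where
  "normal_bases N \<longleftrightarrow> (\<forall>l<CARD('d). \<forall>f\<in>subsimplices l T.
      length (N f) = CARD('d) - l \<and> distinct (N f) \<and> span (set (N f)) = normal_plane f)"

text \<open>The central lemma. The outer induction is on the dimension of \<open>f\<close>, the inner one on the distance
  from \<open>f\<close>. An exponent close to \<open>f\<close> but not in \<open>lattice_S k r T l f\<close> is close to a proper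
  sub-simplex, where the outer hypothesis applies.\<close>

lemma coefficients_vanish_near_face:
  assumes N: "normal_bases N"
  shows "f \<in> subsimplices l T \<Longrightarrow> dofs_vanish_on N k r (lattice_poly k c) f \<Longrightarrow> \<alpha> \<in> lattice_D k T f (r l) \<Longrightarrow> c \<alpha> = 0"
proof (induction l arbitrary: f \<alpha> rule: less_induct)
  case (less l)
  note f = less.prems(1)
  note fv = subsimplices_verts[OF f]
  let ?q = "lattice_poly k c"
  let ?res = "\<lambda>\<alpha> v. if v \<in> verts f then \<alpha> v else (0 :: nat)"
  have IH: "c \<alpha> = 0" if "i < l" "e \<in> subsimplices i f" "\<alpha> \<in> lattice_D k T e (r i)" for i e \<alpha>
  proof (rule less.IH[OF that(1) subsimplices_trans[OF that(2) f] _ that(3)])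
    show "dofs_vanish_on N k r ?q e"
      using less.prems(2) subsimplices_trans[OF _ that(2)] unfolding dofs_vanish_on_def by blast
  qed
  have "c \<alpha> = 0" if "\<alpha> \<in> lattice_on k T" "lattice_dist T \<alpha> f = s" "s \<le> r l" for s \<alpha>
    using that
  proof (induction s arbitrary: \<alpha> rule: less_induct)
    case (less s)
    show ?case
    proof (cases "\<alpha> \<in> lattice_S k r T l f")
      case False
      then show ?thesis
        using less.prems IH unfolding lattice_S_def lattice_D_def by auto
    next
      case True
      define \<beta> where "\<beta> = ?res \<alpha>"
      have sum: "sum \<alpha> (verts f) = k - s" "s \<le> k"
        using lattice_dist_split[OF fv(1) less.prems(1)] less.prems(2) by auto
      have "sum \<beta> (verts f) = sum \<alpha> (verts f)" unfolding \<beta>_def by (intro sum.cong) simp_all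
      then have \<beta>L: "\<beta> \<in> lattice_on (k - s) f" using sum by (simp add: lattice_on_def \<beta>_def)
      have R: "lattice_R num f \<alpha> = lattice_R num f \<beta>"
        using lattice_R_eq_iff[OF fv(1)] by (simp add: \<beta>_def)
      have suml: "sum_list (lattice_R num f \<alpha>) = k - s"
        using vlist[OF fv(1)] sum(1) by (simp add: lattice_R_def sum_list_distinct_conv_sum_set)
      have dof0: "bernstein_fun f (k - s) \<beta> (dir_derivs (concat (map2 replicate \<gamma> (N f))) ?q) = 0"
        if \<gamma>: "\<gamma> \<in> multi_indices (CARD('d) - l) s" for \<gamma>
      proof -
        have mem: "(lattice_R num f \<alpha>, \<gamma>) \<in> S_hat num k r T l f"
          using True \<gamma> suml sum(2) by (auto simp: S_hat_def)
        have "f \<in> subsimplices l f" using subsimplices_top(1)[OF fv(2)] .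
        then have "bernstein_dual num f (k - sum_list \<gamma>) (lattice_R num f \<alpha>)
            (\<lambda>x\<in>f. dir_derivs (concat (map2 replicate \<gamma> (N f))) ?q x) = 0"
          using less.prems mem \<open>dofs_vanish_on N k r ?q f\<close> unfolding dofs_vanish_on_def by fast
        moreover have "sum_list \<gamma> = s" using \<gamma> by (simp add: multi_indices_def)
        ultimately show ?thesis unfolding bernstein_fun_def R by simp
      qed
      show ?thesis
      proof (rule coefficient_at_distance[OF fv(1) subsimplices_nonempty[OF f] less.prems(1,2) \<beta>_def])
        show "c \<alpha>' = 0" if "\<alpha>' \<in> lattice_on k T" "lattice_dist T \<alpha>' f < s" for \<alpha>'
          using less.IH[OF that(2) that(1) refl] that(2) less.prems(3) by simp
      next
        fix n assume n: "n \<in> normal_plane f"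
        show "bernstein_fun f (k - s) \<beta> (dir_derivs (replicate s n) ?q) = 0"
        \<comment> \<open>For \<open>l = CARD('d)\<close> there is no normal basis, but then \<open>f = T\<close> and \<open>s = 0\<close>.\<close>
        proof (cases "l < CARD('d)")
          case True
          then have Nf: "length (N f) = CARD('d) - l" "distinct (N f)" "span (set (N f)) = normal_plane f"
            using N f unfolding normal_bases_def by auto
          have "bernstein_fun f (k - s) \<beta> (dir_derivs ([] @ replicate s n) ?q) = 0"
          proof (rule polarization[OF poly_deg_lattice_poly, where d = s and j = "k - s" and S = "set (N f)"])
            fix ws assume ws: "set ws \<subseteq> set (N f)" "length ws = s"
            obtain \<gamma> where \<gamma>: "\<gamma> \<in> multi_indices (length (N f)) (length ws)"
              "mset ws = mset (concat (map2 replicate \<gamma> (N f)))"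
              using mset_sorted_by_basis[OF Nf(2) ws(1)] .
            show "bernstein_fun f (k - s) \<beta> (dir_derivs ws ?q) = 0"
              unfolding dir_derivs_mset[OF poly_deg_lattice_poly \<gamma>(2)] using dof0 \<gamma>(1) ws(2) Nf(1) by simp
          next
            show "set (replicate s n) \<subseteq> span (set (N f))"
              using n Nf(3) by (auto simp: set_replicate_conv_if)
          qed (use bernstein_fun_linear[OF fv(1) subsimplices_nonempty[OF f] \<beta>L] in auto)
          then show ?thesis by simp
        next
          case False
          then have "l = CARD('d)" using subsimplices_dim_le[OF f] by simp
          then have "f = T" using subsimplices_top(2)[OF simplex] f by simp
          then have "s = 0" using less.prems(2) by (simp add: lattice_dist_def)
          then show ?thesis
            using dof0[of "[]"] \<open>l = CARD('d)\<close> by (simp add: multi_indices_def)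
        qed
      qed
    qed
  qed
  then show ?case using less.prems(3) unfolding lattice_D_def by blast
qed

section \<open>Counting the degrees of freedom\<close>

text \<open>An exponent within distance \<open>r l\<close> of \<open>f\<close> and \<open>r l'\<close> of \<open>f'\<close> is within distance \<open>r l + r l'\<close>, hence
  within \<open>2 * r l'\<close>, of the common vertices. If there are any, the doubling condition places it
  close to the sub-simplex that they span, which is excluded in \<open>lattice_S k r T l f\<close>. If there are
  none, the distance is all of \<open>k\<close>, which is too large.\<close>

lemma lattice_S_disjoint:
  assumes mono: "\<And>i j. i \<le> j \<Longrightarrow> j < CARD('d) \<Longrightarrow> r j \<le> r i"
    and double: "\<forall>l. l + 2 \<le> CARD('d) \<longrightarrow> r l \<ge> 2 * r (l + 1)"
    and deg: "k \<ge> 2 * r 0 + 1"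
    and f: "f \<in> subsimplices l T" "f' \<in> subsimplices l' T" and le: "l' \<le> l"
    and \<alpha>: "\<alpha> \<in> lattice_S k r T l f" "\<alpha> \<in> lattice_S k r T l' f'"
  shows "f = f'"
proof (rule ccontr)
  assume ne: "f \<noteq> f'"
  note fv = subsimplices_verts[OF f(1)] and fv' = subsimplices_verts[OF f(2)]
  have \<alpha>L: "\<alpha> \<in> lattice_on k T" "lattice_dist T \<alpha> f \<le> r l" "lattice_dist T \<alpha> f' \<le> r l'"
    using \<alpha> by (auto simp: lattice_S_def lattice_D_def)
  have excl: "\<alpha> \<notin> lattice_D k T e (r i)" if "i < l" "e \<in> subsimplices i f" for i e
    using \<alpha>(1) that by (auto simp: lattice_S_def)
  have face: "convex hull c \<in> subsimplices (card c - 1) f" "verts (convex hull c) = c"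
    if "c \<subseteq> verts f" "c \<noteq> {}" for c
    using subsimplices_of_vertex_set[OF fv(2) that] by auto
  let ?E = "verts f \<inter> verts f'"
  have nsub: "\<not> verts f' \<subseteq> verts f"
  proof
    assume sub: "verts f' \<subseteq> verts f"
    have ne': "verts f' \<noteq> {}" using fv'(4) by auto
    have f'f: "f' \<in> subsimplices l' f"
      using face(1)[OF sub ne'] fv'(4) unfolding fv'(5)[symmetric] by simp
    show False
    proof (cases "l' < l")
      case True
      then show ?thesis using excl[OF True f'f] \<alpha>L by (simp add: lattice_D_def)
    next
      case False
      then have "l' = l" using le by simp
      then show ?thesis using subsimplices_top(2)[OF fv(2), of f'] f'f ne by blast
    qed
  qed
  then have "verts f \<noteq> verts T" using fv'(6) by blast
  then have "card (verts f) < card (verts T)"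
    using fv(6) finite_verts by (intro psubset_card_mono) auto
  then have l: "l < CARD('d)" using fv(4) simplex_verts(2)[OF simplex] by simp
  have rl: "r l \<le> r l'" using mono[OF le l] .
  have dist: "sum \<alpha> (verts T - ?E) \<le> r l + r l'"
  proof -
    have "verts T - ?E = (verts T - verts f) \<union> (verts T - verts f')" by blast
    then have "sum \<alpha> (verts T - ?E) \<le> sum \<alpha> (verts T - verts f) + sum \<alpha> (verts T - verts f')"
      using finite_verts by (simp add: sum_Un_nat)
    then show ?thesis using \<alpha>L(2,3) by (simp add: lattice_dist_def)
  qed
  show False
  proof (cases "?E = {}")
    case True
    then have "k \<le> r l + r l'" using dist \<alpha>L(1) by (simp add: lattice_on_def)
    moreover have "r l' \<le> r 0" using mono[of 0 l'] le l by simp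
    ultimately show ?thesis using rl deg by simp
  next
    case False
    define i where "i = card ?E - 1"
    have "?E \<subset> verts f'" using nsub by blast
    then have "card ?E < l' + 1" using psubset_card_mono[OF fv'(3)] fv'(4) by metis
    moreover have "card ?E > 0" using False fv(3) by (simp add: card_gt_0_iff)
    ultimately have i: "i < l'" by (simp add: i_def)
    have "2 * r l' \<le> r (l' - 1)" using double[rule_format, of "l' - 1"] i le l by simp
    also have "\<dots> \<le> r i" using mono[of i "l' - 1"] i le l by simp
    finally have "sum \<alpha> (verts T - ?E) \<le> r i" using dist rl by simp
    then have "\<alpha> \<in> lattice_D k T (convex hull ?E) (r i)"
      using \<alpha>L(1) face(2)[of ?E] False by (simp add: lattice_D_def lattice_dist_def)
    then show ?thesis using excl[of i "convex hull ?E"] face(1)[of ?E] False i le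
      by (simp add: i_def)
  qed
qed

text \<open>Every index of a degree of freedom is the image of an exponent: \<open>G\<close> recovers \<open>f\<close> from the exponent,
  which is well defined by disjointness, and lists the values on and off \<open>f\<close>. For surjectivity an
  exponent in \<open>lattice_S k r T l f\<close> is changed to \<open>\<gamma>\<close> off \<open>f\<close>; membership depends only on the values
  on \<open>f\<close>.\<close>

lemma card_dof_index_le:
  assumes "\<And>i j. i \<le> j \<Longrightarrow> j < CARD('d) \<Longrightarrow> r j \<le> r i"
    and "\<forall>l. l + 2 \<le> CARD('d) \<longrightarrow> r l \<ge> 2 * r (l + 1)"
    and "k \<ge> 2 * r 0 + 1"
  shows "finite (dof_index num k r T)" "card (dof_index num k r T) \<le> card (lattice_on k T)"
proof -
  note finL = finite_lattice_on[OF finite_verts, of k]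
  define ws where "ws f = (SOME xs. set xs = verts T - verts f \<and> distinct xs)" for f
  have ws: "set (ws f) = verts T - verts f" "distinct (ws f)" for f
    using someI_ex[OF finite_distinct_list[of "verts T - verts f"]] finite_verts
    by (simp_all add: ws_def)
  define F where "F \<alpha> = (SOME f. \<exists>l. f \<in> subsimplices l T \<and> \<alpha> \<in> lattice_S k r T l f)" for \<alpha>
  have F: "F \<alpha> = f" if f: "f \<in> subsimplices l T" "\<alpha> \<in> lattice_S k r T l f" for \<alpha> f l
  proof -
    have "\<exists>l. F \<alpha> \<in> subsimplices l T \<and> \<alpha> \<in> lattice_S k r T l (F \<alpha>)"
      unfolding F_def by (rule someI[of _ f]) (use f in blast)
    then obtain l' where "F \<alpha> \<in> subsimplices l' T" "\<alpha> \<in> lattice_S k r T l' (F \<alpha>)" by blast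
    then show ?thesis
      using lattice_S_disjoint[OF assms f(1), of "F \<alpha>" l' \<alpha>] lattice_S_disjoint[OF assms _ f(1), of "F \<alpha>" l' \<alpha>] f(2)
      by (metis nle_le)
  qed
  define G where "G \<alpha> = (F \<alpha>, lattice_R num (F \<alpha>) \<alpha>, map \<alpha> (ws (F \<alpha>)))" for \<alpha>
  have "dof_index num k r T \<subseteq> G ` lattice_on k T"
  proof
    fix x assume "x \<in> dof_index num k r T"
    then obtain l f a \<gamma> where x: "x = (f, a, \<gamma>)" and f: "f \<in> subsimplices l T"
      and a\<gamma>: "(a, \<gamma>) \<in> S_hat num k r T l f"
      by (auto simp: dof_index_def)
    note fv = subsimplices_verts[OF f]
    obtain \<alpha> where \<alpha>: "\<alpha> \<in> lattice_S k r T l f" "a = lattice_R num f \<alpha>"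
      and \<gamma>: "\<gamma> \<in> multi_indices (CARD('d) - l) (k - sum_list a)"
      using a\<gamma> by (auto simp: S_hat_def)
    have \<alpha>L: "\<alpha> \<in> lattice_on k T" using \<alpha>(1) by (simp add: lattice_S_def lattice_D_def)
    have suma: "sum_list a = sum \<alpha> (verts f)"
      using vlist[OF fv(1)] unfolding \<alpha>(2) by (simp add: lattice_R_def sum_list_distinct_conv_sum_set)
    have "card (verts T - verts f) = CARD('d) - l"
      using fv(3,4,6) simplex_verts(2)[OF simplex] by (simp add: card_Diff_subset)
    then have len: "length (ws f) = length \<gamma>"
      using \<gamma> distinct_card[OF ws(2), of f] ws(1)[of f] by (simp add: multi_indices_def)
    define \<delta> where "\<delta> v = (if v \<in> verts f then \<alpha> v else if v \<in> verts T then the (map_of (zip (ws f) \<gamma>) v) else 0)" for v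
    have onf: "\<delta> v = \<alpha> v" if "v \<in> verts f" for v using that by (simp add: \<delta>_def)
    have map\<delta>: "map \<delta> (ws f) = \<gamma>"
    proof (rule nth_equalityI)
      show "length (map \<delta> (ws f)) = length \<gamma>" using len by simp
      fix i assume i: "i < length (map \<delta> (ws f))"
      then have "ws f ! i \<in> verts T - verts f" using ws(1)[of f] nth_mem[of i "ws f"] by auto
      then show "map \<delta> (ws f) ! i = \<gamma> ! i"
        using i len ws(2)[of f] by (simp add: \<delta>_def map_of_zip_nth)
    qed
    have dist\<delta>: "lattice_dist T \<delta> f = lattice_dist T \<alpha> f"
    proof -
      have "lattice_dist T \<delta> f = sum_list (map \<delta> (ws f))"
        unfolding lattice_dist_def using ws[of f] by (simp add: sum_list_distinct_conv_sum_set)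
      also have "\<dots> = k - sum \<alpha> (verts f)" using map\<delta> \<gamma> suma by (simp add: multi_indices_def)
      finally show ?thesis using lattice_dist_split[OF fv(1) \<alpha>L] by simp
    qed
    have eq: "sum \<delta> (verts T - B) = sum \<alpha> (verts T - B)" if B: "B \<subseteq> verts f" for B
    proof -
      have split: "sum h (verts T - B) = sum h (verts T - verts f) + sum h (verts f - B)" for h :: "real ^ 'd \<Rightarrow> nat"
      proof -
        have "verts T - B = (verts T - verts f) \<union> (verts f - B)" using B fv(6) by blast
        moreover have "sum h ((verts T - verts f) \<union> (verts f - B)) = sum h (verts T - verts f) + sum h (verts f - B)"
          using fv(3) finite_verts by (intro sum.union_disjoint) auto
        ultimately show ?thesis by simp
      qed
      have "sum \<delta> (verts f - B) = sum \<alpha> (verts f - B)" using onf by (intro sum.cong) auto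
      then show ?thesis using split[of \<delta>] split[of \<alpha>] dist\<delta> by (simp add: lattice_dist_def)
    qed
    have \<delta>L: "\<delta> \<in> lattice_on k T"
      using \<alpha>L eq[of "{}"] fv(6) by (auto simp: lattice_on_def \<delta>_def)
    have D: "\<delta> \<in> lattice_D k T e \<rho> \<longleftrightarrow> \<alpha> \<in> lattice_D k T e \<rho>" if "verts e \<subseteq> verts f" for e \<rho>
      using \<delta>L \<alpha>L eq[OF that] by (simp add: lattice_D_def lattice_dist_def)
    have "\<delta> \<in> lattice_S k r T l f"
      using \<alpha>(1) D subsimplices_verts(6) unfolding lattice_S_def by fastforce
    then have "F \<delta> = f" using F[OF f] by blast
    then have "G \<delta> = x"
      using map\<delta> x \<alpha>(2) lattice_R_eq_iff[OF fv(1), of \<delta> \<alpha>] onf by (simp add: G_def)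
    then show "x \<in> G ` lattice_on k T" using \<delta>L by blast
  qed
  then show "finite (dof_index num k r T)" "card (dof_index num k r T) \<le> card (lattice_on k T)"
    using finL finite_subset card_mono card_image_le le_trans
    by (blast, meson finL finite_imageI card_mono card_image_le le_trans)
qed

end

section \<open>Degrees of freedom as functionals on polynomials\<close>

context simplex_coordinates
begin

lemma global_expansion: "poly_deg n p \<Longrightarrow> \<exists>c. p = lattice_poly n c"
proof -
  assume p: "poly_deg n p"
  have "expansion (lattice_on n T) (mon (verts T)) UNIV p"
    by (rule lattice_expansion[OF finite_verts lam_sum lam_rep p])
  then show ?thesis by (auto simp: expansion_def lattice_poly_def fun_eq_iff)
qed

text \<open>At a vertex of \<open>T\<close> the coordinate directions need not point into \<open>T\<close>. Uniqueness follows instead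
  along the segments to the vertices, whose directions span the space.\<close>

lemma has_derivative_within_simplex_unique:
  fixes u :: "real ^ 'd \<Rightarrow> real"
  assumes x: "x \<in> T" and D: "(u has_derivative D) (at x within T)" "(u has_derivative E) (at x within T)"
  shows "D = E"
proof -
  have conv: "convex T" using simplex convex_simplex by blast
  have edge: "D (z - x) = E (z - x)" if z: "z \<in> T" for z
  proof -
    have sub: "(\<lambda>t. x + t *\<^sub>R (z - x)) ` {0..1} \<subseteq> T"
      using convexD_alt[OF conv x z] by (auto simp: algebra_simps)
    have path: "((\<lambda>t. x + t *\<^sub>R (z - x)) has_derivative (\<lambda>t. t *\<^sub>R (z - x))) (at 0 within {0..1})"
      by (auto intro!: derivative_eq_intros)
    have "((\<lambda>t. u (x + t *\<^sub>R (z - x))) has_vector_derivative F (z - x)) (at 0 within {0..1})"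
      if F: "(u has_derivative F) (at x within T)" for F
    proof -
      have "((\<lambda>t. u (x + t *\<^sub>R (z - x))) has_derivative (\<lambda>t. F (t *\<^sub>R (z - x)))) (at 0 within {0..1})"
        using has_derivative_in_compose[OF path, of u F] has_derivative_subset[OF _ sub, of u F x] F
        by simp
      moreover have "F (t *\<^sub>R (z - x)) = t *\<^sub>R F (z - x)" for t
        using linear_scale[OF has_derivative_linear[OF F]] by blast
      ultimately show ?thesis by (simp add: has_vector_derivative_def)
    qed
    from vector_derivative_unique_within_closed_interval[of 0 1 0,
        OF _ _ this[OF D(1), folded cbox_interval] this[OF D(2), folded cbox_interval]]
    show ?thesis by simp
  qed
  have vert: "v \<in> T" if "v \<in> verts T" for v
    using that by (simp add: verts_def extreme_point_of_def)
  have lin: "linear D" "linear E" using D has_derivative_linear by blast+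
  show ?thesis
  proof
    fix y
    have "y = (\<Sum>v\<in>verts T. lam v (x + y) *\<^sub>R v) - (\<Sum>v\<in>verts T. lam v (x + y)) *\<^sub>R x"
      by (simp add: lam_sum lam_rep)
    also have "\<dots> = (\<Sum>v\<in>verts T. lam v (x + y) *\<^sub>R (v - x))"
      by (simp add: scaleR_diff_right sum_subtractf scaleR_sum_left)
    finally have y: "y = (\<Sum>v\<in>verts T. lam v (x + y) *\<^sub>R (v - x))" .
    have "D (\<Sum>v\<in>verts T. lam v (x + y) *\<^sub>R (v - x)) = E (\<Sum>v\<in>verts T. lam v (x + y) *\<^sub>R (v - x))"
      using edge vert by (simp add: linear_sum[OF lin(1)] linear_sum[OF lin(2)]
          linear_scale[OF lin(1)] linear_scale[OF lin(2)])
    then show "D y = E y" unfolding y[symmetric] .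
  qed
qed

lemma partial_deriv_on_simplex:
  assumes p: "poly_deg n p" and u: "\<And>y. y \<in> T \<Longrightarrow> u y = p y" and x: "x \<in> T"
  shows "partial_deriv T i u x = dir_deriv (axis i 1) p x"
proof -
  have "(u has_derivative (\<lambda>v. dir_deriv v p x)) (at x within T)"
    by (rule has_derivative_transform[OF x u has_derivative_at_withinI[OF poly_deg_deriv[OF p]]])
  moreover from this have "(u has_derivative frechet_derivative u (at x within T)) (at x within T)"
    using frechet_derivative_works differentiable_def by blast
  ultimately have "frechet_derivative u (at x within T) = (\<lambda>v. dir_deriv v p x)"
    using has_derivative_within_simplex_unique[OF x] by blast
  then show ?thesis by (simp add: partial_deriv_def)
qed

lemma grad_tensor_on_simplex:
  assumes p: "poly_deg n p" and u: "\<And>y. y \<in> T \<Longrightarrow> u y = p y" and x: "x \<in> T"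
  shows "grad_tensor T u x is = dir_derivs (map (\<lambda>i. axis i 1) is) p x"
  using x unfolding grad_tensor_def
proof (induction "is" arbitrary: x)
  case (Cons i "is")
  show ?case
    using partial_deriv_on_simplex[OF poly_deg_dir_derivs[OF p, of "map (\<lambda>i. axis i 1) is"], OF Cons.IH Cons.prems]
    by simp
qed (simp add: u)

end

lemma dir_deriv_components:
  assumes "poly_deg n p"
  shows "dir_deriv v p x = (\<Sum>i\<in>UNIV. v $ i * dir_deriv (axis i 1) p x)"
proof -
  have "dir_deriv v p x = dir_deriv (\<Sum>i\<in>UNIV. (v $ i) *\<^sub>R axis i 1) p x"
    using basis_expansion[of v] by (simp add: scalar_mult_eq_scaleR)
  also have "\<dots> = (\<Sum>i\<in>UNIV. v $ i * dir_deriv (axis i 1) p x)"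
    by (simp add: linear_sum[OF dir_deriv_linear[OF assms]] linear_scale[OF dir_deriv_linear[OF assms]])
  finally show ?thesis .
qed

lemma sum_over_Cons_lists:
  "(\<Sum>is | length is = Suc n. h is) = (\<Sum>i\<in>(UNIV :: 'd::finite set). \<Sum>is | length is = n. h (i # is))"
proof -
  have "{is :: 'd list. length is = Suc n} = (\<lambda>(i, is). i # is) ` (UNIV \<times> {is. length is = n})"
    by (auto simp: length_Suc_conv image_iff)
  then have "(\<Sum>is | length is = Suc n. h is) = (\<Sum>x\<in>UNIV \<times> {is. length is = n}. h (fst x # snd x))"
    by (simp add: sum.reindex inj_on_def case_prod_beta)
  then show ?thesis by (simp add: sum.cartesian_product case_prod_beta)
qed

lemma tensor_prod_Cons: "tensor_prod (v # vs) (i # is) = v $ i * tensor_prod vs is"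
  unfolding tensor_prod_def by (simp add: prod.lessThan_Suc_shift del: prod.lessThan_Suc)

text \<open>Multilinearity expresses an iterated directional derivative by iterated partial derivatives; so
  the tensor contraction in \<^const>\<open>normal_deriv\<close> is an iterated directional derivative.\<close>

lemma dir_derivs_eq_tensor_inner:
  assumes p: "poly_deg n p"
  shows "dir_derivs vs p x = tensor_inner (length vs) (\<lambda>is. dir_derivs (map (\<lambda>i. axis i 1) is) p x) (tensor_prod vs)"
  unfolding tensor_inner_def
proof (induction vs arbitrary: x)
  case Nil
  show ?case by (simp add: tensor_prod_def)
next
  case (Cons v vs)
  let ?e = "map (\<lambda>i. axis i 1 :: real ^ 'd)"
  have eq: "dir_derivs vs p = (\<lambda>x. \<Sum>is | length is = length vs. tensor_prod vs is * dir_derivs (?e is) p x)"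
    by (rule ext) (simp add: Cons.IH mult.commute)
  have "dir_derivs (v # vs) p x = dir_deriv v (dir_derivs vs p) x" by simp
  also have "\<dots> = (\<Sum>is | length is = length vs. tensor_prod vs is * dir_deriv v (dir_derivs (?e is) p) x)"
  proof -
    have pe: "poly_deg n (dir_derivs (?e is) p)" for "is" using poly_deg_mono[OF poly_deg_dir_derivs[OF p]] by simp
    then show ?thesis unfolding eq
      by (subst dir_deriv_sum[OF poly_deg_scale[OF pe]]) (simp_all add: dir_deriv_scale[OF pe])
  qed
  also have "\<dots> = (\<Sum>is | length is = length vs. \<Sum>i\<in>UNIV.
      dir_derivs (?e (i # is)) p x * tensor_prod (v # vs) (i # is))"
    by (simp add: dir_deriv_components[OF poly_deg_dir_derivs[OF p], of v] tensor_prod_Cons sum_distrib_left mult_ac)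
  also have "\<dots> = (\<Sum>is | length is = length (v # vs). dir_derivs (?e is) p x * tensor_prod (v # vs) is)"
    by (simp only: length_Cons sum_over_Cons_lists) (rule sum.swap)
  finally show ?case .
qed

context simplex_numbering
begin

lemma normal_deriv_on_simplex:
  assumes p: "poly_deg n p" and u: "\<And>y. y \<in> T \<Longrightarrow> u y = p y" and x: "x \<in> T"
    and len: "length (concat (map2 replicate \<gamma> Ns)) = sum_list \<gamma>"
  shows "normal_deriv T Ns \<gamma> u x = dir_derivs (concat (map2 replicate \<gamma> Ns)) p x"
  unfolding normal_deriv_def dir_derivs_eq_tensor_inner[OF p, of "concat (map2 replicate \<gamma> Ns)"] len
    tensor_inner_def
  by (simp only: grad_tensor_on_simplex[OF p u x])

text \<open>The list \<open>a\<close> comes from an exponent on all of \<open>T\<close>; its restriction to \<open>f\<close> is an exponent of the degree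
  in which the Bernstein functional acts.\<close>

lemma S_hat_index:
  assumes f: "f \<in> subsimplices l T" and a\<gamma>: "(a, \<gamma>) \<in> S_hat num k r T l f"
  obtains \<beta> where "\<beta> \<in> lattice_on (k - sum_list \<gamma>) f" "a = lattice_R num f \<beta>"
    "\<gamma> \<in> multi_indices (CARD('d) - l) (sum_list \<gamma>)"
proof -
  note fv = subsimplices_verts[OF f]
  obtain \<alpha> where \<alpha>: "\<alpha> \<in> lattice_S k r T l f" "a = lattice_R num f \<alpha>"
    and \<gamma>: "\<gamma> \<in> multi_indices (CARD('d) - l) (k - sum_list a)"
    using a\<gamma> by (auto simp: S_hat_def)
  have "\<alpha> \<in> lattice_on k T" using \<alpha>(1) by (simp add: lattice_S_def lattice_D_def)
  then have le: "sum \<alpha> (verts f) \<le> k" using lattice_dist_split[OF fv(1)] by (metis le_add1)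
  have suma: "sum_list a = sum \<alpha> (verts f)"
    using vlist[OF fv(1)] unfolding \<alpha>(2) by (simp add: lattice_R_def sum_list_distinct_conv_sum_set)
  define \<beta> where "\<beta> v = (if v \<in> verts f then \<alpha> v else 0)" for v
  have "sum \<beta> (verts f) = sum \<alpha> (verts f)" unfolding \<beta>_def by (intro sum.cong) simp_all
  then have "\<beta> \<in> lattice_on (k - sum_list \<gamma>) f"
    using \<gamma> suma le by (simp add: lattice_on_def \<beta>_def multi_indices_def)
  moreover have "a = lattice_R num f \<beta>"
    unfolding \<alpha>(2) lattice_R_eq_iff[OF fv(1)] by (simp add: \<beta>_def)
  ultimately show ?thesis using that \<gamma> by (simp add: multi_indices_def)
qed

lemma length_normal_directions:
  assumes N: "normal_bases N" and f: "f \<in> subsimplices l T" and a\<gamma>: "(a, \<gamma>) \<in> S_hat num k r T l f"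
  shows "length (concat (map2 replicate \<gamma> (N f))) = sum_list \<gamma>"
proof -
  have \<gamma>: "\<gamma> \<in> multi_indices (CARD('d) - l) (sum_list \<gamma>)" using S_hat_index[OF f a\<gamma>] .
  show ?thesis
  proof (cases "l < CARD('d)")
    case True
    then have "length \<gamma> = length (N f)" using N f \<gamma> by (simp add: normal_bases_def multi_indices_def)
    then show ?thesis by (rule length_concat_replicate)
  next
    case False
    then show ?thesis using \<gamma> by (simp add: multi_indices_def)
  qed
qed

text \<open>The right-hand side refers to \<open>p\<close> as a function on the whole space and to \<open>f\<close>, but no longer to \<open>T\<close>. This
  makes degrees of freedom on neighbouring elements comparable.\<close>

lemma dof_eq:
  assumes N: "normal_bases N" and f: "f \<in> subsimplices l T" and a\<gamma>: "(a, \<gamma>) \<in> S_hat num k r T l f"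
    and p: "poly_deg n p" and u: "\<And>y. y \<in> T \<Longrightarrow> u y = p y"
  shows "dof num k N T (f, a, \<gamma>) u
    = bernstein_dual num f (k - sum_list \<gamma>) a (\<lambda>x\<in>f. dir_derivs (concat (map2 replicate \<gamma> (N f))) p x)"
proof -
  note len = length_normal_directions[OF N f a\<gamma>]
  have "f \<subseteq> T" using subsimplices_verts(1)[OF f] face_of_imp_subset by blast
  then have "(\<lambda>x\<in>f. normal_deriv T (N f) \<gamma> u x) = (\<lambda>x\<in>f. dir_derivs (concat (map2 replicate \<gamma> (N f))) p x)"
    by (intro restrict_ext normal_deriv_on_simplex[OF p u _ len]) auto
  then show ?thesis by (simp only: dof_def prod.case)
qed

lemma dof_functional_linear:
  assumes f: "f \<in> subsimplices l T" and a\<gamma>: "(a, \<gamma>) \<in> S_hat num k r T l f"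
    and N: "normal_bases N" and p: "poly_deg k p" "poly_deg k q"
  shows "bernstein_dual num f (k - sum_list \<gamma>) a
      (\<lambda>x\<in>f. dir_derivs (concat (map2 replicate \<gamma> (N f))) (\<lambda>x. s * p x + t * q x) x)
    = s * bernstein_dual num f (k - sum_list \<gamma>) a (\<lambda>x\<in>f. dir_derivs (concat (map2 replicate \<gamma> (N f))) p x)
    + t * bernstein_dual num f (k - sum_list \<gamma>) a (\<lambda>x\<in>f. dir_derivs (concat (map2 replicate \<gamma> (N f))) q x)"
proof -
  obtain \<beta> where \<beta>: "\<beta> \<in> lattice_on (k - sum_list \<gamma>) f" "a = lattice_R num f \<beta>"
    using S_hat_index[OF f a\<gamma>] .
  note len = length_normal_directions[OF N f a\<gamma>]
  let ?D = "dir_derivs (concat (map2 replicate \<gamma> (N f)))"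
  have D: "poly_deg (k - sum_list \<gamma>) (?D p)" "poly_deg (k - sum_list \<gamma>) (?D q)"
    using poly_deg_dir_derivs[OF p(1), of "concat (map2 replicate \<gamma> (N f))"]
      poly_deg_dir_derivs[OF p(2), of "concat (map2 replicate \<gamma> (N f))"] unfolding len .
  have "?D (\<lambda>x. s * p x + t * q x) = (\<lambda>x. s * ?D p x + t * ?D q x)"
    by (simp only: dir_derivs_add[OF poly_deg_scale[OF p(1)] poly_deg_scale[OF p(2)]] dir_derivs_scale[OF p(1)] dir_derivs_scale[OF p(2)])
  then show ?thesis
    using bernstein_fun_linear[OF subsimplices_verts(1)[OF f] subsimplices_nonempty[OF f] \<beta>(1) D, of s t]
    unfolding bernstein_fun_def \<beta>(2) by (simp only:)
qed

lemma dof_in_dual_space: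
  assumes f: "f \<in> subsimplices l T" and a\<gamma>: "(a, \<gamma>) \<in> S_hat num k r T l f" and N: "normal_bases N"
  shows "dof num k N T (f, a, \<gamma>) \<in> dual_space T (poly_space k T)"
  unfolding dual_space_def
proof (intro CollectI ballI allI)
  fix u v s t assume uv: "u \<in> poly_space k T" "v \<in> poly_space k T"
  obtain p q where p: "poly_deg k p" "u = restrict p T" and q: "poly_deg k q" "v = restrict q T"
    using uv unfolding poly_space_iff by blast
  have pq: "poly_deg k (\<lambda>x. s * p x + t * q x)" using p(1) q(1) by (intro poly_deg.add poly_deg_scale)
  show "dof num k N T (f, a, \<gamma>) (\<lambda>x\<in>T. s * u x + t * v x)
      = s * dof num k N T (f, a, \<gamma>) u + t * dof num k N T (f, a, \<gamma>) v"
    using dof_functional_linear[OF f a\<gamma> N p(1) q(1), of s t]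
    by (subst (1) dof_eq[OF N f a\<gamma> pq], simp add: p q)
      (subst dof_eq[OF N f a\<gamma> p(1)], simp add: p, subst dof_eq[OF N f a\<gamma> q(1)], simp add: q, simp only:)
qed

lemma unisolvence:
  assumes N: "normal_bases N"
    and r_top: "r CARD('d) = 0"
    and mono: "\<And>i j. i \<le> j \<Longrightarrow> j < CARD('d) \<Longrightarrow> r j \<le> r i"
    and double: "\<forall>l. l + 2 \<le> CARD('d) \<longrightarrow> r l \<ge> 2 * r (l + 1)"
    and deg: "k \<ge> 2 * r 0 + 1"
  defines "V \<equiv> poly_space k T" and "I \<equiv> dof_index num k r T" and "F \<equiv> dof num k N T"
  shows "\<forall>u\<in>V. \<forall>v\<in>V. (\<forall>i\<in>I. F i u = F i v) \<longrightarrow> u = v" and "basis_of_dual T V I F"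
proof -
  let ?L = "lattice_on k T"
  define M where "M i \<alpha> = F i (restrict (mon (verts T) \<alpha>) T)" for i \<alpha>
  have finI: "finite I" and card: "card I \<le> card ?L"
    unfolding I_def using card_dof_index_le[OF mono double deg] by auto
  note finL = finite_lattice_on[OF finite_verts, of k]
  have FV: "F i \<in> dual_space T V" if "i \<in> I" for i
  proof -
    obtain l f a \<gamma> where "i = (f, a, \<gamma>)" "f \<in> subsimplices l T" "(a, \<gamma>) \<in> S_hat num k r T l f"
      using \<open>i \<in> I\<close> by (auto simp: I_def dof_index_def)
    then show ?thesis unfolding F_def V_def using dof_in_dual_space[OF _ _ N] by blast
  qed
  have pm: "poly_deg k (mon (verts T) \<alpha>)" if "\<alpha> \<in> ?L" for \<alpha>
    using that by (intro poly_deg_mon_eq) (simp add: lattice_on_def)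
  have functional: "\<phi> (restrict (lattice_poly k c) T) = (\<Sum>\<alpha>\<in>?L. c \<alpha> * \<phi> (restrict (mon (verts T) \<alpha>) T))"
    if "\<phi> \<in> dual_space T V" for \<phi> c
    using dual_space_sum[OF that[unfolded V_def] pm, where I = ?L and c = c] unfolding lattice_poly_def .
  have FM: "F i (restrict (lattice_poly k c) T) = (\<Sum>\<alpha>\<in>?L. M i \<alpha> * c \<alpha>)" if "i \<in> I" for i c
    unfolding functional[OF FV[OF that]] M_def by (simp only: mult.commute)
  have mem: "restrict (lattice_poly k c) T \<in> V" for c
    unfolding V_def by (rule poly_space_restrict[OF poly_deg_lattice_poly])
  have rep: "\<exists>c. u = restrict (lattice_poly k c) T" if "u \<in> V" for u
  proof -
    obtain p where p: "poly_deg k p" "u = restrict p T" using \<open>u \<in> V\<close> unfolding V_def poly_space_iff by blast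
    then show ?thesis using global_expansion[OF p(1)] by blast
  qed
  have ker: "\<forall>\<alpha>\<in>?L. c \<alpha> = 0" if zero: "\<forall>i\<in>I. (\<Sum>\<alpha>\<in>?L. M i \<alpha> * c \<alpha>) = 0" for c
  proof -
    have "dofs_vanish_on N k r (lattice_poly k c) T"
      unfolding dofs_vanish_on_def
    proof (intro allI ballI, clarify)
      fix i e a \<gamma> assume e: "e \<in> subsimplices i T" and a\<gamma>: "(a, \<gamma>) \<in> S_hat num k r T i e"
      then have "(e, a, \<gamma>) \<in> I" using subsimplices_dim_le[OF e] by (auto simp: I_def dof_index_def)
      then have "F (e, a, \<gamma>) (restrict (lattice_poly k c) T) = 0" using FM zero by simp
      then show "bernstein_dual num e (k - sum_list \<gamma>) a
          (\<lambda>x\<in>e. dir_derivs (concat (map2 replicate \<gamma> (N e))) (lattice_poly k c) x) = 0"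
        unfolding F_def by (subst (asm) dof_eq[OF N e a\<gamma> poly_deg_lattice_poly]) simp_all
    qed
    from coefficients_vanish_near_face[OF N subsimplices_top(1)[OF simplex] this]
    show ?thesis using r_top by (simp add: lattice_D_def lattice_dist_def)
  qed
  show "\<forall>u\<in>V. \<forall>v\<in>V. (\<forall>i\<in>I. F i u = F i v) \<longrightarrow> u = v"
  proof (intro ballI impI)
    fix u v assume uv: "u \<in> V" "v \<in> V" "\<forall>i\<in>I. F i u = F i v"
    obtain c d where c: "u = restrict (lattice_poly k c) T" and d: "v = restrict (lattice_poly k d) T"
      using rep[OF uv(1)] rep[OF uv(2)] by blast
    have "\<forall>i\<in>I. (\<Sum>\<alpha>\<in>?L. M i \<alpha> * (c \<alpha> - d \<alpha>)) = 0"
      using uv(3) FM unfolding c d by (simp add: right_diff_distrib sum_subtractf)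
    from ker[OF this] have "lattice_poly k c = lattice_poly k d" unfolding lattice_poly_def[abs_def] by simp
    then show "u = v" unfolding c d by simp
  qed
  note square = trivial_kernel_square_system[OF finI finL card, of M, OF ker]
  show "basis_of_dual T V I F"
    unfolding basis_of_dual_def
  proof (intro conjI ballI allI impI)
    fix c i assume zero: "\<forall>u\<in>V. (\<Sum>i\<in>I. c i * F i u) = 0" and i: "i \<in> I"
    have "\<forall>\<alpha>\<in>?L. (\<Sum>i\<in>I. c i * M i \<alpha>) = 0"
      using zero poly_space_restrict[OF pm] unfolding M_def V_def by blast
    then show "c i = 0" using square(1) i by blast
  next
    fix \<phi> assume \<phi>: "\<phi> \<in> dual_space T V"
    obtain c where c: "\<forall>\<alpha>\<in>?L. \<phi> (restrict (mon (verts T) \<alpha>) T) = (\<Sum>i\<in>I. c i * M i \<alpha>)"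
      using square(2)[of "\<lambda>\<alpha>. \<phi> (restrict (mon (verts T) \<alpha>) T)"] by blast
    have "\<phi> u = (\<Sum>i\<in>I. c i * F i u)" if "u \<in> V" for u
    proof -
      obtain d where d: "u = restrict (lattice_poly k d) T" using rep[OF \<open>u \<in> V\<close>] by blast
      have "\<phi> u = (\<Sum>\<alpha>\<in>?L. d \<alpha> * (\<Sum>i\<in>I. c i * M i \<alpha>))"
        unfolding d functional[OF \<phi>] using c by simp
      also have "\<dots> = (\<Sum>i\<in>I. c i * (\<Sum>\<alpha>\<in>?L. M i \<alpha> * d \<alpha>))"
        by (simp add: sum_distrib_left mult_ac) (rule sum.swap)
      also have "\<dots> = (\<Sum>i\<in>I. c i * F i u)" unfolding d by (simp add: FM)
      finally show ?thesis .
    qed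
    then show "\<exists>c. \<forall>u\<in>V. \<phi> u = (\<Sum>i\<in>I. c i * F i u)" by blast
  qed (use finI FV in auto)
qed

text \<open>The functionals involve normal derivatives only, but the conclusion holds for derivatives in all
  directions, since it comes from the vanishing of the coefficients near \<open>f\<close>.\<close>

lemma derivatives_agree_on_face:
  assumes N: "normal_bases N" and f: "f \<in> subsimplices l T" and q: "poly_deg k q"
    and zero: "dofs_vanish_on N k r q f" and x: "x \<in> f" and vs: "length vs \<le> r l"
  shows "dir_derivs vs q x = 0"
proof -
  obtain c where c: "q = lattice_poly k c" using global_expansion[OF q] by blast
  show ?thesis
    unfolding c
  proof (rule derivatives_vanish_on_face[OF subsimplices_verts(1)[OF f] x _ vs])
    show "c \<alpha> = 0" if "\<alpha> \<in> lattice_on k T" "lattice_dist T \<alpha> f \<le> r l" for \<alpha>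
      using coefficients_vanish_near_face[OF N f zero[unfolded c]] that by (simp add: lattice_D_def)
  qed
qed

end

section \<open>Gluing\<close>

lemma tendsto_within_Union:
  assumes "finite F" "\<And>A. A \<in> F \<Longrightarrow> (h \<longlongrightarrow> l) (at x within A)"
  shows "(h \<longlongrightarrow> l) (at x within \<Union>F)"
  using assms
proof (induction F rule: finite_induct)
  case (insert A F)
  then show ?case by (simp add: at_within_union filterlim_sup)
qed simp

lemma C_diff_on_cong:
  "C_diff_on m S f \<Longrightarrow> (\<And>x. x \<in> S \<Longrightarrow> f x = h x) \<Longrightarrow> C_diff_on m S h"
proof (induction m arbitrary: f h)
  case 0
  then show ?case using continuous_on_cong[of S S f h] by simp
next
  case (Suc m)
  have iff: "(f has_derivative D) (at x within S) \<longleftrightarrow> (h has_derivative D) (at x within S)"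
    if x: "x \<in> S" for x D
    using has_derivative_transform[OF x, of h f D] has_derivative_transform[OF x, of f h D] Suc.prems(2)
    by auto
  then have "partial_deriv S i f x = partial_deriv S i h x" if "x \<in> S" for i x
    using that by (simp add: partial_deriv_def frechet_derivative_def)
  moreover have "h differentiable_on S"
    using Suc.prems(1) iff by (auto simp: differentiable_on_def differentiable_def)
  ultimately show ?case using Suc.IH Suc.prems(1) by fastforce
qed

text \<open>\<open>W vs\<close> is the candidate for the iterated derivative in the directions \<open>vs\<close>; by assumption any element
  containing the point may be used to evaluate it. It is differentiable within each of finitely many
  closed sets that cover \<open>\<Omega>\<close>, with a derivative that is independent of the set, hence it is
  differentiable in \<open>\<Omega>\<close>.\<close>

lemma piecewise_polynomial_C_diff:
  fixes p :: "(real ^ 'd) set \<Rightarrow> real ^ 'd \<Rightarrow> real"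
  assumes \<Omega>: "open \<Omega>" "\<Omega> \<subseteq> \<Union>Th" and Th: "finite Th" "\<And>T. T \<in> Th \<Longrightarrow> closed T"
    and p: "\<And>T. T \<in> Th \<Longrightarrow> poly_deg k (p T)"
    and agree: "\<And>T T' x vs. T \<in> Th \<Longrightarrow> T' \<in> Th \<Longrightarrow> x \<in> T \<Longrightarrow> x \<in> T' \<Longrightarrow> length vs \<le> m
      \<Longrightarrow> dir_derivs vs (p T) x = dir_derivs vs (p T') x"
  shows "\<exists>w. C_diff_on m \<Omega> w \<and> (\<forall>T\<in>Th. \<forall>x\<in>T. w x = p T x)"
proof -
  define W where "W vs x = dir_derivs vs (p (SOME T. T \<in> Th \<and> x \<in> T)) x" for vs x
  have W: "W vs x = dir_derivs vs (p T) x" if T: "T \<in> Th" "x \<in> T" and vs: "length vs \<le> m" for vs x T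
  proof -
    have "(SOME T. T \<in> Th \<and> x \<in> T) \<in> Th \<and> x \<in> (SOME T. T \<in> Th \<and> x \<in> T)"
      by (rule someI[of _ T]) (use T in blast)
    then show ?thesis unfolding W_def using agree T vs by blast
  qed
  have cont: "continuous_on \<Omega> (W vs)" if vs: "length vs \<le> m" for vs
  proof -
    have "continuous_on T (W vs)" if T: "T \<in> Th" for T
      using poly_deg_continuous[OF poly_deg_dir_derivs[OF p[OF T]], of T vs] W[OF T _ vs]
      by (simp cong: continuous_on_cong)
    then have "continuous_on (\<Union>T\<in>Th. T) (W vs)"
      using Th by (intro continuous_on_closed_Union) auto
    then show ?thesis using \<Omega>(2) continuous_on_subset by (metis image_ident)
  qed
  have deriv: "(W vs has_derivative (\<lambda>v. W (v # vs) x)) (at x within \<Omega>)"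
    if vs: "Suc (length vs) \<le> m" and x: "x \<in> \<Omega>" for vs x
  proof -
    obtain T0 where T0: "T0 \<in> Th" "x \<in> T0" using \<Omega>(2) x by blast
    let ?L = "\<lambda>v. W (v # vs) x"
    have L: "?L = (\<lambda>v. dir_deriv v (dir_derivs vs (p T)) x)" if "T \<in> Th" "x \<in> T" for T
      using W[OF that] vs by simp
    have bl: "bounded_linear ?L"
      unfolding L[OF T0] by (rule has_derivative_bounded_linear[OF poly_deg_deriv[OF poly_deg_dir_derivs[OF p[OF T0(1)]]]])
    let ?h = "\<lambda>y. (1 / norm (y - x)) *\<^sub>R (W vs y - (W vs x + ?L (y - x)))"
    have "(?h \<longlongrightarrow> 0) (at x within T)" if T: "T \<in> Th" for T
    proof (cases "x \<in> T")
      case True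
      have "(W vs has_derivative ?L) (at x within T)"
        unfolding L[OF T True]
        using has_derivative_at_withinI[OF poly_deg_deriv[OF poly_deg_dir_derivs[OF p[OF T]]]] W[OF T] vs
        by (intro has_derivative_transform[OF True, of "W vs" "dir_derivs vs (p T)"]) auto
      then show ?thesis unfolding has_derivative_within by blast
    next
      case False
      \<comment> \<open>The set \<open>T\<close> stays away from \<open>x\<close>, so there is nothing to prove.\<close>
      then have "at x within T = bot"
        using Th(2)[OF T] closed_limpt trivial_limit_within by blast
      then show ?thesis by simp
    qed
    then have "(?h \<longlongrightarrow> 0) (at x within \<Union>Th)" by (rule tendsto_within_Union[OF Th(1)])
    then have "(W vs has_derivative ?L) (at x within \<Union>Th)"
      unfolding has_derivative_within using bl by blast
    then show ?thesis using has_derivative_subset \<Omega>(2) by blast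
  qed
  have "C_diff_on j \<Omega> (W vs)" if "j + length vs \<le> m" for j vs
    using that
  proof (induction j arbitrary: vs)
    case 0
    then show ?case using cont by simp
  next
    case (Suc j)
    have len: "Suc (length vs) \<le> m" using Suc.prems by simp
    have "W vs differentiable_on \<Omega>"
      unfolding differentiable_on_def differentiable_def using deriv[OF len] by blast
    moreover have "C_diff_on j \<Omega> (partial_deriv \<Omega> i (W vs))" for i
    proof (rule C_diff_on_cong)
      show "C_diff_on j \<Omega> (W (axis i 1 # vs))" using Suc.IH[of "axis i 1 # vs"] Suc.prems by simp
      fix x assume x: "x \<in> \<Omega>"
      have "(W vs has_derivative (\<lambda>v. W (v # vs) x)) (at x)"
        using deriv[OF len x] by (simp add: at_within_open[OF x \<Omega>(1)])
      then show "W (axis i 1 # vs) x = partial_deriv \<Omega> i (W vs) x"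
        unfolding partial_deriv_def at_within_open[OF x \<Omega>(1)]
        by (metis frechet_derivative_at)
    qed
    ultimately show ?case by simp
  qed
  from this[of m "[]"] have "C_diff_on m \<Omega> (W [])" by simp
  then show ?thesis using W[of _ _ "[]"] by (intro exI[of _ "W []"]) simp
qed

section \<open>Conformity\<close>

lemma simplex_numbering_exists:
  fixes T :: "(real ^ 'd) set"
  assumes "int CARD('d) simplex T" "inj_on num (verts T)"
  obtains g b where "simplex_numbering T g b num"
proof -
  obtain g b where "bary_coords (verts T) g b"
    using bary_coords_exist[OF simplex_verts_indep[OF assms(1)]] simplex_verts(2)[OF assms(1)] by auto
  then have "simplex_numbering T g b num"
    using assms by unfold_locales
  then show ?thesis using that by blast
qed

text \<open>Here \<open>f\<close> is a common face of two elements, and the difference of their polynomials has vanishing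
  degrees of freedom on \<open>f\<close> and its sub-simplices. On the side of \<open>T'\<close> the index set is that of
  \<open>T'\<close>, which is the same by \<open>S_hat_indep\<close>.\<close>

lemma common_derivatives:
  fixes T T' :: "(real ^ 'd) set"
  assumes T: "int CARD('d) simplex T" "inj_on num (verts T)"
    and T': "int CARD('d) simplex T'" "inj_on num (verts T')"
    and N: "\<And>l f S. S \<in> {T, T'} \<Longrightarrow> l < CARD('d) \<Longrightarrow> f \<in> subsimplices l S
      \<Longrightarrow> length (N f) = CARD('d) - l \<and> distinct (N f) \<and> span (set (N f)) = normal_plane f"
    and f: "f \<in> subsimplices l T" "f \<in> subsimplices l T'"
    and p: "poly_deg k p" "poly_deg k p'"
    and dofs: "\<And>i e a \<gamma>. e \<in> subsimplices i T \<Longrightarrow> e \<in> subsimplices i T' \<Longrightarrow> (a, \<gamma>) \<in> S_hat num k r T i e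
      \<Longrightarrow> dof num k N T (e, a, \<gamma>) (restrict p T) = dof num k N T' (e, a, \<gamma>) (restrict p' T')"
    and x: "x \<in> f" and vs: "length vs \<le> r l"
  shows "dir_derivs vs p x = dir_derivs vs p' x"
proof -
  obtain g b where gb: "simplex_numbering T g b num" using simplex_numbering_exists[OF T] .
  obtain g' b' where gb': "simplex_numbering T' g' b' num" using simplex_numbering_exists[OF T'] .
  interpret A: simplex_numbering T g b num by (rule gb)
  interpret B: simplex_numbering T' g' b' num by (rule gb')
  have NA: "A.normal_bases N" unfolding A.normal_bases_def using N by blast
  have NB: "B.normal_bases N" unfolding B.normal_bases_def using N by blast
  let ?q = "\<lambda>x. 1 * p x + (-1) * p' x"
  have q: "poly_deg k ?q" using p by (intro poly_deg.add poly_deg_scale)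
  have "A.dofs_vanish_on N k r ?q f"
    unfolding A.dofs_vanish_on_def
  proof (intro allI ballI, clarify)
    fix i e a \<gamma> assume e: "e \<in> subsimplices i f" and a\<gamma>: "(a, \<gamma>) \<in> S_hat num k r T i e"
    have eA: "e \<in> subsimplices i T" and eB: "e \<in> subsimplices i T'"
      using subsimplices_trans[OF e] f by blast+
    have "inj_on num (verts e)" using T(2) subsimplices_verts(6)[OF eA] inj_on_subset by blast
    then have a\<gamma>': "(a, \<gamma>) \<in> S_hat num k r T' i e"
      using a\<gamma> S_hat_indep[OF T(1) T'(1) eA eB] by metis
    have "dof num k N T (e, a, \<gamma>) (restrict p T)
        = bernstein_dual num e (k - sum_list \<gamma>) a (\<lambda>x\<in>e. dir_derivs (concat (map2 replicate \<gamma> (N e))) p x)"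
      by (rule A.dof_eq[OF NA eA a\<gamma> p(1)]) simp
    moreover have "dof num k N T' (e, a, \<gamma>) (restrict p' T')
        = bernstein_dual num e (k - sum_list \<gamma>) a (\<lambda>x\<in>e. dir_derivs (concat (map2 replicate \<gamma> (N e))) p' x)"
      by (rule B.dof_eq[OF NB eB a\<gamma>' p(2)]) simp
    ultimately show "bernstein_dual num e (k - sum_list \<gamma>) a
        (\<lambda>x\<in>e. dir_derivs (concat (map2 replicate \<gamma> (N e))) ?q x) = 0"
      using dofs[OF eA eB a\<gamma>] A.dof_functional_linear[OF eA a\<gamma> NA p, of 1 "-1"] by linarith
  qed
  from A.derivatives_agree_on_face[OF NA f(1) q this x vs] have "dir_derivs vs ?q x = 0" .
  then show ?thesis using dir_derivs_diff[OF p, of vs] by simp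
qed

theorem theorem5p2:
  fixes \<Omega> :: "(real ^ 'd) set" and Th :: "(real ^ 'd) set set"
    and num :: "real ^ 'd \<Rightarrow> nat" and m k :: nat and r :: "nat \<Rightarrow> nat"
    and N :: "(real ^ 'd) set \<Rightarrow> (real ^ 'd) list"
  assumes domain: "open \<Omega>" "connected \<Omega>" "\<Omega> \<noteq> {}"
    and mesh: "triangulation Th" "\<forall>T\<in>Th. int CARD('d) simplex T" "\<Union>Th = closure \<Omega>"
    and numbering: "inj_on num (\<Union>T\<in>Th. verts T)"
    and r_top: "r CARD('d) = 0" "r (CARD('d) - 1) = m"
    and r_double: "\<forall>l. l + 2 \<le> CARD('d) \<longrightarrow> r l \<ge> 2 * r (l + 1)"
    and degree: "k \<ge> 2 * r 0 + 1"
    and normals: "\<forall>l<CARD('d). \<forall>f\<in>mesh_subsimplices l Th.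
      length (N f) = CARD('d) - l \<and> distinct (N f) \<and> independent (set (N f))
      \<and> span (set (N f)) = normal_plane f"
  shows "(\<forall>T\<in>Th.
            (\<forall>u\<in>poly_space k T. \<forall>v\<in>poly_space k T.
               (\<forall>i\<in>dof_index num k r T. dof num k N T i u = dof num k N T i v) \<longrightarrow> u = v)
            \<and> basis_of_dual T (poly_space k T) (dof_index num k r T) (dof num k N T))
       \<and> (\<forall>u\<in>fe_space Th num k r N.
            \<exists>w. C_diff_on m \<Omega> w \<and> (\<forall>T\<in>Th. \<forall>x\<in>T \<inter> \<Omega>. w x = u T x))"
proof -
  have mono: "r j \<le> r i" if "i \<le> j" "j < CARD('d)" for i j
    using that
  proof (induction j rule: dec_induct)
    case (step j)
    have "2 * r (j + 1) \<le> r j" using r_double step by simp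
    then show ?case using step by simp
  qed simp
  have num: "inj_on num (verts T)" if "T \<in> Th" for T
    using numbering that inj_on_subset by blast
  have N: "length (N f) = CARD('d) - l \<and> distinct (N f) \<and> span (set (N f)) = normal_plane f"
    if "T \<in> Th" "l < CARD('d)" "f \<in> subsimplices l T" for T l f
    using normals that unfolding mesh_subsimplices_def by blast
  have unisolvent: "(\<forall>u\<in>poly_space k T. \<forall>v\<in>poly_space k T.
        (\<forall>i\<in>dof_index num k r T. dof num k N T i u = dof num k N T i v) \<longrightarrow> u = v)
      \<and> basis_of_dual T (poly_space k T) (dof_index num k r T) (dof num k N T)"
    if T: "T \<in> Th" for T
  proof -
    obtain g b where "simplex_numbering T g b num"
      using simplex_numbering_exists mesh(2) num T by blast
    then interpret simplex_numbering T g b num .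
    have "normal_bases N" unfolding normal_bases_def using N[OF T] by blast
    from unisolvence[OF this r_top(1) mono r_double degree] show ?thesis by (intro conjI)
  qed
  have smooth: "\<exists>w. C_diff_on m \<Omega> w \<and> (\<forall>T\<in>Th. \<forall>x\<in>T \<inter> \<Omega>. w x = u T x)"
    if u: "u \<in> fe_space Th num k r N" for u
  proof -
  have "\<exists>q. poly_deg k q \<and> u T = restrict q T" if "T \<in> Th" for T
    using u that poly_space_iff[of "u T" k T] unfolding fe_space_def by blast
  then obtain p where p: "\<And>T. T \<in> Th \<Longrightarrow> poly_deg k (p T)" "\<And>T. T \<in> Th \<Longrightarrow> u T = restrict (p T) T"
    by metis
  have agree: "dir_derivs vs (p T) x = dir_derivs vs (p T') x"
    if T: "T \<in> Th" "T' \<in> Th" and x: "x \<in> T" "x \<in> T'" and vs: "length vs \<le> m" for T T' x vs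
  proof (cases "T = T'")
    case False
    let ?f = "T \<inter> T'"
    define l where "l = card (verts ?f) - 1"
    have simpl: "int CARD('d) simplex T" "int CARD('d) simplex T'" using mesh(2) T by auto
    have face: "?f face_of T" "?f face_of T'"
      using mesh(1) T unfolding triangulation_def by (blast, metis Int_commute)
    have f: "?f \<in> subsimplices l T" "?f \<in> subsimplices l T'"
      using face_of_simplex(2)[OF simpl(1) face(1)] face_of_simplex(2)[OF simpl(2) face(2)] x
      unfolding l_def by blast+
    \<comment> \<open>A common face of full dimension would be equal to both elements.\<close>
    have "l \<noteq> CARD('d)"
      using subsimplices_top(2)[OF simpl(1), of ?f] subsimplices_top(2)[OF simpl(2), of ?f] f False by metis
    moreover obtain g b where "simplex_numbering T g b num"
      using simplex_numbering_exists[OF simpl(1) num[OF T(1)]] .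
    ultimately have l: "l < CARD('d)"
      using simplex_numbering.subsimplices_dim_le[OF _ f(1)] by fastforce
    show ?thesis
    proof (rule common_derivatives[OF simpl(1) num[OF T(1)] simpl(2) num[OF T(2)] _ f p(1)[OF T(1)] p(1)[OF T(2)]])
      show "length (N f) = CARD('d) - l \<and> distinct (N f) \<and> span (set (N f)) = normal_plane f"
        if "S \<in> {T, T'}" "l < CARD('d)" "f \<in> subsimplices l S" for l f S
        using N that T by blast
      show "x \<in> ?f" using x by simp
      have "l \<le> CARD('d) - 1" "CARD('d) - 1 < CARD('d)" using l by linarith+
      from mono[OF this] show "length vs \<le> r l" using vs r_top(2) by linarith
      fix i e a \<gamma> assume e: "e \<in> subsimplices i T" "e \<in> subsimplices i T'"
        and a\<gamma>: "(a, \<gamma>) \<in> S_hat num k r T i e"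
      have "i \<le> CARD('d)"
        using simplex_numbering.subsimplices_dim_le[OF \<open>simplex_numbering T g b num\<close> e(1)] .
      then have "dof num k N T (e, a, \<gamma>) (u T) = dof num k N T' (e, a, \<gamma>) (u T')"
        using u T e a\<gamma> unfolding fe_space_def by fast
      then show "dof num k N T (e, a, \<gamma>) (restrict (p T) T) = dof num k N T' (e, a, \<gamma>) (restrict (p T') T')"
        using p(2) T by simp
    qed
  qed simp
  have closed: "closed T" if "T \<in> Th" for T
    using mesh(2) that simplex_imp_polytope polytope_imp_closed by blast
  have fin: "finite Th" using mesh(1) by (simp add: triangulation_def)
  have sub: "\<Omega> \<subseteq> \<Union>Th" using mesh(3) closure_subset by simp
  have "\<exists>w. C_diff_on m \<Omega> w \<and> (\<forall>T\<in>Th. \<forall>x\<in>T. w x = p T x)"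
    by (rule piecewise_polynomial_C_diff[of \<Omega> Th k p m, OF domain(1) sub fin])
      (use closed p(1) agree in blast)+
  then obtain w where "C_diff_on m \<Omega> w" "\<forall>T\<in>Th. \<forall>x\<in>T. w x = p T x" by (elim exE conjE)
  then show ?thesis using p(2) by (intro exI[of _ w]) simp
  qed
  show ?thesis using unisolvent smooth by blast
qed

end
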